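(* Let $A_4\subset A_5$ be a subgroup isomorphic to the alternating group on four letters, acting on Bring's curve $\mathcal{B}$ by even permutations of coordinates. The quotient curve $\mathcal{B}/_{A_4}$ is given by (i.e. is isomorphic over $\mathbb{C}$ to the curve with) the equation $$y^2 + xy + y = x^3 + 549x - 2202.$$
   Context: Bring's curve $\mathcal{B}\subset\mathbb{CP}^4$ is the genus-4 curve defined by $\sum_{i=1}^5 x_i=\sum_{i=1}^5 x_i^2=\sum_{i=1}^5 x_i^3=0$. The group $A_5$ acts on $\mathcal{B}$ by even permutations of the five homogeneous coordinates (it is the automorphism group of the dessin d'enfant $I_4$, the icosahedron of genus 4, embedded in $\mathcal{B}$). For a subgroup $G\subset A_5$, $\mathcal{B}/_G$ denotes the quotient compact Riemann surface. The curve given by an affine equation means the compact Riemann surface (smooth projective model) of that affine curve over $\mathbb{C}$. *)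

theory Defs
  imports
    "HOL-Complex_Analysis.Complex_Analysis"
    "HOL-Algebra.Sym_Groups"
begin

text \<open>
  Complex analytic spaces are represented by a topological space together with its sheaf of
  holomorphic functions. Functions are total, so \<open>hol X U f\<close> is meant to depend only on the
  values of \<open>f\<close> on the open set \<open>U\<close>; it is only relevant for \<open>U\<close> open in \<open>topo X\<close>.
\<close>

record 'a fun_space =
  topo :: "'a topology"
  hol :: "'a set \<Rightarrow> ('a \<Rightarrow> complex) \<Rightarrow> bool"

abbreviation points :: "'a fun_space \<Rightarrow> 'a set"
  where "points X \<equiv> topspace (topo X)"

text \<open>\<open>f\<close> agrees on \<open>U\<close>, near every point of \<open>U\<close>, with a holomorphic function on an open set of \<open>X\<close>.\<close>

definition locally_hol :: "'a fun_space \<Rightarrow> 'a set \<Rightarrow> ('a \<Rightarrow> complex) \<Rightarrow> bool"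
  where "locally_hol X U f \<longleftrightarrow>
    (\<forall>p\<in>U. \<exists>V F. openin (topo X) V \<and> p \<in> V \<and> hol X V F \<and> (\<forall>q\<in>U \<inter> V. f q = F q))"

text \<open>Extensionality, restriction and gluing in one condition.\<close>

definition is_sheaf :: "'a fun_space \<Rightarrow> bool"
  where "is_sheaf X \<longleftrightarrow> (\<forall>U f. openin (topo X) U \<longrightarrow> (hol X U f \<longleftrightarrow> locally_hol X U f))"

definition isomorphic :: "'a fun_space \<Rightarrow> 'b fun_space \<Rightarrow> bool"
  where "isomorphic X Y \<longleftrightarrow>
    (\<exists>h. homeomorphic_map (topo X) (topo Y) h \<and>
      (\<forall>V f. openin (topo Y) V \<longrightarrow>
        (hol Y V f \<longleftrightarrow> hol X {x \<in> points X. h x \<in> V} (f \<circ> h))))"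

definition subspace_of :: "'a fun_space \<Rightarrow> 'a set \<Rightarrow> 'a fun_space"
  where "subspace_of X S = \<lparr>topo = subtopology (topo X) S, hol = locally_hol X\<rparr>"

definition quotient_topology :: "'a topology \<Rightarrow> ('a \<Rightarrow> 'b) \<Rightarrow> 'b topology"
  where "quotient_topology T \<pi> =
    topology (\<lambda>U. U \<subseteq> \<pi> ` topspace T \<and> openin T {x \<in> topspace T. \<pi> x \<in> U})"

lemma openin_quotient_topology:
  "openin (quotient_topology T \<pi>) U \<longleftrightarrow>
    U \<subseteq> \<pi> ` topspace T \<and> openin T {x \<in> topspace T. \<pi> x \<in> U}"
proof -
  have "istopology (\<lambda>U. U \<subseteq> \<pi> ` topspace T \<and> openin T {x \<in> topspace T. \<pi> x \<in> U})"
    unfolding istopology_def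
  proof (intro conjI allI impI)
    fix A B
    assume A: "A \<subseteq> \<pi> ` topspace T \<and> openin T {x \<in> topspace T. \<pi> x \<in> A}"
      and B: "B \<subseteq> \<pi> ` topspace T \<and> openin T {x \<in> topspace T. \<pi> x \<in> B}"
    show "A \<inter> B \<subseteq> \<pi> ` topspace T" using A by blast
    have "{x \<in> topspace T. \<pi> x \<in> A \<inter> B} =
        {x \<in> topspace T. \<pi> x \<in> A} \<inter> {x \<in> topspace T. \<pi> x \<in> B}" by blast
    then show "openin T {x \<in> topspace T. \<pi> x \<in> A \<inter> B}" using A B by auto
  next
    fix \<K>
    assume K: "\<forall>A\<in>\<K>. A \<subseteq> \<pi> ` topspace T \<and> openin T {x \<in> topspace T. \<pi> x \<in> A}"
    show "\<Union>\<K> \<subseteq> \<pi> ` topspace T" using K by blast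
    have "{x \<in> topspace T. \<pi> x \<in> \<Union>\<K>} = (\<Union>A\<in>\<K>. {x \<in> topspace T. \<pi> x \<in> A})" by blast
    then show "openin T {x \<in> topspace T. \<pi> x \<in> \<Union>\<K>}" using K by auto
  qed
  then show ?thesis
    unfolding quotient_topology_def by (simp add: topology_inverse')
qed

lemma topspace_quotient_topology [simp]:
  "topspace (quotient_topology T \<pi>) = \<pi> ` topspace T"
proof
  show "topspace (quotient_topology T \<pi>) \<subseteq> \<pi> ` topspace T"
    using openin_quotient_topology openin_topspace by metis
  have "{x \<in> topspace T. \<pi> x \<in> \<pi> ` topspace T} = topspace T" by blast
  then have "openin (quotient_topology T \<pi>) (\<pi> ` topspace T)"
    by (simp add: openin_quotient_topology)
  then show "\<pi> ` topspace T \<subseteq> topspace (quotient_topology T \<pi>)"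
    by (rule openin_subset)
qed

lemma quotient_map_quotient_topology: "quotient_map T (quotient_topology T \<pi>) \<pi>"
  by (simp add: quotient_map_def openin_quotient_topology)

text \<open>A function on the quotient is holomorphic iff its pullback along the projection is.\<close>

definition quotient_of :: "'a fun_space \<Rightarrow> ('a \<Rightarrow> 'b) \<Rightarrow> 'b fun_space"
  where "quotient_of X \<pi> =
    \<lparr>topo = quotient_topology (topo X) \<pi>,
     hol = (\<lambda>U f. hol X {x \<in> points X. \<pi> x \<in> U} (f \<circ> \<pi>))\<rparr>"

definition complex_plane :: "complex fun_space"
  where "complex_plane = \<lparr>topo = euclidean, hol = (\<lambda>U f. f holomorphic_on U)\<rparr>"

text \<open>Holomorphy in several variables: the real derivative at each point is complex linear.\<close>

definition affine_space :: "(complex^'n) fun_space"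
  where "affine_space = \<lparr>topo = euclidean,
    hol = (\<lambda>U f. \<forall>x\<in>U. \<exists>a::complex^'n. (f has_derivative (\<lambda>v. \<Sum>i\<in>UNIV. a $ i * v $ i)) (at x))\<rparr>"

text \<open>
  The point of projective space with homogeneous coordinates \<open>x\<close>, as a line through the origin.
\<close>

definition proj_point :: "complex^'n \<Rightarrow> (complex^'n) set"
  where "proj_point x = range (\<lambda>c. c *s x)"

text \<open>The projective space of the vector space \<open>complex^'n\<close>; its dimension is \<open>CARD('n) - 1\<close>.\<close>

definition projective_space :: "(complex^'n) set fun_space"
  where "projective_space = quotient_of (subspace_of affine_space (- {0})) proj_point"

text \<open>
  Second countability need not be required: it is automatic for compact surfaces.
\<close>

definition compact_riemann_surface :: "'a fun_space \<Rightarrow> bool"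
  where "compact_riemann_surface X \<longleftrightarrow>
    is_sheaf X \<and> points X \<noteq> {} \<and>
    compact_space (topo X) \<and> connected_space (topo X) \<and> Hausdorff_space (topo X) \<and>
    (\<forall>p\<in>points X. \<exists>U W. openin (topo X) U \<and> p \<in> U \<and> open W \<and>
      isomorphic (subspace_of X U) (subspace_of complex_plane W))"

text \<open>
  \<open>Y\<close> is the compact Riemann surface (smooth projective model) of the affine curve \<open>C\<close>: the two
  become isomorphic after removing finitely many points (points at infinity, singular points)
  from each. By the removable singularity theorem this determines \<open>Y\<close> up to isomorphism.
\<close>

definition smooth_projective_model :: "'a fun_space \<Rightarrow> 'b fun_space \<Rightarrow> bool"
  where "smooth_projective_model Y C \<longleftrightarrow>
    compact_riemann_surface Y \<and>
    (\<exists>S T. finite S \<and> finite T \<and>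
      isomorphic (subspace_of Y (points Y - S)) (subspace_of C (points C - T)))"

definition affine_plane_curve :: "(complex \<Rightarrow> complex \<Rightarrow> bool) \<Rightarrow> (complex^2) fun_space"
  where "affine_plane_curve P = subspace_of affine_space {v. P (v $ 1) (v $ 2)}"

definition bring_curve :: "(complex^5) set fun_space"
  where "bring_curve = subspace_of projective_space
    {proj_point x | x. x \<noteq> 0 \<and>
      (\<Sum>i\<in>UNIV. x $ i) = 0 \<and> (\<Sum>i\<in>UNIV. (x $ i)^2) = 0 \<and> (\<Sum>i\<in>UNIV. (x $ i)^3) = 0}"

text \<open>
  The alternating group on an arbitrary set; \<open>alternating_group {1..n}\<close> is \<open>alt_group n\<close>.
\<close>

definition alternating_group :: "'a set \<Rightarrow> ('a \<Rightarrow> 'a) monoid"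
  where "alternating_group A =
    \<lparr>carrier = {p. p permutes A \<and> evenperm p}, mult = (\<circ>), one = id\<rparr>"

text \<open>Left action: the coordinate \<open>x\<^sub>i\<close> is moved to position \<open>p i\<close>.\<close>

definition permute_coords :: "('n \<Rightarrow> 'n) \<Rightarrow> (complex^'n) set \<Rightarrow> (complex^'n) set"
  where "permute_coords p L = (\<lambda>x. \<chi> i. x $ (inv_into UNIV p i)) ` L"

text \<open>The points of the quotient are the orbits.\<close>

definition bring_quotient :: "(5 \<Rightarrow> 5) set \<Rightarrow> (complex^5) set set fun_space"
  where "bring_quotient H = quotient_of bring_curve (\<lambda>L. (\<lambda>p. permute_coords p L) ` H)"

end

theory Submission
  imports Defs "HOL-Algebra.Group_Action" "HOL-Computational_Algebra.Fundamental_Theorem_Algebra"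
begin

text \<open>
  A subgroup of order 12 of the alternating group of degree 5 fixes one of the coordinates, say
  \<open>t\<close>. The other four coordinates of a point of Bring's curve are the roots of
  \<open>X\<^sup>4 + t X\<^sup>3 + t\<^sup>2 X\<^sup>2 + t\<^sup>3 X + s\<close>, whose discriminant is
  \<open>256 s\<^sup>3 - 203 s\<^sup>2 t\<^sup>4 + 88 s t\<^sup>8 - 16 t\<^sup>1\<^sup>2\<close>. With the square root
  \<open>w\<close> of the discriminant given by the Vandermonde product, the map
  \<open>x \<mapsto> (s t\<^sup>2 : w : t\<^sup>6)\<close> to the projective plane has no base points on Bring's curve, its
  fibres are the orbits, and its image is the cubic
  \<open>Y\<^sup>2 Z = 256 X\<^sup>3 - 203 X\<^sup>2 Z + 88 X Z\<^sup>2 - 16 Z\<^sup>3\<close>; the substitution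
  \<open>x = 64 X - 17\<close>, \<open>2 y + x + 1 = 64 Y\<close> turns its affine part into the given equation.

  The cubic carries the topology and the holomorphic functions of the quotient of Bring's curve.
  That its usual local coordinates are charts for this structure needs holomorphic local sections
  of the projection, which exist away from four points because simple roots of the quartic depend
  holomorphically on \<open>s\<close>; the four points are removable singularities.
\<close>

text \<open>The work is done on the cone in C^5 and not in charts of Bring's curve: a function on
  the quotient is holomorphic when its pullback to the cone extends locally to holomorphic
  functions, homogeneous of degree 0, on open cones of C^5. This makes the two directions of the
  comparison with the cubic unequal. A function of one of the coordinates X/Z, Y/Z, X/Y extends at
  once, since these pull back to ratios of polynomials on C^5; the converse needs holomorphic curves
  leading from the cubic back into the cone, and this is what the sections are for. The topology
  shows the same asymmetry: maps out of a quotient are easy to handle, maps into it are not.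
  Compactness helps: a continuous injection of the quotient into a space of matrices is an
  embedding, so continuity into the quotient can be tested on matrices. The four exceptional points
  are the point at infinity and the three zeros of the discriminant, where roots of the quartic
  collide. Crossing them requires that holomorphic functions on the quotient are known to be
  continuous.\<close>

no_notation fps_nth (infixl "$" 75)

section \<open>Sheaves of holomorphic functions\<close>

lemma locally_hol_subset:
  assumes "locally_hol X U f" "V \<subseteq> U"
  shows "locally_hol X V f"
  unfolding locally_hol_def
proof
  fix p assume "p \<in> V"
  then obtain W F where "openin (topo X) W" "p \<in> W" "hol X W F" "\<forall>q\<in>U \<inter> W. f q = F q"
    using assms unfolding locally_hol_def by blast
  then show "\<exists>W F. openin (topo X) W \<and> p \<in> W \<and> hol X W F \<and> (\<forall>q\<in>V \<inter> W. f q = F q)"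
    using assms(2) by (intro exI[of _ W] exI[of _ F]) auto
qed

lemma hol_imp_locally_hol: "openin (topo X) U \<Longrightarrow> hol X U f \<Longrightarrow> locally_hol X U f"
  unfolding locally_hol_def by auto

lemma is_sheafD: "is_sheaf X \<Longrightarrow> openin (topo X) U \<Longrightarrow> hol X U f \<longleftrightarrow> locally_hol X U f"
  unfolding is_sheaf_def by blast

lemma is_sheaf_hol_subset:
  assumes "is_sheaf X" "openin (topo X) U" "openin (topo X) V" "hol X U f" "V \<subseteq> U"
  shows "hol X V f"
  using assms locally_hol_subset is_sheafD by metis

lemma topo_subspace_of [simp]: "topo (subspace_of X S) = subtopology (topo X) S"
  and hol_subspace_of [simp]: "hol (subspace_of X S) = locally_hol X"
  by (simp_all add: subspace_of_def)

lemma topo_quotient_of [simp]: "topo (quotient_of X \<pi>) = quotient_topology (topo X) \<pi>"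
  and hol_quotient_of [simp]:
    "hol (quotient_of X \<pi>) U f = hol X {x \<in> points X. \<pi> x \<in> U} (f \<circ> \<pi>)"
  by (simp_all add: quotient_of_def)

text \<open>Extending locally twice is extending locally once: a function on the subspace near a
  point is itself the trace of an ambient one, and the sheaf property allows the latter to be
  restricted to a smaller open set.\<close>

lemma locally_hol_subspace_of:
  assumes X: "is_sheaf X" and "U \<subseteq> S"
  shows "locally_hol (subspace_of X S) U f \<longleftrightarrow> locally_hol X U f"
proof
  assume l: "locally_hol X U f"
  show "locally_hol (subspace_of X S) U f"
    unfolding locally_hol_def
  proof
    fix p assume p: "p \<in> U"
    then obtain V F where V: "openin (topo X) V" "p \<in> V" "hol X V F" "\<forall>q\<in>U \<inter> V. f q = F q"
      using l unfolding locally_hol_def by blast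
    have "locally_hol X (V \<inter> S) F"
      using hol_imp_locally_hol[OF V(1,3)] locally_hol_subset by blast
    moreover have "openin (subtopology (topo X) S) (V \<inter> S)"
      using V(1) openin_subtopology by blast
    ultimately show "\<exists>V F. openin (topo (subspace_of X S)) V \<and> p \<in> V
        \<and> hol (subspace_of X S) V F \<and> (\<forall>q\<in>U \<inter> V. f q = F q)"
      using V p assms(2) by (intro exI[of _ "V \<inter> S"] exI[of _ F]) auto
  qed
next
  assume l: "locally_hol (subspace_of X S) U f"
  show "locally_hol X U f"
    unfolding locally_hol_def
  proof
    fix p assume p: "p \<in> U"
    then obtain V F where V: "openin (subtopology (topo X) S) V" "p \<in> V" "locally_hol X V F"
        "\<forall>q\<in>U \<inter> V. f q = F q"
      using l unfolding locally_hol_def[of "subspace_of X S"] by auto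
    obtain V' where V': "openin (topo X) V'" "V = V' \<inter> S"
      using V(1) by (auto simp: openin_subtopology)
    obtain V2 F2 where V2: "openin (topo X) V2" "p \<in> V2" "hol X V2 F2" "\<forall>q\<in>V \<inter> V2. F q = F2 q"
      using V(2,3) unfolding locally_hol_def by blast
    have o: "openin (topo X) (V' \<inter> V2)" using V' V2 by blast
    have "hol X (V' \<inter> V2) F2"
      using is_sheaf_hol_subset[OF X V2(1) o V2(3)] by auto
    moreover have "\<forall>q\<in>U \<inter> (V' \<inter> V2). f q = F2 q" using V V2 V' assms(2) by auto
    ultimately show "\<exists>V F. openin (topo X) V \<and> p \<in> V \<and> hol X V F \<and> (\<forall>q\<in>U \<inter> V. f q = F q)"
      using o V(2) V'(2) V2(2) by blast
  qed
qed

lemma is_sheaf_subspace_of: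
  assumes "is_sheaf X" shows "is_sheaf (subspace_of X S)"
  unfolding is_sheaf_def
proof (intro allI impI)
  fix U f assume "openin (topo (subspace_of X S)) U"
  then have "U \<subseteq> S" using openin_subset by fastforce
  then show "hol (subspace_of X S) U f = locally_hol (subspace_of X S) U f"
    using locally_hol_subspace_of[OF assms] by simp
qed

lemma is_sheaf_quotient_of:
  assumes X: "is_sheaf X" shows "is_sheaf (quotient_of X \<pi>)"
  unfolding is_sheaf_def
proof (intro allI impI iffI)
  fix U f assume U: "openin (topo (quotient_of X \<pi>)) U"
  {
    assume "hol (quotient_of X \<pi>) U f"
    then show "locally_hol (quotient_of X \<pi>) U f" using U hol_imp_locally_hol by blast
  }
  assume l: "locally_hol (quotient_of X \<pi>) U f"
  have o: "openin (topo X) {x \<in> points X. \<pi> x \<in> V}" if "openin (topo (quotient_of X \<pi>)) V" for V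
    using that by (simp add: openin_quotient_topology)
  have "locally_hol X {x \<in> points X. \<pi> x \<in> U} (f \<circ> \<pi>)"
    unfolding locally_hol_def
  proof
    fix x assume x: "x \<in> {x \<in> points X. \<pi> x \<in> U}"
    then obtain V F where V: "openin (topo (quotient_of X \<pi>)) V" "\<pi> x \<in> V"
        "hol (quotient_of X \<pi>) V F" "\<forall>q\<in>U \<inter> V. f q = F q"
      using l unfolding locally_hol_def by blast
    show "\<exists>V F. openin (topo X) V \<and> x \<in> V \<and> hol X V F
        \<and> (\<forall>q\<in>{x \<in> points X. \<pi> x \<in> U} \<inter> V. (f \<circ> \<pi>) q = F q)"
      using o[OF V(1)] V x by (intro exI[of _ "{x \<in> points X. \<pi> x \<in> V}"] exI[of _ "F \<circ> \<pi>"]) auto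
  qed
  then show "hol (quotient_of X \<pi>) U f" using is_sheafD[OF X o[OF U]] by simp
qed

lemma is_sheaf_complex_plane: "is_sheaf complex_plane"
  unfolding is_sheaf_def
proof (intro allI impI iffI)
  fix U :: "complex set" and f assume U: "openin (topo complex_plane) U"
  {
    assume "hol complex_plane U f"
    then show "locally_hol complex_plane U f" using U hol_imp_locally_hol by blast
  }
  assume l: "locally_hol complex_plane U f"
  have U: "open U" using U by (simp add: complex_plane_def)
  have "f field_differentiable at p" if p: "p \<in> U" for p
  proof -
    obtain V F where V: "open V" "p \<in> V" "F holomorphic_on V" "\<forall>q\<in>U \<inter> V. f q = F q"
      using l p unfolding locally_hol_def complex_plane_def by auto
    obtain F' where F': "(F has_field_derivative F') (at p)"
      using V holomorphic_on_open by blast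
    have "(f has_field_derivative F') (at p)"
      by (rule has_field_derivative_transform_within_open[OF F', of "U \<inter> V"]) (use V U p in auto)
    then show ?thesis unfolding field_differentiable_def by blast
  qed
  then show "hol complex_plane U f"
    using field_differentiable_at_within by (auto simp: complex_plane_def holomorphic_on_def)
qed

section \<open>Holomorphic functions of several variables\<close>

text \<open>The pointwise condition behind \<open>hol affine_space\<close>; the coefficient vector
  \<open>a\<close> is the complex gradient.\<close>

definition cdiff_at :: "(complex^'n \<Rightarrow> complex) \<Rightarrow> complex^'n \<Rightarrow> bool"
  where "cdiff_at f x \<longleftrightarrow> (\<exists>a. (f has_derivative (\<lambda>v. \<Sum>i\<in>UNIV. a $ i * v $ i)) (at x))"

lemma topo_affine_space [simp]: "topo affine_space = euclidean"
  and hol_affine_space [simp]: "hol affine_space U f \<longleftrightarrow> (\<forall>x\<in>U. cdiff_at f x)"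
  by (simp_all add: affine_space_def cdiff_at_def)

lemma cdiff_at_transform:
  assumes "cdiff_at f x" "open U" "x \<in> U" "\<And>y. y \<in> U \<Longrightarrow> f y = g y"
  shows "cdiff_at g x"
  using assms unfolding cdiff_at_def by (meson has_derivative_transform_within_open)

lemma cdiff_at_const [simp]: "cdiff_at (\<lambda>x. c) x"
  unfolding cdiff_at_def by (rule exI[of _ 0]) simp

lemma cdiff_at_nth [simp]: "cdiff_at (\<lambda>x. x $ j) x"
  unfolding cdiff_at_def
proof (rule exI[of _ "\<chi> i. if i = j then 1 else 0"])
  have "(\<lambda>v::complex^'a. \<Sum>i\<in>UNIV. (\<chi> i. if i = j then 1 else 0) $ i * v $ i) = (\<lambda>v. v $ j)"
    by (simp add: if_distrib[of "\<lambda>x. x * _"] cong: if_cong)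
  then show "((\<lambda>x. x $ j) has_derivative (\<lambda>v::complex^'a. \<Sum>i\<in>UNIV. (\<chi> i. if i = j then 1 else 0) $ i * v $ i)) (at x)"
    using bounded_linear_imp_has_derivative[OF bounded_linear_vec_nth] by metis
qed

lemma cdiff_at_compose:
  assumes "cdiff_at f x" "g field_differentiable at (f x)"
  shows "cdiff_at (\<lambda>x. g (f x)) x"
proof -
  obtain a where a: "(f has_derivative (\<lambda>v. \<Sum>i\<in>UNIV. a $ i * v $ i)) (at x)"
    using assms(1) cdiff_at_def by blast
  obtain g' where "(g has_field_derivative g') (at (f x))"
    using assms(2) field_differentiable_def by blast
  then have "((\<lambda>x. g (f x)) has_derivative (\<lambda>v. g' * (\<Sum>i\<in>UNIV. a $ i * v $ i))) (at x)"
    using has_derivative_compose[OF a] unfolding has_field_derivative_def by auto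
  moreover have "(\<lambda>v. g' * (\<Sum>i\<in>UNIV. a $ i * v $ i)) = (\<lambda>v. \<Sum>i\<in>UNIV. (g' *s a) $ i * v $ i)"
    by (simp add: sum_distrib_left mult.assoc)
  ultimately show ?thesis unfolding cdiff_at_def by metis
qed

lemma cdiff_at_add [simp]:
  assumes "cdiff_at f x" "cdiff_at g x"
  shows "cdiff_at (\<lambda>x. f x + g x) x"
proof -
  obtain a b where "(f has_derivative (\<lambda>v. \<Sum>i\<in>UNIV. a $ i * v $ i)) (at x)"
      "(g has_derivative (\<lambda>v. \<Sum>i\<in>UNIV. b $ i * v $ i)) (at x)"
    using assms cdiff_at_def by blast
  then have "((\<lambda>x. f x + g x) has_derivative (\<lambda>v. \<Sum>i\<in>UNIV. (a + b) $ i * v $ i)) (at x)"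
    by (auto simp: algebra_simps sum.distrib intro!: derivative_eq_intros)
  then show ?thesis unfolding cdiff_at_def by metis
qed

lemma cdiff_at_mult [simp]:
  assumes "cdiff_at f x" "cdiff_at g x"
  shows "cdiff_at (\<lambda>x. f x * g x) x"
proof -
  obtain a b where "(f has_derivative (\<lambda>v. \<Sum>i\<in>UNIV. a $ i * v $ i)) (at x)"
      "(g has_derivative (\<lambda>v. \<Sum>i\<in>UNIV. b $ i * v $ i)) (at x)"
    using assms cdiff_at_def by blast
  then have "((\<lambda>x. f x * g x) has_derivative (\<lambda>v. \<Sum>i\<in>UNIV. (f x *s b + g x *s a) $ i * v $ i)) (at x)"
    by (auto simp: algebra_simps sum.distrib sum_distrib_left intro!: derivative_eq_intros)
  then show ?thesis unfolding cdiff_at_def by metis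
qed

lemma cdiff_at_diff [simp]:
  assumes "cdiff_at f x" "cdiff_at g x"
  shows "cdiff_at (\<lambda>x. f x - g x) x"
  using cdiff_at_add[OF assms(1) cdiff_at_mult[OF cdiff_at_const[of "-1"] assms(2)]] by simp

lemma cdiff_at_power [simp]:
  assumes "cdiff_at f x"
  shows "cdiff_at (\<lambda>x. f x ^ n) x"
  by (induction n) (use assms in auto)

lemma cdiff_at_divide:
  assumes "cdiff_at f x" "cdiff_at g x" "g x \<noteq> 0"
  shows "cdiff_at (\<lambda>x. f x / g x) x"
proof -
  have "inverse field_differentiable at (g x)"
    using assms(3) DERIV_inverse unfolding field_differentiable_def by blast
  then have "cdiff_at (\<lambda>x. inverse (g x)) x" using assms(2) by (rule cdiff_at_compose[rotated])
  then show ?thesis using cdiff_at_mult[OF assms(1)] by (simp add: divide_inverse)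
qed

lemma cdiff_at_imp_continuous: "cdiff_at f x \<Longrightarrow> isCont f x"
  unfolding cdiff_at_def using has_derivative_continuous by blast

text \<open>The chain rule along a holomorphic curve. Functions on C^5 or C^2 are brought into a
  chart of the quotient in this way.\<close>

lemma cdiff_at_curve:
  fixes \<gamma> :: "complex \<Rightarrow> complex^'n"
  assumes "cdiff_at f (\<gamma> z)" "\<And>i. (\<lambda>z. \<gamma> z $ i) field_differentiable at z"
  shows "(\<lambda>z. f (\<gamma> z)) field_differentiable at z"
proof -
  obtain a where a: "(f has_derivative (\<lambda>v. \<Sum>i\<in>UNIV. a $ i * v $ i)) (at (\<gamma> z))"
    using assms(1) cdiff_at_def by blast
  obtain d where d: "\<And>i. ((\<lambda>z. \<gamma> z $ i) has_field_derivative d i) (at z)"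
    using assms(2) unfolding field_differentiable_def by metis
  have "(\<gamma> has_derivative (\<lambda>h. \<chi> i. d i * h)) (at z)"
    \<comment> \<open>Components here refer to the real basis of C^n, whose vectors
      \<open>axis i u\<close> pick the real or the imaginary part of one complex coordinate.\<close>
    unfolding has_derivative_componentwise_within[of \<gamma>]
  proof
    fix b :: "complex^'n" assume "b \<in> Basis"
    then obtain i u where b: "b = axis i u" "u \<in> Basis" by (auto simp: Basis_vec_def)
    have "((\<lambda>x. \<gamma> x $ i \<bullet> u) has_derivative (\<lambda>y. (d i * y) \<bullet> u)) (at z)"
      using d[of i] unfolding has_field_derivative_def by (rule has_derivative_inner_left)
    then show "((\<lambda>x. \<gamma> x \<bullet> b) has_derivative (\<lambda>y. (\<chi> i. d i * y) \<bullet> b)) (at z)"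
      by (simp add: b inner_axis)
  qed
  from has_derivative_compose[OF this a]
  have "((\<lambda>z. f (\<gamma> z)) has_derivative (\<lambda>h. (\<Sum>i\<in>UNIV. a $ i * d i) * h)) (at z)"
    by (simp add: sum_distrib_right mult.assoc)
  then show ?thesis unfolding field_differentiable_def has_field_derivative_def by auto
qed

lemma is_sheaf_affine_space: "is_sheaf (affine_space :: (complex^'n) fun_space)"
  unfolding is_sheaf_def
proof (intro allI impI iffI)
  fix U :: "(complex^'n) set" and f assume U: "openin (topo affine_space) U"
  {
    assume "hol affine_space U f"
    then show "locally_hol affine_space U f" using U hol_imp_locally_hol by blast
  }
  assume l: "locally_hol affine_space U f"
  have "cdiff_at f p" if p: "p \<in> U" for p
  proof -
    obtain V F where V: "open V" "p \<in> V" "\<forall>x\<in>V. cdiff_at F x" "\<forall>q\<in>U \<inter> V. f q = F q"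
      using l p unfolding locally_hol_def by auto
    then show ?thesis
      using U p by (intro cdiff_at_transform[of F p "U \<inter> V" f]) auto
  qed
  then show "hol affine_space U f" by simp
qed

section \<open>Projective space\<close>

lemma proj_point_eq_iff:
  assumes "x \<noteq> 0"
  shows "proj_point x = proj_point y \<longleftrightarrow> (\<exists>c. c \<noteq> 0 \<and> y = c *s x)"
proof
  assume e: "proj_point x = proj_point y"
  have "x = 1 *s x" "y = 1 *s y" by simp_all
  then have "x \<in> proj_point y" "y \<in> proj_point x" using e unfolding proj_point_def by blast+
  then obtain c d where c: "y = c *s x" and d: "x = d *s y" unfolding proj_point_def by blast
  then have "c \<noteq> 0" using assms by auto
  then show "\<exists>c. c \<noteq> 0 \<and> y = c *s x" using c by blast
next
  assume "\<exists>c. c \<noteq> 0 \<and> y = c *s x"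
  then obtain c where c: "c \<noteq> 0" "y = c *s x" by blast
  have "d *s x = (d / c) *s y" "d *s y = (d * c) *s x" for d using c by simp_all
  then have "d *s x \<in> proj_point y" "d *s y \<in> proj_point x" for d
    unfolding proj_point_def by (metis rangeI)+
  then show "proj_point x = proj_point y"
    unfolding proj_point_def by blast
qed

lemma proj_point_scale [simp]: "c \<noteq> 0 \<Longrightarrow> proj_point (c *s x) = proj_point x"
proof (cases "x = 0")
  case False
  then show "proj_point (c *s x) = proj_point x" if "c \<noteq> 0"
    using proj_point_eq_iff[OF False, of "c *s x"] that by auto
qed simp

lemma quotient_map_proj_point:
  "quotient_map (top_of_set (- {0})) (topo projective_space) proj_point"
  unfolding projective_space_def by (simp add: quotient_map_quotient_topology)

lemma points_projective_space [simp]: "points projective_space = proj_point ` (- {0})"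
  unfolding projective_space_def by simp

lemma openin_projective_space:
  "openin (topo projective_space) V \<longleftrightarrow> V \<subseteq> proj_point ` (- {0}) \<and> open {x. x \<noteq> 0 \<and> proj_point x \<in> V}"
proof -
  have "{x \<in> - {0}. proj_point x \<in> V} = {x. x \<noteq> 0 \<and> proj_point x \<in> V}" by auto
  moreover have "openin (top_of_set (- {0})) {x. x \<noteq> 0 \<and> proj_point x \<in> V} \<longleftrightarrow> open {x. x \<noteq> 0 \<and> proj_point x \<in> V}"
    by (subst openin_open_eq) auto
  ultimately show ?thesis
    unfolding projective_space_def by (simp add: openin_quotient_topology)
qed

lemma is_sheaf_projective_space: "is_sheaf projective_space"
  unfolding projective_space_def
  by (intro is_sheaf_quotient_of is_sheaf_subspace_of is_sheaf_affine_space)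

lemma hol_projective_space_iff:
  assumes "openin (topo projective_space) V"
  shows "hol projective_space V F \<longleftrightarrow> (\<forall>x. x \<noteq> 0 \<longrightarrow> proj_point x \<in> V \<longrightarrow> cdiff_at (F \<circ> proj_point) x)"
proof -
  have o: "open {x. x \<noteq> 0 \<and> proj_point x \<in> V}" using assms openin_projective_space by auto
  have "hol projective_space V F \<longleftrightarrow> locally_hol affine_space {x. x \<noteq> 0 \<and> proj_point x \<in> V} (F \<circ> proj_point)"
    unfolding projective_space_def by simp
  also have "\<dots> \<longleftrightarrow> hol affine_space {x. x \<noteq> 0 \<and> proj_point x \<in> V} (F \<circ> proj_point)"
    by (rule is_sheafD[OF is_sheaf_affine_space, symmetric]) (use o in simp)
  finally show ?thesis by auto
qed

text \<open>A holomorphic function that is homogeneous of degree 0 on an open cone descends to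
  projective space. \<open>F\<close> evaluates \<open>G\<close> at an arbitrary representative,
  which homogeneity makes harmless.\<close>

lemma hol_projective_space_extension:
  fixes N :: "(complex^'n) set"
  assumes N: "open N" "0 \<notin> N"
    and cone: "\<And>x c. x \<in> N \<Longrightarrow> c \<noteq> 0 \<Longrightarrow> c *s x \<in> N \<and> G (c *s x) = G x"
    and G: "\<And>x. x \<in> N \<Longrightarrow> cdiff_at G x"
  obtains V F where "openin (topo projective_space) V" "hol projective_space V F"
    "\<And>x. x \<noteq> 0 \<Longrightarrow> proj_point x \<in> V \<longleftrightarrow> x \<in> N" "\<And>x. x \<in> N \<Longrightarrow> F (proj_point x) = G x"
proof -
  define V where "V = proj_point ` N"
  define F where "F L = G (SOME x. x \<in> N \<and> proj_point x = L)" for L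
  have N_proj: "x \<in> N \<and> G x = G y" if y: "y \<in> N" "proj_point y = proj_point x" for x y
  proof -
    have "y \<noteq> 0" using y(1) N(2) by auto
    then obtain c where c: "c \<noteq> 0" "x = c *s y" using proj_point_eq_iff[of y x] y(2) by auto
    show ?thesis using cone[OF y(1) c(1)] c(2) by simp
  qed
  have V: "proj_point x \<in> V \<longleftrightarrow> x \<in> N" if "x \<noteq> 0" for x
  proof
    assume "proj_point x \<in> V"
    then obtain y where "y \<in> N" "proj_point y = proj_point x" unfolding V_def by fastforce
    then show "x \<in> N" using N_proj by blast
  qed (auto simp: V_def)
  have F: "F (proj_point x) = G x" if x: "x \<in> N" for x
  proof -
    define y where "y = (SOME y. y \<in> N \<and> proj_point y = proj_point x)"
    have "y \<in> N \<and> proj_point y = proj_point x" unfolding y_def by (rule someI[of _ x]) (use x in auto)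
    then have "G y = G x" using N_proj[of y x] by simp
    then show ?thesis unfolding F_def y_def .
  qed
  have eq: "{x. x \<noteq> 0 \<and> proj_point x \<in> V} = N"
  proof (intro Set.set_eqI)
    fix x show "x \<in> {x. x \<noteq> 0 \<and> proj_point x \<in> V} \<longleftrightarrow> x \<in> N"
      using V[of x] N(2) by (cases "x = 0") auto
  qed
  have o: "openin (topo projective_space) V"
    unfolding openin_projective_space eq using N unfolding V_def by (simp add: image_mono subset_Compl_singleton)
  moreover have "hol projective_space V F"
    unfolding hol_projective_space_iff[OF o]
  proof (intro allI impI)
    fix x assume "x \<noteq> 0" "proj_point x \<in> V"
    then have x: "x \<in> N" using V[of x] by simp
    show "cdiff_at (F \<circ> proj_point) x"
      by (rule cdiff_at_transform[OF G[OF x] N(1) x]) (simp add: F)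
  qed
  ultimately show thesis using V F that[of V F] by simp
qed

section \<open>Quartics\<close>

text \<open>Newton's identities, the power sums of four of the numbers being minus the powers of the
  fifth. The factors 2 and 3 that arise are cancelled.\<close>

lemma elementary_symmetric_of_power_sums:
  fixes p q r u t :: complex
  assumes 1: "p + q + r + u + t = 0" and 2: "p^2 + q^2 + r^2 + u^2 + t^2 = 0"
    and 3: "p^3 + q^3 + r^3 + u^3 + t^3 = 0"
  shows "p + q + r + u = - t" and "p*q + p*r + p*u + q*r + q*u + r*u = t^2"
    and "p*q*r + p*q*u + p*r*u + q*r*u = - (t^3)"
proof -
  show e1: "p + q + r + u = - t" using 1 by algebra
  have "2 * (p*q + p*r + p*u + q*r + q*u + r*u) = 2 * t^2" using 1 2 by algebra
  then show e2: "p*q + p*r + p*u + q*r + q*u + r*u = t^2"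
    by (metis mult_cancel_left zero_neq_numeral)
  have "3 * (p*q*r + p*q*u + p*r*u + q*r*u) = p^3 + q^3 + r^3 + u^3 
      - (p + q + r + u) * ((p + q + r + u)^2 - 3 * (p*q + p*r + p*u + q*r + q*u + r*u))"
    by algebra
  also have "\<dots> = - 3 * t^3" unfolding e1 e2 using 3 by algebra
  finally have "3 * (p*q*r + p*q*u + p*r*u + q*r*u) = 3 * (- (t^3))" by simp
  then show "p*q*r + p*q*u + p*r*u + q*r*u = - (t^3)"
    by (metis mult_cancel_left zero_neq_numeral)
qed

text \<open>This converse turns the roots of any quartic of the family into a point of Bring's
  curve.\<close>

lemma power_sums_of_elementary_symmetric:
  fixes p q r u t :: complex
  assumes 1: "p + q + r + u = - t" and 2: "p*q + p*r + p*u + q*r + q*u + r*u = t^2"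
    and 3: "p*q*r + p*q*u + p*r*u + q*r*u = - (t^3)"
  shows "p + q + r + u + t = 0" "p^2 + q^2 + r^2 + u^2 + t^2 = 0" "p^3 + q^3 + r^3 + u^3 + t^3 = 0"
proof -
  show "p + q + r + u + t = 0" using 1 by algebra
  show "p^2 + q^2 + r^2 + u^2 + t^2 = 0" using 1 2 by algebra
  have "p^3 + q^3 + r^3 + u^3 = (p + q + r + u) * ((p + q + r + u)^2 - 3 * (p*q + p*r + p*u + q*r + q*u + r*u))
      + 3 * (p*q*r + p*q*u + p*r*u + q*r*u)"
    by algebra
  then show "p^3 + q^3 + r^3 + u^3 + t^3 = 0" unfolding 1 2 3 by algebra
qed

text \<open>The differences of the roots of the resolvent cubic are products of differences of the
  roots of the quartic, so that both polynomials have the same discriminant.\<close>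

lemma quartic_discriminant:
  fixes p q r u t s :: complex
  assumes 1: "p + q + r + u = - t" and 2: "p*q + p*r + p*u + q*r + q*u + r*u = t^2"
    and 3: "p*q*r + p*q*u + p*r*u + q*r*u = - (t^3)" and 4: "p*q*r*u = s"
  shows "((p-q)*(p-r)*(p-u)*(q-r)*(q-u)*(r-u))^2 = 256* s^3 - 203* s^2*t^4 + 88* s*t^8 - 16*t^12"
proof -
  define x y z where "x = p*q + r*u" and "y = p*r + q*u" and "z = p*u + q*r"
  have s1: "x + y + z = t^2" using 2 unfolding x_def y_def z_def by algebra
  have "x*y + x*z + y*z = (p + q + r + u) * (p*q*r + p*q*u + p*r*u + q*r*u) - 4 * (p*q*r*u)"
    unfolding x_def y_def z_def by algebra
  then have s2: "x*y + x*z + y*z = t^4 - 4* s" unfolding 1 3 4 by algebra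
  have "x*y*z = (p*q*r + p*q*u + p*r*u + q*r*u)^2 + (p + q + r + u)^2 * (p*q*r*u)
      - 4 * (p*q + p*r + p*u + q*r + q*u + r*u) * (p*q*r*u)"
    unfolding x_def y_def z_def by algebra
  then have s3: "x*y*z = t^6 - 3*t^2* s" unfolding 1 2 3 4 by algebra
  have "(p-q)*(p-r)*(p-u)*(q-r)*(q-u)*(r-u) = (x-y)*(x-z)*(y-z)"
    unfolding x_def y_def z_def by algebra
  then have "((p-q)*(p-r)*(p-u)*(q-r)*(q-u)*(r-u))^2 = ((x-y)*(x-z)*(y-z))^2" by simp
  \<comment> \<open>The discriminant of a monic cubic in the elementary symmetric functions of its
    roots.\<close>
  also have "\<dots> = (x+y+z)^2 * (x*y+x*z+y*z)^2 - 4*(x*y+x*z+y*z)^3 - 4*(x+y+z)^3*(x*y*z)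
      + 18*(x+y+z)*(x*y+x*z+y*z)*(x*y*z) - 27*(x*y*z)^2"
    by algebra
  also have "\<dots> = 256* s^3 - 203* s^2*t^4 + 88* s*t^8 - 16*t^12"
    unfolding s1 s2 s3 by algebra
  finally show ?thesis .
qed

text \<open>The fundamental theorem of algebra is applied three times, after each root to the
  quotient by the linear factor just found; the nested expressions are the Horner coefficients of
  these quotients. The last root is dictated by the sum of the roots.\<close>

lemma quartic_splits:
  fixes e1 e2 e3 e4 :: complex
  obtains p q r u where "p + q + r + u = e1" "p*q + p*r + p*u + q*r + q*u + r*u = e2"
    "p*q*r + p*q*u + p*r*u + q*r*u = e3" "p*q*r*u = e4"
proof -
  have "\<exists>p. poly [:e4, -e3, e2, -e1, 1:] p = 0"
    by (intro fundamental_theorem_of_algebra) (simp add: constant_degree)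
  then obtain p where p: "e4 + p * (-e3 + p * (e2 + p * (-e1 + p))) = 0" by auto
  have "\<exists>q. poly [:-e3 + p * (e2 + p * (-e1 + p)), e2 + p * (-e1 + p), -e1 + p, 1:] q = 0"
    by (intro fundamental_theorem_of_algebra) (simp add: constant_degree)
  then obtain q where q: "-e3 + p * (e2 + p * (-e1 + p)) + q * (e2 + p * (-e1 + p) + q * (-e1 + p + q)) = 0" by auto
  have "\<exists>r. poly [:e2 + p * (-e1 + p) + q * (-e1 + p + q), -e1 + p + q, 1:] r = 0"
    by (intro fundamental_theorem_of_algebra) (simp add: constant_degree)
  then obtain r where r: "e2 + p * (-e1 + p) + q * (-e1 + p + q) + r * (-e1 + p + q + r) = 0" by auto
  define u where "u = e1 - p - q - r"
  show thesis
  proof (rule that)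
    show "p + q + r + u = e1" unfolding u_def by simp
    show "p*q + p*r + p*u + q*r + q*u + r*u = e2" using r unfolding u_def by algebra
    show "p*q*r + p*q*u + p*r*u + q*r*u = e3" using q r unfolding u_def by algebra
    show "p*q*r*u = e4" using p q r unfolding u_def by algebra
  qed
qed

section \<open>The projection of Bring's curve to an elliptic curve\<close>

text \<open>The affine cone over Bring's curve without its vertex.\<close>

definition bring_cone :: "(complex^5) set"
  where "bring_cone = {x. x \<noteq> 0 \<and> (\<Sum>i\<in>UNIV. x $ i) = 0 \<and> (\<Sum>i\<in>UNIV. (x $ i)^2) = 0
    \<and> (\<Sum>i\<in>UNIV. (x $ i)^3) = 0}"

text \<open>\<open>k\<close> is to be the index fixed by the subgroup, and \<open>a\<close>,
  \<open>b\<close>, \<open>c\<close>, \<open>d\<close> number the others in some order, which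
  affects only the sign of the Vandermonde product.\<close>

locale labelling =
  fixes a b c d k :: 5
  assumes UNIV_labels: "UNIV = {a, b, c, d, k}" and distinct_labels: "distinct [a, b, c, d, k]"
begin

lemma labels_neq: "a \<noteq> b" "a \<noteq> c" "a \<noteq> d" "a \<noteq> k" "b \<noteq> c" "b \<noteq> d" "b \<noteq> k" "c \<noteq> d" "c \<noteq> k" "d \<noteq> k"
  "b \<noteq> a" "c \<noteq> a" "d \<noteq> a" "k \<noteq> a" "c \<noteq> b" "d \<noteq> b" "k \<noteq> b" "d \<noteq> c" "k \<noteq> c" "k \<noteq> d"
  using distinct_labels by auto

lemma label_cases: "i = a \<or> i = b \<or> i = c \<or> i = d \<or> i = k"
  using UNIV_labels by (metis UNIV_I empty_iff insert_iff)

lemma sum_labels: "(\<Sum>i\<in>UNIV. f i) = f a + f b + f c + f d + (f k :: complex)"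
  unfolding UNIV_labels using labels_neq by (simp add: add.assoc)

lemma all_labels: "(\<forall>i. P i) \<longleftrightarrow> P a \<and> P b \<and> P c \<and> P d \<and> P k"
  using label_cases by metis

definition labelled :: "complex \<Rightarrow> complex \<Rightarrow> complex \<Rightarrow> complex \<Rightarrow> complex \<Rightarrow> complex^5"
  where "labelled p q r u t = (\<chi> i. if i = a then p else if i = b then q else if i = c then r
    else if i = d then u else t)"

lemma labelled_nth [simp]:
  "labelled p q r u t $ a = p" "labelled p q r u t $ b = q" "labelled p q r u t $ c = r"
  "labelled p q r u t $ d = u" "labelled p q r u t $ k = t"
  unfolding labelled_def using labels_neq by simp_all

definition root_prod :: "complex^5 \<Rightarrow> complex"
  where "root_prod x = x $ a * x $ b * x $ c * x $ d"

definition vandermonde :: "complex^5 \<Rightarrow> complex"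
  where "vandermonde x = (x $ a - x $ b) * (x $ a - x $ c) * (x $ a - x $ d)
    * (x $ b - x $ c) * (x $ b - x $ d) * (x $ c - x $ d)"

text \<open>The product of the four roots has degree 4 and the Vandermonde product degree 6; the
  powers of \<open>x $ k\<close> bring all three entries to degree 6, as a map of projective spaces
  requires.\<close>

definition invariants :: "complex^5 \<Rightarrow> complex^3"
  where "invariants x = vector [root_prod x * (x $ k)^2, vandermonde x, (x $ k)^6]"

lemma invariants_nth [simp]:
  "invariants x $ 1 = root_prod x * (x $ k)^2" "invariants x $ 2 = vandermonde x"
  "invariants x $ 3 = (x $ k)^6"
  by (simp_all add: invariants_def)

lemma bring_cone_labels:
  "x \<in> bring_cone \<longleftrightarrow> x \<noteq> 0 \<and> x $ a + x $ b + x $ c + x $ d = - x $ k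
    \<and> x $ a * x $ b + x $ a * x $ c + x $ a * x $ d + x $ b * x $ c + x $ b * x $ d + x $ c * x $ d = (x $ k)^2
    \<and> x $ a * x $ b * x $ c + x $ a * x $ b * x $ d + x $ a * x $ c * x $ d + x $ b * x $ c * x $ d = - ((x $ k)^3)"
  unfolding bring_cone_def sum_labels
  using elementary_symmetric_of_power_sums[of "x $ a" "x $ b" "x $ c" "x $ d" "x $ k"]
    power_sums_of_elementary_symmetric[of "x $ a" "x $ b" "x $ c" "x $ d" "x $ k"] by blast

lemma vandermonde_square:
  assumes "x \<in> bring_cone"
  shows "(vandermonde x)^2 = 256 * root_prod x^3 - 203 * root_prod x^2 * (x $ k)^4
    + 88 * root_prod x * (x $ k)^8 - 16 * (x $ k)^12"
  using assms unfolding bring_cone_labels vandermonde_def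
  by (intro quartic_discriminant) (auto simp: root_prod_def)

lemma vec_eq_labels: "x = y \<longleftrightarrow> x $ a = y $ a \<and> x $ b = y $ b \<and> x $ c = y $ c \<and> x $ d = y $ d \<and> x $ k = y $ k"
  for x y :: "complex^5"
  unfolding vec_eq_iff all_labels ..

text \<open>With t = 0 the quartic is X^4 + s, so s = 0 would make all five coordinates
  vanish.\<close>

lemma root_prod_neq_0:
  assumes x: "x \<in> bring_cone" and "x $ k = 0"
  shows "root_prod x \<noteq> 0"
proof
  assume 0: "root_prod x = 0"
  have "y^4 = 0" if "y \<in> {x $ a, x $ b, x $ c, x $ d}" for y
  proof -
    have "(y - x $ a) * (y - x $ b) * (y - x $ c) * (y - x $ d) = 0" using that by auto
    moreover have "(y - x $ a) * (y - x $ b) * (y - x $ c) * (y - x $ d) = y^4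
      - (x $ a + x $ b + x $ c + x $ d) * y^3
      + (x $ a * x $ b + x $ a * x $ c + x $ a * x $ d + x $ b * x $ c + x $ b * x $ d + x $ c * x $ d) * y^2
      - (x $ a * x $ b * x $ c + x $ a * x $ b * x $ d + x $ a * x $ c * x $ d + x $ b * x $ c * x $ d) * y
      + root_prod x" unfolding root_prod_def by algebra
    ultimately show ?thesis using x assms(2) 0 unfolding bring_cone_labels by simp
  qed
  then have "x = 0" using assms(2) unfolding vec_eq_labels by simp
  then show False using x unfolding bring_cone_labels by simp
qed

lemma vec3_eq_0: "x = 0 \<longleftrightarrow> x $ 1 = 0 \<and> x $ 2 = 0 \<and> x $ 3 = 0" for x :: "complex^3"
  by (simp add: vec_eq_iff forall_3)

text \<open>For t = 0 only 256 s^3 is left of the discriminant. This excludes base points of the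
  invariants.\<close>

lemma vandermonde_neq_0: 
  assumes "x \<in> bring_cone" "x $ k = 0"
  shows "vandermonde x \<noteq> 0"
  using vandermonde_square[OF assms(1)] root_prod_neq_0[OF assms] assms(2) by auto

lemma invariants_neq_0: "x \<in> bring_cone \<Longrightarrow> invariants x \<noteq> 0"
  using vandermonde_neq_0 unfolding vec3_eq_0 by auto

lemma invariants_scale: "invariants (l *s x) = l^6 *s invariants x"
  unfolding vec_eq_iff forall_3
  by (simp add: root_prod_def vandermonde_def power_mult_distrib) algebra

lemma bring_cone_scale: "x \<in> bring_cone \<Longrightarrow> l \<noteq> 0 \<Longrightarrow> l *s x \<in> bring_cone"
  unfolding bring_cone_def
  by (auto simp: power_mult_distrib simp flip: sum_distrib_left)

text \<open>The roots of the quartic have the prescribed product, and \<open>y\<close> is their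
  Vandermonde product up to sign; exchanging the first two roots reverses the sign.\<close>

lemma ex_bring_cone:
  fixes s y :: complex
  assumes "y^2 = 256* s^3 - 203* s^2 + 88* s - 16"
  obtains x where "x \<in> bring_cone" "x $ k = 1" "root_prod x = s" "vandermonde x = y"
proof -
  obtain p q r u :: complex where pqru: "p + q + r + u = -1" "p*q + p*r + p*u + q*r + q*u + r*u = 1"
    "p*q*r + p*q*u + p*r*u + q*r*u = -1" "p*q*r*u = s"
    using quartic_splits .
  have x: "labelled p q r u 1 \<in> bring_cone" "labelled q p r u 1 \<in> bring_cone"
    using pqru unfolding bring_cone_labels by (simp_all add: vec_eq_labels algebra_simps)
  have s: "root_prod (labelled p q r u 1) = s" "root_prod (labelled q p r u 1) = s"
    using pqru(4) unfolding root_prod_def by (simp_all add: algebra_simps)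
  have "(vandermonde (labelled p q r u 1))^2 = y^2"
    using vandermonde_square[OF x(1)] s assms by simp
  then consider "vandermonde (labelled p q r u 1) = y" | "vandermonde (labelled p q r u 1) = - y"
    using power2_eq_iff by blast
  then show thesis
  proof cases
    case 1 then show thesis using that[OF x(1)] s by simp
  next
    case 2
    moreover have "vandermonde (labelled q p r u 1) = - vandermonde (labelled p q r u 1)"
      unfolding vandermonde_def labelled_nth by algebra
    ultimately show thesis using that[OF x(2)] s by simp
  qed
qed

lemma ex_bring_cone_infinity:
  obtains x where "x \<in> bring_cone" "x $ k = 0"
proof -
  obtain p q r u :: complex where pqru: "p + q + r + u = 0" "p*q + p*r + p*u + q*r + q*u + r*u = 0"
    "p*q*r + p*q*u + p*r*u + q*r*u = 0" "p*q*r*u = 1"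
    using quartic_splits .
  then have "labelled p q r u 0 \<in> bring_cone" unfolding bring_cone_labels
    by (auto simp: vec_eq_labels)
  then show thesis using that by simp
qed

section \<open>Orbits of the even permutations as fibres of the invariants\<close>

lemma vandermonde_permute:
  assumes "p permutes {a, b, c, d}"
  shows "vandermonde (\<chi> i. x $ p i) = of_int (sign p) * vandermonde x"
proof -
  have "finite {a, b, c, d}" by simp
  with assms show ?thesis
  \<comment> \<open>Indexing \<open>x\<close> by a transposition after \<open>p\<close> is indexing
    the transposed vector by \<open>p\<close>, so the hypothesis is needed for that other
    vector.\<close>
  proof (induction p arbitrary: x rule: permutes_induct)
    case id then show ?case by (simp add: vec_lambda_eta)
  next
    case (swap i j p)
    have sgn: "sign (Transposition.transpose i j \<circ> p) = - sign p"
      using swap permutes_imp_permutation[OF _ swap(4)] 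
      by (simp add: sign_compose permutation_swap_id sign_swap_id)
    have "vandermonde (\<chi> l. x $ (Transposition.transpose i j \<circ> p) l)
        = vandermonde (\<chi> l. (\<chi> m. x $ Transposition.transpose i j m) $ p l)" by simp
    also have "\<dots> = of_int (sign p) * vandermonde (\<chi> m. x $ Transposition.transpose i j m)" by (rule swap.IH)
    also have "vandermonde (\<chi> m. x $ Transposition.transpose i j m) = - vandermonde x"
    proof -
      define V where "V p q r u = (p-q)*(p-r)*(p-u)*(q-r)*(q-u)*(r-u)" for p q r u :: complex
      have V: "V q p r u = - V p q r u" "V r q p u = - V p q r u" "V u q r p = - V p q r u"
        "V p r q u = - V p q r u" "V p u r q = - V p q r u" "V p q u r = - V p q r u" for p q r u
        unfolding V_def by algebra+
      have "vandermonde z = V (z $ a) (z $ b) (z $ c) (z $ d)" for z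
        unfolding vandermonde_def V_def ..
      then show ?thesis
        using swap(1-3) labels_neq by (auto simp: Transposition.transpose_def intro: V)
    qed
    finally show ?case unfolding sgn by simp
  qed
qed

lemma root_prod_permute:
  assumes "p permutes {a, b, c, d}"
  shows "root_prod (\<chi> i. x $ p i) = root_prod x"
proof -
  have "root_prod y = (\<Prod>i\<in>{a, b, c, d}. y $ i)" for y
    unfolding root_prod_def using labels_neq by (simp add: mult.assoc)
  then show ?thesis using prod.permute[OF assms, of "\<lambda>i. x $ i"] by (simp add: o_def)
qed

lemma invariants_permute:
  assumes "p permutes {a, b, c, d}" "evenperm p"
  shows "invariants (\<chi> i. x $ p i) = invariants x"
proof -
  have "p k = k" using permutes_not_in[OF assms(1)] labels_neq by simp
  then show ?thesis unfolding vec_eq_iff forall_3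
    using vandermonde_permute[OF assms(1), of x] root_prod_permute[OF assms(1), of x] assms(2)
    by (simp add: sign_def)
qed

text \<open>The numbers t and s determine the quartic, hence the multiset of its roots; two
  indexings of the same multiset differ by a permutation of the indices.\<close>

lemma ex_permutation_of_roots:
  assumes "x \<in> bring_cone" "y \<in> bring_cone" "x $ k = y $ k" "root_prod x = root_prod y"
  obtains p where "p permutes {a, b, c, d}" "y = (\<chi> i. x $ p i)"
proof -
  let ?A = "{a, b, c, d}"
  define P where "P x = (\<Prod>i\<in>?A. [:- (x $ i), 1:])" for x :: "complex^5"
  have P: "P z = [:root_prod z, (z $ k)^3, (z $ k)^2, z $ k, 1:]" if "z \<in> bring_cone" for z
  proof -
    have z: "z $ k = - (z $ a + z $ b + z $ c + z $ d)"
      "(z $ k)^2 = z $ a * z $ b + z $ a * z $ c + z $ a * z $ d + z $ b * z $ c + z $ b * z $ d + z $ c * z $ d"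
      "(z $ k)^3 = - (z $ a * z $ b * z $ c + z $ a * z $ b * z $ d + z $ a * z $ c * z $ d + z $ b * z $ c * z $ d)"
      using that unfolding bring_cone_labels by simp_all
    have "P z = [:- (z $ a), 1:] * [:- (z $ b), 1:] * [:- (z $ c), 1:] * [:- (z $ d), 1:]"
      unfolding P_def using labels_neq by (simp add: mult.assoc del: mult_pCons_left mult_pCons_right)
    also have "\<dots> = [:root_prod z, (z $ k)^3, (z $ k)^2, z $ k, 1:]"
      unfolding z(2,3) unfolding z(1) root_prod_def by (simp add: algebra_simps)
    finally show ?thesis .
  qed
  have roots: "proots (P z) = image_mset (($) z) (mset_set ?A)" for z
    unfolding P_def by (subst proots_prod) (use labels_neq in auto)
  have "P y = P x" using P assms by simp
  then have "image_mset (($) y) (mset_set ?A) = image_mset (($) x) (mset_set ?A)"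
    using roots by metis
  then obtain p where p: "p permutes ?A" "\<forall>i\<in>?A. y $ i = x $ p i"
    using image_mset_eq_implies_permutes[of ?A "($) y" "($) x"] by auto
  have "p k = k" using permutes_not_in[OF p(1)] labels_neq by simp
  then have "y = (\<chi> i. x $ p i)" using p(2) assms(3) unfolding vec_eq_labels by simp
  then show thesis using that p(1) by simp
qed

text \<open>If the permutation found is odd, then w = -w, so two roots coincide, and exchanging them
  makes the permutation even without changing the vector.\<close>

lemma ex_even_permutation_of_roots:
  assumes "x \<in> bring_cone" "y \<in> bring_cone" "x $ k = y $ k" "root_prod x = root_prod y"
    "vandermonde x = vandermonde y"
  obtains p where "p permutes {a, b, c, d}" "evenperm p" "y = (\<chi> i. x $ p i)"
proof -
  obtain p where p: "p permutes {a, b, c, d}" "y = (\<chi> i. x $ p i)"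
    using ex_permutation_of_roots assms(1-4) by blast
  show thesis
  proof (cases "evenperm p")
    case False
    then have "vandermonde x = - vandermonde x"
      using vandermonde_permute[OF p(1), of x] p(2) assms(5) by (simp add: sign_def)
    then have "vandermonde x = 0" by simp
    then obtain i j where ij: "i \<noteq> j" "x $ i = x $ j" "i \<in> {a, b, c, d}" "j \<in> {a, b, c, d}"
      using labels_neq unfolding vandermonde_def by auto
    let ?q = "Transposition.transpose i j \<circ> p"
    have "?q permutes {a, b, c, d}"
      using permutes_compose[OF p(1) permutes_swap_id[OF ij(3,4)]] .
    moreover have "evenperm ?q"
      using False ij(1) permutes_imp_permutation[OF _ p(1)]
      by (simp add: evenperm_comp permutation_swap_id evenperm_swap)
    moreover have "x $ ?q l = x $ p l" for l
      using ij(2) by (auto simp: Transposition.transpose_def)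
    then have "y = (\<chi> i. x $ ?q i)" using p(2) by simp
    ultimately show thesis by (rule that)
  qed (use p that in blast)
qed

text \<open>Proportional invariants have to be traced back to one scalar \<open>m\<close> that acts
  on t, s, w with weights 1, 4, 6; then \<open>m *s x\<close> and \<open>y\<close> have the same t,
  s and w. If t is nonzero, the ratio of the two values of t serves.\<close>

lemma invariants_fibre:
  assumes x: "x \<in> bring_cone" and y: "y \<in> bring_cone" and "proj_point (invariants x) = proj_point (invariants y)"
  obtains p m where "p permutes {a, b, c, d}" "evenperm p" "m \<noteq> 0" "y = m *s (\<chi> i. x $ p i)"
proof -
  obtain l where l: "l \<noteq> 0" "invariants y = l *s invariants x"
    using assms(3) proj_point_eq_iff[OF invariants_neq_0[OF x]] by blast
  have l': "root_prod y * (y $ k)^2 = l * (root_prod x * (x $ k)^2)" "vandermonde y = l * vandermonde x"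
    "(y $ k)^6 = l * (x $ k)^6"
    using l(2) by (metis invariants_nth vector_smult_component)+
  have "\<exists>m. m \<noteq> 0 \<and> y $ k = m * x $ k \<and> root_prod y = m^4 * root_prod x \<and> vandermonde y = m^6 * vandermonde x"
  proof (cases "x $ k = 0")
    case True
    then have yk: "y $ k = 0" using l'(3) by simp
    have nz: "root_prod x \<noteq> 0" "root_prod y \<noteq> 0" using root_prod_neq_0 x y True yk by auto
    \<comment> \<open>With t = 0 the scalar has to come from s, which fixes it up to a fourth root
      of unity.\<close>
    define m where "m = csqrt (csqrt (root_prod y / root_prod x))"
    have "m^4 = (m^2)^2" by algebra
    then have m4: "root_prod y = m^4 * root_prod x" unfolding m_def using nz by simp
    then have m0: "m \<noteq> 0" using nz by auto
    have "(vandermonde y)^2 = (m^6 * vandermonde x)^2"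
      using vandermonde_square[OF x] vandermonde_square[OF y] True yk m4
      by (simp add: power_mult_distrib flip: power_mult)
    then consider "vandermonde y = m^6 * vandermonde x" | "vandermonde y = - (m^6 * vandermonde x)"
      using power2_eq_iff by blast
    then show ?thesis
    proof cases
      case 1 then show ?thesis using m4 m0 True yk by auto
    next
      case 2
      \<comment> \<open>The factor i keeps the fourth power and reverses the sixth, which corrects
        the sign of w.\<close>
      have "(\<i> * m)^4 = m^4" "(\<i> * m)^6 = - (m^6)"
        by (simp_all add: power_mult_distrib)
      then show ?thesis using 2 m4 m0 True yk by (intro exI[of _ "\<i> * m"]) simp
    qed
  next
    case False
    define m where "m = y $ k / x $ k"
    have yk: "y $ k = m * x $ k" using False unfolding m_def by simp
    then have m6: "m^6 = l" using l'(3) False by (simp add: power_mult_distrib)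
    then have m0: "m \<noteq> 0" using l(1) by auto
    have "root_prod y * m^2 * (x $ k)^2 = m^4 * root_prod x * m^2 * (x $ k)^2"
      using l'(1) unfolding m6[symmetric] yk by algebra
    then have "root_prod y = m^4 * root_prod x" using m0 False by simp
    then show ?thesis using m6 m0 yk l'(2) by blast
  qed
  then obtain m where m: "m \<noteq> 0" "y $ k = m * x $ k" "root_prod y = m^4 * root_prod x"
    "vandermonde y = m^6 * vandermonde x" by blast
  have "root_prod (m *s x) = m^4 * root_prod x" "vandermonde (m *s x) = m^6 * vandermonde x"
    unfolding root_prod_def vandermonde_def vector_smult_component by algebra+
  then obtain p where "p permutes {a, b, c, d}" "evenperm p" "y = (\<chi> i. (m *s x) $ p i)"
    using ex_even_permutation_of_roots[OF bring_cone_scale[OF x m(1)] y] m by auto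
  moreover have "(\<chi> i. (m *s x) $ p i) = m *s (\<chi> i. x $ p i)" by (simp add: vec_eq_iff)
  ultimately show thesis using that m(1) by simp
qed

text \<open>On a line the invariants scale by sixth powers, and every complex number is a sixth
  power. So the image of a line is a whole line, and the quotient map can be given as an image of
  sets, without representatives.\<close>

lemma invariants_image_proj_point:
  "invariants ` proj_point x = proj_point (invariants x)"
proof -
  have "\<exists>z. c = z^6" for c :: complex
  proof (cases "c = 0")
    case False
    then have "c = exp (Ln c / 6) ^ 6" by (simp flip: exp_of_nat_mult)
    then show ?thesis by blast
  qed (auto intro: exI[of _ 0])
  then have "range (\<lambda>c. c^6 *s invariants x) = range (\<lambda>c. c *s invariants x)"
    by (auto simp: image_iff)
  then show ?thesis unfolding proj_point_def by (simp add: image_image invariants_scale)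
qed

lemma orbit_eq_iff:
  assumes x: "x \<in> bring_cone" and y: "y \<in> bring_cone"
  defines "G \<equiv> {p. p permutes {a, b, c, d} \<and> evenperm p}"
  shows "(\<lambda>p. permute_coords p (proj_point x)) ` G = (\<lambda>p. permute_coords p (proj_point y)) ` G
    \<longleftrightarrow> proj_point (invariants x) = proj_point (invariants y)"
proof -
  have pc: "permute_coords p (proj_point z) = proj_point (\<chi> i. z $ inv' p i)" for p and z :: "complex^5"
  proof -
    have "(\<chi> i. (c *s z) $ inv' p i) = c *s (\<chi> i. z $ inv' p i)" for c by (simp add: vec_eq_iff)
    then show ?thesis unfolding permute_coords_def proj_point_def by (simp add: image_image)
  qed
  have bij: "bij p" if "p \<in> G" for p using that permutes_bij unfolding G_def by blast
  have perm: "permutation p" if "p \<in> G" for p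
    using that permutes_imp_permutation[of "{a, b, c, d}" p] unfolding G_def by simp
  have id: "id \<in> G" unfolding G_def by (simp add: permutes_id)
  have inv: "inv' p \<in> G" if "p \<in> G" for p
    using that perm[OF that] unfolding G_def by (simp add: permutes_inv evenperm_inv)
  have comp: "p \<circ> q \<in> G" if "p \<in> G" "q \<in> G" for p q
    using that perm[OF that(1)] perm[OF that(2)] unfolding G_def
    by (simp add: permutes_compose evenperm_comp)
  \<comment> \<open>\<open>permute_coords\<close> involves inverse permutations, but
    \<open>G\<close> is closed under inverses, so the orbit can be described without them.\<close>
  have orb: "(\<lambda>p. permute_coords p (proj_point z)) ` G = {proj_point (\<chi> i. z $ p i) | p. p \<in> G}" for z
  proof -
    have "inv' (inv' p) = p" if "p \<in> G" for p using bij[OF that] inv_inv_eq by blast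
    then show ?thesis unfolding pc using inv by (auto simp: image_iff) metis
  qed
  show ?thesis
  proof
    assume "(\<lambda>p. permute_coords p (proj_point x)) ` G = (\<lambda>p. permute_coords p (proj_point y)) ` G"
    moreover have "proj_point x \<in> (\<lambda>p. permute_coords p (proj_point x)) ` G"
      unfolding orb using id by (force simp: vec_lambda_eta)
    ultimately obtain p where p: "p \<in> G" "proj_point x = proj_point (\<chi> i. y $ p i)"
      unfolding orb by auto
    then have "invariants ` proj_point x = invariants ` proj_point (\<chi> i. y $ p i)" by simp
    then show "proj_point (invariants x) = proj_point (invariants y)"
      using p(1) invariants_permute[of p y] unfolding invariants_image_proj_point G_def by simp
  next
    assume "proj_point (invariants x) = proj_point (invariants y)"
    then obtain p m where p: "p \<in> G" "m \<noteq> 0" "y = m *s (\<chi> i. x $ p i)"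
      using invariants_fibre[OF x y] unfolding G_def by blast
    \<comment> \<open>The translates of \<open>y\<close> by \<open>q\<close> are those of
      \<open>x\<close> by \<open>p \<circ> q\<close>, and composition with \<open>p\<close> maps
      \<open>G\<close> onto itself.\<close>
    have yq: "proj_point (\<chi> i. y $ q i) = proj_point (\<chi> i. x $ (p \<circ> q) i)" for q
    proof -
      have "(\<chi> i. y $ q i) = m *s (\<chi> i. x $ (p \<circ> q) i)" by (simp add: p(3) vec_eq_iff)
      then show ?thesis using p(2) by simp
    qed
    have "p \<circ> (inv' p \<circ> q) = q" for q
      using bij[OF p(1)] by (simp add: fun_eq_iff bij_is_surj surj_f_inv_f)
    then have "\<exists>r\<in>G. q = p \<circ> r" if "q \<in> G" for q using comp[OF inv[OF p(1)] that] by metis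
    then show "(\<lambda>p. permute_coords p (proj_point x)) ` G = (\<lambda>p. permute_coords p (proj_point y)) ` G"
      unfolding orb yq using comp[OF p(1)] by blast
  qed
qed

end

section \<open>Topology of the quotient curve\<close>

lemma bring_curve_eq: "bring_curve = subspace_of projective_space (proj_point ` bring_cone)"
  unfolding bring_curve_def bring_cone_def by (simp add: setcompr_eq_image)

lemma bring_cone_nonzero: "bring_cone \<subseteq> - {0}"
  unfolding bring_cone_def by auto

lemma bring_cone_neq_0: "x \<in> bring_cone \<Longrightarrow> x \<noteq> 0"
  unfolding bring_cone_def by simp

lemma closed_bring_equations:
  "closed {x :: complex^5. (\<Sum>i\<in>UNIV. x $ i) = 0 \<and> (\<Sum>i\<in>UNIV. (x $ i)^2) = 0 \<and> (\<Sum>i\<in>UNIV. (x $ i)^3) = 0}"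
  by (intro closed_Collect_conj closed_Collect_eq continuous_intros)

lemma points_bring_curve [simp]: "points bring_curve = proj_point ` bring_cone"
  using bring_cone_nonzero unfolding bring_curve_eq by auto

lemma proj_point_in_bring_curve:
  assumes "x \<noteq> 0"
  shows "proj_point x \<in> proj_point ` bring_cone \<longleftrightarrow> x \<in> bring_cone"
proof
  assume "proj_point x \<in> proj_point ` bring_cone"
  then obtain y where y: "y \<in> bring_cone" "proj_point y = proj_point x" by (metis imageE)
  then obtain m where "m \<noteq> 0" "x = m *s y"
    using proj_point_eq_iff[of y x] bring_cone_nonzero by auto
  then show "x \<in> bring_cone" using y(1) unfolding bring_cone_def
    by (auto simp: power_mult_distrib simp flip: sum_distrib_left)
qed simp

text \<open>The cone is closed in C^5 without the origin and is a full preimage, and a quotient map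
  stays one over a closed set. So the topology of Bring's curve can be tested on the cone.\<close>

lemma quotient_map_bring_curve: "quotient_map (top_of_set bring_cone) (topo bring_curve) proj_point"
proof -
  have U: "{x \<in> topspace (top_of_set (- {0})). proj_point x \<in> proj_point ` bring_cone} = bring_cone"
    using proj_point_in_bring_curve bring_cone_nonzero by auto
  have "closedin (top_of_set (- {0})) bring_cone"
  proof -
    have eq: "bring_cone = - {0} \<inter> {x :: complex^5. (\<Sum>i\<in>UNIV. x $ i) = 0 \<and> (\<Sum>i\<in>UNIV. (x $ i)^2) = 0
        \<and> (\<Sum>i\<in>UNIV. (x $ i)^3) = 0}"
      unfolding bring_cone_def by auto
    show ?thesis unfolding eq by (rule closedin_closed_Int[OF closed_bring_equations])
  qed
  then have "closedin (topo projective_space) (proj_point ` bring_cone)"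
    using conjunct2[OF quotient_map_proj_point[unfolded quotient_map_closedin],
        THEN spec[of _ "proj_point ` bring_cone"]] U image_mono[OF bring_cone_nonzero, of proj_point]
    by simp
  then have "quotient_map (subtopology (top_of_set (- {0})) bring_cone) (topo bring_curve) proj_point"
    using quotient_map_restriction[OF quotient_map_proj_point U] unfolding bring_curve_eq by simp
  moreover have "subtopology (top_of_set (- {0})) bring_cone = top_of_set bring_cone"
    using bring_cone_nonzero by (simp add: subtopology_subtopology Int_absorb1)
  ultimately show ?thesis by simp
qed

lemma ex_bring_cone_normalised:
  assumes "x \<in> bring_cone"
  obtains y where "y \<in> bring_cone" "norm y = 1" "proj_point y = proj_point x"
proof -
  define y where "y = complex_of_real (inverse (norm x)) *s x"
  have x: "x \<noteq> 0" using assms bring_cone_nonzero by auto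
  have "y = inverse (norm x) *\<^sub>R x"
    unfolding y_def vec_eq_iff by (simp add: scaleR_conv_of_real[where 'a = complex])
  then have "norm y = 1" using x by simp
  moreover have "proj_point y = proj_point x" unfolding y_def using x by simp
  moreover have "y \<noteq> 0" using \<open>norm y = 1\<close> by auto
  then have "y \<in> bring_cone"
    using proj_point_in_bring_curve[of y] \<open>proj_point y = proj_point x\<close> assms by auto
  ultimately show thesis using that by blast
qed

definition vec3 :: "complex \<Rightarrow> complex \<Rightarrow> complex \<Rightarrow> complex^3"
  where "vec3 x y z = vector [x, y, z]"

lemma vec3_nth [simp]: "vec3 x y z $ 1 = x" "vec3 x y z $ 2 = y" "vec3 x y z $ 3 = z"
  by (simp_all add: vec3_def)

lemma vec3_eq_iff: "v = w \<longleftrightarrow> v $ 1 = w $ 1 \<and> v $ 2 = w $ 2 \<and> v $ 3 = w $ 3" for v w :: "complex^3"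
  by (simp add: vec_eq_iff forall_3)

text \<open>The discriminant of X^4 + X^3 + X^2 + X + s, that is, of the quartic with t = 1.\<close>

definition disc :: "complex \<Rightarrow> complex"
  where "disc s = 256 * s^3 - 203 * s^2 + 88 * s - 16"

definition cubic_cone :: "(complex^3) set"
  where "cubic_cone = {v. v \<noteq> 0 \<and> (v $ 2)^2 * v $ 3
    = 256 * (v $ 1)^3 - 203 * (v $ 1)^2 * v $ 3 + 88 * v $ 1 * (v $ 3)^2 - 16 * (v $ 3)^3}"

lemma cubic_cone_affine: "vec3 s y 1 \<in> cubic_cone \<longleftrightarrow> y^2 = disc s"
  by (auto simp: cubic_cone_def disc_def vec3_eq_iff)

lemma cubic_cone_infinity: "vec3 0 1 0 \<in> cubic_cone"
  by (auto simp: cubic_cone_def vec3_eq_iff)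

lemma cubic_cone_nonzero: "v \<in> cubic_cone \<Longrightarrow> v \<noteq> 0"
  by (simp add: cubic_cone_def)

lemma cubic_cone_scale: "v \<in> cubic_cone \<Longrightarrow> m \<noteq> 0 \<Longrightarrow> m *s v \<in> cubic_cone"
  unfolding cubic_cone_def mem_Collect_eq
proof (elim conjE, intro conjI)
  assume "(v $ 2)^2 * v $ 3
    = 256 * (v $ 1)^3 - 203 * (v $ 1)^2 * v $ 3 + 88 * v $ 1 * (v $ 3)^2 - 16 * (v $ 3)^3"
  then show "((m *s v) $ 2)^2 * (m *s v) $ 3 = 256 * ((m *s v) $ 1)^3 - 203 * ((m *s v) $ 1)^2 * (m *s v) $ 3
      + 88 * (m *s v) $ 1 * ((m *s v) $ 3)^2 - 16 * ((m *s v) $ 3)^3"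
    unfolding vector_smult_component by algebra
qed (auto simp: vec_eq_iff)

lemma cubic_cone_cases:
  assumes "v \<in> cubic_cone"
  obtains (affine) s y where "v $ 3 \<noteq> 0" "y^2 = disc s" "proj_point v = proj_point (vec3 s y 1)"
      "s = v $ 1 / v $ 3" "y = v $ 2 / v $ 3"
    | (infinity) "v $ 3 = 0" "v $ 1 = 0" "v $ 2 \<noteq> 0" "proj_point v = proj_point (vec3 0 1 0)"
proof (cases "v $ 3 = 0")
  case True
  then have v: "v $ 1 = 0" "v $ 2 \<noteq> 0" using assms unfolding cubic_cone_def by (auto simp: vec3_eq_iff)
  have "v = v $ 2 *s vec3 0 1 0" using v True by (simp add: vec3_eq_iff)
  then show thesis using infinity v True proj_point_scale by metis
next
  case False
  define s y where "s = v $ 1 / v $ 3" and "y = v $ 2 / v $ 3"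
  have "vec3 s y 1 = inverse (v $ 3) *s v"
    unfolding s_def y_def using False by (simp add: vec3_eq_iff field_simps)
  then have "vec3 s y 1 \<in> cubic_cone" "proj_point v = proj_point (vec3 s y 1)"
    using cubic_cone_scale[OF assms] False by simp_all
  then show thesis using affine False unfolding cubic_cone_affine s_def y_def by blast
qed

text \<open>The matrix of the orthogonal projection onto a line depends continuously on the line and
  determines it; so it embeds the projective plane into a Hausdorff space.\<close>

definition line_matrix :: "complex^3 \<Rightarrow> complex^3^3"
  where "line_matrix v = (\<chi> i j. v $ i * cnj (v $ j) / of_real ((norm v)^2))"

lemma line_matrix_scale: "m \<noteq> 0 \<Longrightarrow> line_matrix (m *s v) = line_matrix v"
proof -
  assume m: "m \<noteq> 0"
  have "norm (m *s v) = norm m * norm v"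
    unfolding norm_vec_def L2_set_def
    by (simp add: norm_mult power_mult_distrib real_sqrt_mult flip: sum_distrib_left)
  moreover have "complex_of_real ((norm m)^2) = m * cnj m" by (rule complex_norm_square)
  ultimately show ?thesis using m
    unfolding line_matrix_def vec_eq_iff by (simp add: power_mult_distrib flip: of_real_power)
qed

text \<open>Column \<open>j\<close> of the matrix is a multiple of the vector, and a nonzero one if
  entry \<open>j\<close> of the vector is nonzero; comparing such columns gives the factor
  \<open>m\<close>.\<close>

lemma line_matrix_eq_imp:
  assumes "v \<noteq> 0" "w \<noteq> 0" "line_matrix v = line_matrix w"
  shows "proj_point v = proj_point w"
proof -
  have e: "v $ i * cnj (v $ j) / of_real ((norm v)^2) = w $ i * cnj (w $ j) / of_real ((norm w)^2)" for i j
    using assms(3) unfolding line_matrix_def vec_eq_iff by simp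
  obtain j where j: "v $ j \<noteq> 0" using assms(1) by (auto simp: vec_eq_iff)
  have nz: "complex_of_real ((norm v)^2) \<noteq> 0" "complex_of_real ((norm w)^2) \<noteq> 0" using assms(1,2) by auto
  then have j': "w $ j \<noteq> 0" using e[of j j] j by auto
  define m where "m = cnj (v $ j) / of_real ((norm v)^2) * of_real ((norm w)^2) / cnj (w $ j)"
  have "m \<noteq> 0" unfolding m_def using j j' nz by simp
  moreover have "w = m *s v" unfolding vec_eq_iff m_def using e[of _ j] j' nz by (auto simp: field_simps)
  ultimately show ?thesis by simp
qed

lemma continuous_on_line_matrix: "continuous_on (- {0}) line_matrix"
  unfolding line_matrix_def continuous_on_vec_lambda
  by (intro continuous_on_vec_lambda continuous_intros) auto

definition line_embedding :: "(complex^3) set \<Rightarrow> complex^3^3"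
  where "line_embedding L = line_matrix (SOME v. v \<noteq> 0 \<and> proj_point v = L)"

lemma line_embedding_proj_point:
  assumes "v \<noteq> 0" shows "line_embedding (proj_point v) = line_matrix v"
proof -
  define w where "w = (SOME w. w \<noteq> 0 \<and> proj_point w = proj_point v)"
  have "w \<noteq> 0 \<and> proj_point w = proj_point v"
    unfolding w_def by (rule someI[of _ v]) (use assms in simp)
  then have "line_matrix v = line_matrix w"
    using line_matrix_scale proj_point_eq_iff[of w v] by auto
  then show ?thesis unfolding line_embedding_def w_def by simp
qed

context labelling
begin

text \<open>The points are lines in C^3 and not orbits, so that ratios of coordinates are available
  as functions; the structure is that of the quotient by definition.\<close>

definition elliptic :: "(complex^3) set fun_space"
  where "elliptic = quotient_of bring_curve (\<lambda>L. invariants ` L)"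

text \<open>The discriminant identity multiplied by t^6 is homogeneous of degree 3 in s t^2, w,
  t^6.\<close>

lemma invariants_cubic: "x \<in> bring_cone \<Longrightarrow> invariants x \<in> cubic_cone"
proof -
  assume x: "x \<in> bring_cone"
  have "(vandermonde x)^2 * (x $ k)^6 = (256 * root_prod x^3 - 203 * root_prod x^2 * (x $ k)^4
    + 88 * root_prod x * (x $ k)^8 - 16 * (x $ k)^12) * (x $ k)^6"
    using vandermonde_square[OF x] by simp
  also have "\<dots> = 256 * (root_prod x * (x $ k)^2)^3 - 203 * (root_prod x * (x $ k)^2)^2 * (x $ k)^6
    + 88 * (root_prod x * (x $ k)^2) * ((x $ k)^6)^2 - 16 * ((x $ k)^6)^3"
    by algebra
  finally show ?thesis using invariants_neq_0[OF x] unfolding cubic_cone_def by simp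
qed

lemma points_elliptic: "points elliptic = proj_point ` cubic_cone"
proof -
  have "points elliptic = (\<lambda>x. proj_point (invariants x)) ` bring_cone"
    unfolding elliptic_def by (simp add: image_image invariants_image_proj_point)
  moreover have "proj_point v \<in> (\<lambda>x. proj_point (invariants x)) ` bring_cone" if "v \<in> cubic_cone" for v
    using that
  proof (cases rule: cubic_cone_cases)
    case (affine s y)
    then obtain x where x: "x \<in> bring_cone" "x $ k = 1" "root_prod x = s" "vandermonde x = y"
      using ex_bring_cone[of y s] unfolding disc_def by blast
    then have "invariants x = vec3 s y 1" by (simp add: vec3_eq_iff)
    then show ?thesis using x(1) affine by (metis imageI)
  next
    case infinity
    obtain x where x: "x \<in> bring_cone" "x $ k = 0" using ex_bring_cone_infinity by blast
    then have "invariants x = vandermonde x *s vec3 0 1 0" by (simp add: vec3_eq_iff)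
    then show ?thesis using x infinity vandermonde_neq_0 by (metis imageI proj_point_scale)
  qed
  ultimately show ?thesis using invariants_cubic by auto
qed

lemma quotient_map_elliptic:
  "quotient_map (top_of_set bring_cone) (topo elliptic) (\<lambda>x. proj_point (invariants x))"
proof -
  have "quotient_map (topo bring_curve) (topo elliptic) (\<lambda>L. invariants ` L)"
    unfolding elliptic_def by (simp add: quotient_map_quotient_topology)
  then show ?thesis
    using quotient_map_compose[OF quotient_map_bring_curve]
    by (metis (no_types, lifting) comp_apply ext invariants_image_proj_point)
qed

lemma openin_elliptic:
  "openin (topo elliptic) V \<longleftrightarrow> V \<subseteq> proj_point ` cubic_cone
    \<and> openin (top_of_set bring_cone) {x \<in> bring_cone. proj_point (invariants x) \<in> V}"
proof -
  have "openin (topo elliptic) V \<longleftrightarrow> openin (top_of_set bring_cone) {x \<in> bring_cone. proj_point (invariants x) \<in> V}"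
    if "V \<subseteq> proj_point ` cubic_cone"
    using quotient_map_elliptic that unfolding quotient_map_def points_elliptic by simp
  moreover have "V \<subseteq> proj_point ` cubic_cone" if "openin (topo elliptic) V"
    using openin_subset[OF that] by (simp add: points_elliptic)
  ultimately show ?thesis by blast
qed

section \<open>Compactness and the Hausdorff property\<close>

lemma continuous_on_invariants: "continuous_on S invariants"
proof -
  have "continuous_on S (\<lambda>x. invariants x $ i)" for i
    using exhaust_3[of i]
    by (elim disjE) (simp_all add: root_prod_def vandermonde_def continuous_intros)
  then show ?thesis
    using continuous_on_vec_lambda[of S "\<lambda>i x. invariants x $ i"] by (simp add: vec_lambda_eta)
qed

text \<open>The part of the cone on the unit sphere is compact and meets every line of the
  cone.\<close>

lemma compact_space_elliptic: "compact_space (topo elliptic)"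
proof -
  let ?S = "bring_cone \<inter> sphere 0 1"
  have "?S = {x. (\<Sum>i\<in>UNIV. x $ i) = 0 \<and> (\<Sum>i\<in>UNIV. (x $ i)^2) = 0 \<and> (\<Sum>i\<in>UNIV. (x $ i)^3) = 0} \<inter> sphere 0 1"
    unfolding bring_cone_def by auto
  then have "compact ?S" using closed_bring_equations by (simp add: closed_Int_compact)
  then have "compactin (top_of_set bring_cone) ?S"
    by (simp add: compactin_subtopology)
  then have "compactin (topo elliptic) ((\<lambda>x. proj_point (invariants x)) ` ?S)"
    using image_compactin quotient_imp_continuous_map[OF quotient_map_elliptic] by blast
  moreover have "(\<lambda>x. proj_point (invariants x)) ` ?S = points elliptic"
  proof -
    have "\<exists>y\<in>?S. proj_point (invariants x) = proj_point (invariants y)" if x: "x \<in> bring_cone" for x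
    proof -
      obtain y where "y \<in> bring_cone" "norm y = 1" "proj_point y = proj_point x"
        using ex_bring_cone_normalised[OF x] .
      then show ?thesis using invariants_image_proj_point by (metis IntI mem_sphere_0)
    qed
    then have "(\<lambda>x. proj_point (invariants x)) ` ?S = (\<lambda>x. proj_point (invariants x)) ` bring_cone" by blast
    then show ?thesis
      using quotient_imp_surjective_map[OF quotient_map_elliptic] by simp
  qed
  ultimately show ?thesis by (simp add: compact_space_def)
qed

lemma continuous_map_line_embedding: "continuous_map (topo elliptic) euclidean line_embedding"
proof -
  have "continuous_on bring_cone (\<lambda>x. line_matrix (invariants x))"
    using continuous_on_line_matrix continuous_on_invariants
    by (rule continuous_on_compose2) (use invariants_neq_0 in auto)
  then have "continuous_on bring_cone (line_embedding \<circ> (\<lambda>x. proj_point (invariants x)))"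
    by (rule continuous_on_eq) (simp add: invariants_neq_0 line_embedding_proj_point)
  then show ?thesis
    using continuous_compose_quotient_map_eq[OF quotient_map_elliptic, of euclidean line_embedding] by simp
qed

lemma inj_on_line_embedding: "inj_on line_embedding (points elliptic)"
  unfolding points_elliptic inj_on_def
  using line_embedding_proj_point line_matrix_eq_imp cubic_cone_nonzero by (metis imageE)

lemma Hausdorff_space_elliptic: "Hausdorff_space (topo elliptic)"
  using Hausdorff_space_injective_preimage[OF _ continuous_map_line_embedding inj_on_line_embedding] by simp

text \<open>The quotient topology gives no direct access to continuity into it. But
  \<open>line_embedding\<close> is a continuous injection from a compact space into a Hausdorff
  space, hence an embedding, and it is enough that the matrices depend continuously on
  \<open>z\<close>.\<close>

lemma continuous_map_into_elliptic:
  assumes "continuous_on W \<psi>" "\<And>z. z \<in> W \<Longrightarrow> \<psi> z \<in> cubic_cone"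
  shows "continuous_map (top_of_set W) (topo elliptic) (\<lambda>z. proj_point (\<psi> z))"
proof -
  have "embedding_map (topo elliptic) euclidean line_embedding"
    using injective_closed_imp_embedding_map continuous_imp_closed_map continuous_map_line_embedding
      compact_space_elliptic inj_on_line_embedding Hausdorff_space_euclidean by blast
  then obtain g where g: "homeomorphic_maps (topo elliptic)
      (top_of_set (line_embedding ` points elliptic)) line_embedding g"
    unfolding embedding_map_def homeomorphic_map_maps by blast
  have gl: "g (line_embedding p) = p" if "p \<in> points elliptic" for p
    using g that unfolding homeomorphic_maps_def by blast
  have pts: "proj_point (\<psi> z) \<in> points elliptic" if "z \<in> W" for z
    using assms(2)[OF that] by (simp add: points_elliptic)
  have "continuous_on W (\<lambda>z. line_matrix (\<psi> z))"
    using continuous_on_line_matrix assms(1)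
    by (rule continuous_on_compose2) (use assms(2) cubic_cone_nonzero in auto)
  then have "continuous_on W (\<lambda>z. line_embedding (proj_point (\<psi> z)))"
    by (rule continuous_on_eq) (simp add: line_embedding_proj_point assms(2) cubic_cone_nonzero)
  then have cont: "continuous_map (top_of_set W) (top_of_set (line_embedding ` points elliptic))
      (\<lambda>z. line_embedding (proj_point (\<psi> z)))"
    using pts by (auto simp: continuous_map_in_subtopology)
  then have "continuous_map (top_of_set W) (topo elliptic) (g \<circ> (\<lambda>z. line_embedding (proj_point (\<psi> z))))"
    using continuous_map_compose[OF cont, of "topo elliptic" g] g unfolding homeomorphic_maps_def by simp
  then show ?thesis by (rule continuous_map_eq) (use gl pts in auto)
qed

section \<open>Holomorphic functions of the quotient, read off on the cone in C^5\<close>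

lemma is_sheaf_elliptic: "is_sheaf elliptic"
  unfolding elliptic_def bring_curve_eq
  by (intro is_sheaf_quotient_of is_sheaf_subspace_of is_sheaf_projective_space)

lemma hol_elliptic_iff:
  "hol elliptic V f \<longleftrightarrow> locally_hol projective_space
    {L \<in> proj_point ` bring_cone. invariants ` L \<in> V} (f \<circ> (\<lambda>L. invariants ` L))"
  unfolding elliptic_def hol_quotient_of points_bring_curve by (simp add: bring_curve_eq)

text \<open>The pullback to Bring's curve extends locally to projective space and from there lifts
  to C^5; the open set is cut down so that its part in the cone stays over \<open>V\<close>.\<close>

lemma hol_elliptic_lift:
  assumes hol: "hol elliptic V f" and V: "openin (topo elliptic) V"
    and x: "x \<in> bring_cone" "proj_point (invariants x) \<in> V"
  obtains N G where "open N" "x \<in> N" "\<And>y. y \<in> N \<Longrightarrow> cdiff_at G y"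
    "\<And>y. y \<in> N \<Longrightarrow> y \<in> bring_cone \<Longrightarrow> proj_point (invariants y) \<in> V \<and> f (proj_point (invariants y)) = G y"
proof -
  let ?B = "{L \<in> proj_point ` bring_cone. invariants ` L \<in> V}"
  have "proj_point x \<in> ?B" using x by (auto simp: invariants_image_proj_point)
  then obtain P F where P: "openin (topo projective_space) P" "proj_point x \<in> P" "hol projective_space P F"
      "\<forall>L\<in>?B \<inter> P. f (invariants ` L) = F L"
    using bspec[OF hol[unfolded hol_elliptic_iff locally_hol_def], of "proj_point x"] unfolding o_def by blast
  obtain T where T: "open T" "{x \<in> bring_cone. proj_point (invariants x) \<in> V} = bring_cone \<inter> T"
    using V unfolding openin_elliptic openin_open by blast
  define N where "N = {y. y \<noteq> 0 \<and> proj_point y \<in> P} \<inter> T"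
  show thesis
  proof (rule that)
    show "open N" unfolding N_def using P(1) T(1) openin_projective_space by blast
    show "x \<in> N" unfolding N_def using x T P(2) bring_cone_nonzero by blast
    show "cdiff_at (F \<circ> proj_point) y" if "y \<in> N" for y
      using that P(3) hol_projective_space_iff[OF P(1)] unfolding N_def by blast
    show "proj_point (invariants y) \<in> V \<and> f (proj_point (invariants y)) = (F \<circ> proj_point) y"
      if y: "y \<in> N" "y \<in> bring_cone" for y
    proof -
      have V: "proj_point (invariants y) \<in> V" using y T(2) unfolding N_def by blast
      then have "proj_point y \<in> ?B \<inter> P"
        using y unfolding N_def by (auto simp: invariants_image_proj_point)
      then have "f (invariants ` proj_point y) = F (proj_point y)" using P(4) by blast
      then show ?thesis using V by (simp add: invariants_image_proj_point)
    qed
  qed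
qed

text \<open>An extension that is homogeneous of degree 0 on an open cone descends to projective
  space, where it witnesses holomorphy on Bring's curve.\<close>

lemma hol_ellipticI:
  assumes "\<And>x. x \<in> bring_cone \<Longrightarrow> proj_point (invariants x) \<in> V \<Longrightarrow>
    \<exists>N G. open N \<and> 0 \<notin> N \<and> x \<in> N \<and> (\<forall>y\<in>N. cdiff_at G y)
      \<and> (\<forall>y\<in>N. \<forall>m. m \<noteq> 0 \<longrightarrow> m *s y \<in> N \<and> G (m *s y) = G y)
      \<and> (\<forall>y\<in>N \<inter> bring_cone. f (proj_point (invariants y)) = G y)"
  shows "hol elliptic V f"
  unfolding hol_elliptic_iff locally_hol_def
proof
  fix L assume "L \<in> {L \<in> proj_point ` bring_cone. invariants ` L \<in> V}"
  then obtain x where x: "x \<in> bring_cone" "L = proj_point x" "proj_point (invariants x) \<in> V"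
    by (auto simp: invariants_image_proj_point)
  obtain N G where N: "open N" "0 \<notin> N" "x \<in> N" "\<forall>y\<in>N. cdiff_at G y"
    "\<forall>y\<in>N. \<forall>m. m \<noteq> 0 \<longrightarrow> m *s y \<in> N \<and> G (m *s y) = G y"
    "\<forall>y\<in>N \<inter> bring_cone. f (proj_point (invariants y)) = G y"
    using assms[OF x(1,3)] by blast
  obtain P F where P: "openin (topo projective_space) P" "hol projective_space P F"
    "\<And>x. x \<noteq> 0 \<Longrightarrow> proj_point x \<in> P \<longleftrightarrow> x \<in> N" "\<And>x. x \<in> N \<Longrightarrow> F (proj_point x) = G x"
    using hol_projective_space_extension[OF N(1,2), of G] N(4,5) by blast
  show "\<exists>P F. openin (topo projective_space) P \<and> L \<in> P \<and> hol projective_space P F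
    \<and> (\<forall>q\<in>{L \<in> proj_point ` bring_cone. invariants ` L \<in> V} \<inter> P. (f \<circ> (`) invariants) q = F q)"
  proof (intro exI conjI ballI)
    show "L \<in> P" using P(3)[OF bring_cone_neq_0] x N(3) by simp
    fix q assume "q \<in> {L \<in> proj_point ` bring_cone. invariants ` L \<in> V} \<inter> P"
    then obtain y where y: "y \<in> bring_cone" "q = proj_point y" "proj_point y \<in> P" by auto
    then have "y \<in> N" using P(3)[OF bring_cone_neq_0] by simp
    then show "(f \<circ> (`) invariants) q = F q"
      using y N(6) P(4) by (simp add: invariants_image_proj_point)
  qed (use P in auto)
qed

end

section \<open>Charts of the quotient curve\<close>

lemma holomorphic_local_inverse:
  assumes "f holomorphic_on S" "open S" "z0 \<in> S" "deriv f z0 \<noteq> 0"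
  obtains N g where "open N" "z0 \<in> N" "N \<subseteq> S" "open (f ` N)" "g holomorphic_on f ` N"
    "\<And>z. z \<in> N \<Longrightarrow> g (f z) = z"
proof -
  obtain r where r: "r > 0" "ball z0 r \<subseteq> S" "open (f ` ball z0 r)" "inj_on f (ball z0 r)"
    using has_complex_derivative_locally_invertible[OF assms(1,3,2,4)] .
  obtain g where "g holomorphic_on f ` ball z0 r" "\<And>z. z \<in> ball z0 r \<Longrightarrow> g (f z) = z"
  proof (rule holomorphic_has_inverse[OF holomorphic_on_subset[OF assms(1) r(2)] open_ball r(4)])
    fix g assume "g holomorphic_on f ` ball z0 r" "\<And>z. z \<in> ball z0 r \<Longrightarrow> g (f z) = z"
    then show thesis by (rule that)
  qed
  then show thesis using that[of "ball z0 r" g] r by simp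
qed

text \<open>A Bezout identity between \<open>disc\<close> and its derivative. It expresses that the
  cubic has no singular point with Y = 0.\<close>

lemma disc_simple_root:
  assumes "disc s = 0" shows "768 * s^2 - 406 * s + 88 \<noteq> 0"
proof
  assume "768 * s^2 - 406 * s + 88 = 0"
  moreover have "(27298 - 162048 * s) * disc s + (7236 - 23377 * s + 54016 * s^2) * (768 * s^2 - 406 * s + 88) = 200000"
    unfolding disc_def by (simp add: algebra_simps power2_eq_square power3_eq_cube)
  ultimately show False using assms by simp
qed

lemma has_field_derivative_disc: "(disc has_field_derivative 768 * s^2 - 406 * s + 88) (at s)"
  unfolding disc_def[abs_def] by (auto intro!: derivative_eq_intros)

lemma holomorphic_on_disc: "disc holomorphic_on S"
  unfolding disc_def[abs_def] by (intro holomorphic_intros)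

lemma finite_disc_roots: "finite {s. disc s = 0}"
proof -
  have "disc s = poly [:-16, 88, -203, 256:] s" for s
    unfolding disc_def by (simp add: algebra_simps power2_eq_square power3_eq_cube)
  then show ?thesis using poly_roots_finite[of "[:-16, 88, -203, 256 :: complex:]"] by simp
qed

text \<open>The quartic is linear in s, so the root is taken as the parameter: s is \<open>R\<close>
  of the root, the derivative of \<open>R\<close> does not vanish at a simple root, and the branch
  is a local inverse of \<open>R\<close>.\<close>

lemma simple_quartic_root_section:
  fixes p s0 :: complex
  assumes p: "p^4 + p^3 + p^2 + p + s0 = 0" and simple: "4 * p^3 + 3 * p^2 + 2 * p + 1 \<noteq> 0"
  obtains N g where "open N" "s0 \<in> N" "g holomorphic_on N" "g s0 = p"
    "\<And>s. s \<in> N \<Longrightarrow> g s^4 + g s^3 + g s^2 + g s + s = 0"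
proof -
  define R where "R = (\<lambda>z :: complex. - (z^4 + z^3 + z^2 + z))"
  have "(R has_field_derivative - (4 * p^3 + 3 * p^2 + 2 * p + 1)) (at p)"
    unfolding R_def by (auto intro!: derivative_eq_intros)
  then have "deriv R p \<noteq> 0" using simple by (metis DERIV_imp_deriv neg_equal_0_iff_equal)
  moreover have "R holomorphic_on UNIV" unfolding R_def by (intro holomorphic_intros)
  ultimately obtain N g where N: "open N" "p \<in> N" "open (R ` N)" "g holomorphic_on R ` N"
      "\<And>z. z \<in> N \<Longrightarrow> g (R z) = z"
    using holomorphic_local_inverse[of R UNIV p] by auto
  have Rp: "R p = s0" unfolding R_def using p by algebra
  show thesis
  proof (rule that[OF N(3) _ N(4)])
    show "s0 \<in> R ` N" "g s0 = p" using Rp N(2,5) by auto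
    show "g s^4 + g s^3 + g s^2 + g s + s = 0" if "s \<in> R ` N" for s
      using that N(5) unfolding R_def by auto
  qed
qed

text \<open>Divided differences of the quartic vanish at distinct roots. The third one yields the
  sum of the roots, and the second, the first and the quartic itself then yield the other symmetric
  functions. Thus four branches continued separately are together all the roots as long as they stay
  distinct.\<close>

lemma quartic_of_distinct_roots:
  fixes p q r u s :: complex
  assumes root: "\<And>x. x \<in> {p, q, r, u} \<Longrightarrow> x^4 + x^3 + x^2 + x + s = 0"
    and ne: "(p-q)*(p-r)*(p-u)*(q-r)*(q-u)*(r-u) \<noteq> 0"
  shows "p + q + r + u = -1" "p*q + p*r + p*u + q*r + q*u + r*u = 1"
    "p*q*r + p*q*u + p*r*u + q*r*u = -1" "p*q*r*u = s"
proof -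
  have d1: "x^3 + x^2*y + x*y^2 + y^3 + x^2 + x*y + y^2 + x + y + 1 = 0"
    if "x \<in> {p, q, r, u}" "y \<in> {p, q, r, u}" "x - y \<noteq> 0" for x y
  proof -
    have "(x - y) * (x^3 + x^2*y + x*y^2 + y^3 + x^2 + x*y + y^2 + x + y + 1) = 0"
      using root[OF that(1)] root[OF that(2)] by algebra
    then show ?thesis using that(3) by simp
  qed
  have d2: "x^2 + x*y + x*z + y^2 + y*z + z^2 + x + y + z + 1 = 0"
    if "x \<in> {p, q, r, u}" "y \<in> {p, q, r, u}" "z \<in> {p, q, r, u}" "x - y \<noteq> 0" "x - z \<noteq> 0" "y - z \<noteq> 0" for x y z
  proof -
    have "(y - z) * (x^2 + x*y + x*z + y^2 + y*z + z^2 + x + y + z + 1) = 0"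
      using d1[OF that(1,2,4)] d1[OF that(1,3,5)] by algebra
    then show ?thesis using that(6) by simp
  qed
  have pqr: "p^2 + p*q + p*r + q^2 + q*r + r^2 + p + q + r + 1 = 0"
    and pqu: "p^2 + p*q + p*u + q^2 + q*u + u^2 + p + q + u + 1 = 0"
    using ne by (auto intro!: d2)
  have pq: "p^3 + p^2*q + p*q^2 + q^3 + p^2 + p*q + q^2 + p + q + 1 = 0"
    using ne by (auto intro!: d1)
  have "(r - u) * (p + q + r + u + 1) = 0" using pqr pqu by algebra
  then have "p + q + r + u + 1 = 0" using ne by simp
  then show e1: "p + q + r + u = -1" by algebra
  show e2: "p*q + p*r + p*u + q*r + q*u + r*u = 1" using e1 pqr by algebra
  show e3: "p*q*r + p*q*u + p*r*u + q*r*u = -1" using e1 e2 pq by algebra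
  show "p*q*r*u = s" using e1 e2 e3 root[OF insertI1] by algebra
qed

text \<open>As \<open>y0\<close> is nonzero, the four roots over \<open>s0\<close> are simple and
  each continues as a holomorphic branch of its own. The sign of the Vandermonde product is
  prescribed at \<open>s0\<close> only.\<close>

lemma (in labelling) local_section:
  assumes "y0^2 = disc s0" "y0 \<noteq> 0"
  obtains N \<sigma> where "open N" "s0 \<in> N" "\<And>i. (\<lambda>s. \<sigma> s $ i) holomorphic_on N"
    "\<And>s. s \<in> N \<Longrightarrow> \<sigma> s \<in> bring_cone" "\<And>s. s \<in> N \<Longrightarrow> \<sigma> s $ k = 1"
    "\<And>s. s \<in> N \<Longrightarrow> root_prod (\<sigma> s) = s" "vandermonde (\<sigma> s0) = y0"
proof -
  obtain x where x: "x \<in> bring_cone" "x $ k = 1" "root_prod x = s0" "vandermonde x = y0"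
    using ex_bring_cone[of y0 s0] assms unfolding disc_def by blast
  have es: "x $ a + x $ b + x $ c + x $ d = -1"
    "x $ a * x $ b + x $ a * x $ c + x $ a * x $ d + x $ b * x $ c + x $ b * x $ d + x $ c * x $ d = 1"
    "x $ a * x $ b * x $ c + x $ a * x $ b * x $ d + x $ a * x $ c * x $ d + x $ b * x $ c * x $ d = -1"
    using x(1,2) unfolding bring_cone_labels by simp_all
  have V: "vandermonde x \<noteq> 0" using x(4) assms(2) by simp
  have branch: "\<exists>N g. open N \<and> s0 \<in> N \<and> g holomorphic_on N \<and> g s0 = p
      \<and> (\<forall>s\<in>N. g s^4 + g s^3 + g s^2 + g s + s = 0)"
    if e: "p + q + r + u = -1" "p*q + p*r + p*u + q*r + q*u + r*u = 1"
      "p*q*r + p*q*u + p*r*u + q*r*u = -1" "p*q*r*u = s0" and ne: "(p - q) * (p - r) * (p - u) \<noteq> 0" for p q r u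
  proof -
    \<comment> \<open>The right-hand side is the derivative of the quartic at its root
      \<open>p\<close>.\<close>
    have "(p - q) * (p - r) * (p - u) = 4 * p^3 + 3 * p^2 + 2 * p + 1" using e(1-3) by algebra
    then have "4 * p^3 + 3 * p^2 + 2 * p + 1 \<noteq> 0" using ne by simp
    moreover have "p^4 + p^3 + p^2 + p + s0 = 0" using e by algebra
    ultimately show ?thesis using simple_quartic_root_section[of p s0] by metis
  qed
  note s0 = x(3)[unfolded root_prod_def]
  have ne: "x $ a \<noteq> x $ b" "x $ a \<noteq> x $ c" "x $ a \<noteq> x $ d" "x $ b \<noteq> x $ c" "x $ b \<noteq> x $ d" "x $ c \<noteq> x $ d"
    using V unfolding vandermonde_def by auto
  obtain Na ga where a: "open Na" "s0 \<in> Na" "ga holomorphic_on Na" "ga s0 = x $ a"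
      "\<And>s. s \<in> Na \<Longrightarrow> ga s^4 + ga s^3 + ga s^2 + ga s + s = 0"
  proof -
    have "(x $ a - x $ b) * (x $ a - x $ c) * (x $ a - x $ d) \<noteq> 0" using ne by simp
    then show thesis
      using branch[of "x $ a" "x $ b" "x $ c" "x $ d"] es s0 that by (simp add: ac_simps) blast
  qed
  obtain Nb gb where b: "open Nb" "s0 \<in> Nb" "gb holomorphic_on Nb" "gb s0 = x $ b"
      "\<And>s. s \<in> Nb \<Longrightarrow> gb s^4 + gb s^3 + gb s^2 + gb s + s = 0"
  proof -
    have "(x $ b - x $ a) * (x $ b - x $ c) * (x $ b - x $ d) \<noteq> 0" using ne by simp
    then show thesis
      using branch[of "x $ b" "x $ a" "x $ c" "x $ d"] es s0 that by (simp add: ac_simps) blast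
  qed
  obtain Nc gc where c: "open Nc" "s0 \<in> Nc" "gc holomorphic_on Nc" "gc s0 = x $ c"
      "\<And>s. s \<in> Nc \<Longrightarrow> gc s^4 + gc s^3 + gc s^2 + gc s + s = 0"
  proof -
    have "(x $ c - x $ a) * (x $ c - x $ b) * (x $ c - x $ d) \<noteq> 0" using ne by simp
    then show thesis
      using branch[of "x $ c" "x $ a" "x $ b" "x $ d"] es s0 that by (simp add: ac_simps) blast
  qed
  obtain Nd gd where d: "open Nd" "s0 \<in> Nd" "gd holomorphic_on Nd" "gd s0 = x $ d"
      "\<And>s. s \<in> Nd \<Longrightarrow> gd s^4 + gd s^3 + gd s^2 + gd s + s = 0"
  proof -
    have "(x $ d - x $ a) * (x $ d - x $ b) * (x $ d - x $ c) \<noteq> 0" using ne by simp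
    then show thesis
      using branch[of "x $ d" "x $ a" "x $ b" "x $ c"] es s0 that by (simp add: ac_simps) blast
  qed
  define M where "M = Na \<inter> Nb \<inter> Nc \<inter> Nd"
  have M: "open M" "s0 \<in> M" unfolding M_def using a b c d by auto
  have hol: "ga holomorphic_on M" "gb holomorphic_on M" "gc holomorphic_on M" "gd holomorphic_on M"
    using a(3) b(3) c(3) d(3) by (auto elim: holomorphic_on_subset simp: M_def)
  define \<sigma> where "\<sigma> s = labelled (ga s) (gb s) (gc s) (gd s) 1" for s
  \<comment> \<open>Here the branches stay distinct.\<close>
  define N where "N = M \<inter> (\<lambda>s. vandermonde (\<sigma> s)) -` (- {0})"
  have "(\<lambda>s. vandermonde (\<sigma> s)) holomorphic_on M"
    unfolding vandermonde_def \<sigma>_def labelled_nth using hol by (intro holomorphic_intros)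
  then have N: "open N"
    unfolding N_def by (intro continuous_open_preimage holomorphic_on_imp_continuous_on M) auto
  have "\<sigma> s0 = x" unfolding \<sigma>_def vec_eq_labels using a(4) b(4) c(4) d(4) x(2) by simp
  show thesis
  proof (rule that[OF N])
    show "s0 \<in> N" unfolding N_def using M(2) \<open>\<sigma> s0 = x\<close> V by simp
    show "vandermonde (\<sigma> s0) = y0" using \<open>\<sigma> s0 = x\<close> x(4) by simp
    show "(\<lambda>s. \<sigma> s $ i) holomorphic_on N" for i
    proof -
      have "(\<lambda>s. \<sigma> s $ i) holomorphic_on M"
        using label_cases[of i] hol unfolding \<sigma>_def by (elim disjE) simp_all
      then show ?thesis by (rule holomorphic_on_subset) (simp add: N_def)
    qed
    fix s assume s: "s \<in> N"
    have roots: "z^4 + z^3 + z^2 + z + s = 0" if "z \<in> {ga s, gb s, gc s, gd s}" for z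
      using that s a(5) b(5) c(5) d(5) unfolding N_def M_def by auto
    have ne: "(ga s - gb s)*(ga s - gc s)*(ga s - gd s)*(gb s - gc s)*(gb s - gd s)*(gc s - gd s) \<noteq> 0"
      using s unfolding N_def vandermonde_def \<sigma>_def labelled_nth by simp
    note e = quartic_of_distinct_roots[OF roots ne]
    show "\<sigma> s $ k = 1" unfolding \<sigma>_def by simp
    show "root_prod (\<sigma> s) = s" unfolding root_prod_def \<sigma>_def labelled_nth using e(4) by blast
    have "\<sigma> s \<noteq> 0" unfolding \<sigma>_def vec_eq_labels by simp
    then show "\<sigma> s \<in> bring_cone" unfolding bring_cone_labels \<sigma>_def labelled_nth using e by simp
  qed
qed

text \<open>A local parametrisation of the cubic, phrased in C^3 alone: the coordinate is the ratio
  of entries \<open>i\<close> and \<open>j\<close>, \<open>\<psi>\<close> is its inverse with values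
  in the cone, and the open cone \<open>U\<close> cuts out the domain. Both ratio and cone can be
  pulled back to C^5 along the invariants.\<close>

definition cubic_chart :: "complex set \<Rightarrow> (complex \<Rightarrow> complex^3) \<Rightarrow> 3 \<Rightarrow> 3 \<Rightarrow> (complex^3) set \<Rightarrow> bool"
  where "cubic_chart W \<psi> i j U \<longleftrightarrow> open W \<and> open U \<and> (\<forall>n. (\<lambda>z. \<psi> z $ n) holomorphic_on W)
    \<and> (\<forall>z\<in>W. \<psi> z \<in> U \<inter> cubic_cone \<and> \<psi> z $ i / \<psi> z $ j = z)
    \<and> (\<forall>v\<in>U. v $ j \<noteq> 0 \<and> (\<forall>m. m \<noteq> 0 \<longrightarrow> m *s v \<in> U))
    \<and> (\<forall>v\<in>U \<inter> cubic_cone. v $ i / v $ j \<in> W \<and> proj_point v = proj_point (\<psi> (v $ i / v $ j)))"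

lemma continuous_on_nth_vec: "continuous_on S (\<lambda>v :: complex^'n. v $ i)"
  by (intro continuous_intros)

lemma open_quotient_preimage:
  fixes f g :: "complex^'n \<Rightarrow> complex"
  assumes "continuous_on UNIV f" "continuous_on UNIV g" "open T"
  shows "open {v. g v \<noteq> 0 \<and> f v / g v \<in> T}"
proof -
  have "open {v. g v \<noteq> 0}" using assms(2) by (intro open_Collect_neq) auto
  moreover have "continuous_on {v. g v \<noteq> 0} (\<lambda>v. f v / g v)"
    using assms continuous_on_subset by (intro continuous_on_divide) blast+
  ultimately have "open ({v. g v \<noteq> 0} \<inter> (\<lambda>v. f v / g v) -` T)"
    using assms(3) by (intro continuous_open_preimage)
  moreover have "{v. g v \<noteq> 0} \<inter> (\<lambda>v. f v / g v) -` T = {v. g v \<noteq> 0 \<and> f v / g v \<in> T}" by auto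
  ultimately show ?thesis by simp
qed

lemma holomorphic_on_vec3:
  assumes "f holomorphic_on W" "g holomorphic_on W" "h holomorphic_on W"
  shows "(\<lambda>z. vec3 (f z) (g z) (h z) $ n) holomorphic_on W"
  using exhaust_3[of n] assms by (elim disjE) simp_all

text \<open>Where Y and Z are nonzero, X/Z is a coordinate and Y/Z a holomorphic square root of the
  discriminant.\<close>

lemma cubic_chart_unramified:
  assumes "y0^2 = disc s0" "y0 \<noteq> 0"
  obtains W \<psi> U where "cubic_chart W \<psi> 1 3 U" "vec3 s0 y0 1 \<in> U" "\<And>z. \<psi> z $ 3 = 1"
proof -
  define q where "q = (\<lambda>y :: complex. y^2)"
  have "(q has_field_derivative 2 * y0) (at y0)"
    unfolding q_def by (auto intro!: derivative_eq_intros)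
  then have "deriv q y0 \<noteq> 0" using assms(2) DERIV_imp_deriv by fastforce
  moreover have "q holomorphic_on UNIV" unfolding q_def by (intro holomorphic_intros)
  ultimately obtain N g where N: "open N" "y0 \<in> N" "open (q ` N)" "g holomorphic_on q ` N"
      "\<And>z. z \<in> N \<Longrightarrow> g (q z) = z"
    using holomorphic_local_inverse[of q UNIV y0] by auto
  define W where "W = disc -` (q ` N)"
  define \<psi> where "\<psi> z = vec3 z (g (disc z)) 1" for z
  \<comment> \<open>The second condition keeps Y/Z in \<open>N\<close> and thereby on one branch of
    the square root.\<close>
  define U where "U = {v :: complex^3. v $ 3 \<noteq> 0 \<and> v $ 1 / v $ 3 \<in> W} \<inter> {v. v $ 3 \<noteq> 0 \<and> v $ 2 / v $ 3 \<in> N}"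
  have W: "open W" unfolding W_def
    using N(3) holomorphic_on_imp_continuous_on[OF holomorphic_on_disc[of UNIV]] by (rule open_vimage)
  show thesis
  proof (rule that)
    show "cubic_chart W \<psi> 1 3 U"
      unfolding cubic_chart_def
    proof (intro conjI ballI allI impI)
      show "open U" unfolding U_def using W N(1)
        by (intro open_Int open_quotient_preimage continuous_on_nth_vec)
      have "g \<circ> disc holomorphic_on W"
        by (rule holomorphic_on_compose_gen[OF holomorphic_on_disc N(4)]) (auto simp: W_def)
      then show "(\<lambda>z. \<psi> z $ n) holomorphic_on W" for n
        unfolding \<psi>_def by (intro holomorphic_on_vec3 holomorphic_intros) (simp add: o_def)
      show "\<psi> z \<in> U \<inter> cubic_cone" "\<psi> z $ 1 / \<psi> z $ 3 = z" if z: "z \<in> W" for z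
      proof -
        obtain y where y: "y \<in> N" "disc z = q y" using z unfolding W_def by blast
        have "\<psi> z \<in> cubic_cone"
          unfolding \<psi>_def cubic_cone_affine using y N(5) by (simp add: q_def)
        then show "\<psi> z \<in> U \<inter> cubic_cone" "\<psi> z $ 1 / \<psi> z $ 3 = z" 
          unfolding U_def \<psi>_def using y N(5) z by simp_all
      qed
      show "v $ 3 \<noteq> 0" if "v \<in> U" for v using that unfolding U_def by simp
      show "m *s v \<in> U" if "v \<in> U" "m \<noteq> 0" for v m using that unfolding U_def by simp
      fix v assume v: "v \<in> U \<inter> cubic_cone"
      then show "v $ 1 / v $ 3 \<in> W" unfolding U_def by simp
      from v have "v \<in> cubic_cone" by simp
      then show "proj_point v = proj_point (\<psi> (v $ 1 / v $ 3))"
      proof (cases rule: cubic_cone_cases)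
        case (affine s y)
        then have "y \<in> N" "disc s = q y" using v unfolding U_def q_def by simp_all
        then show ?thesis using affine N(5) unfolding \<psi>_def by metis
      next
        case infinity
        then show ?thesis using v unfolding U_def by simp
      qed
    qed (rule W)
    show "vec3 s0 y0 1 \<in> U" unfolding U_def W_def using N(2) assms(1) unfolding q_def by force
    show "\<psi> z $ 3 = 1" for z unfolding \<psi>_def by simp
  qed
qed

text \<open>Here Y/Z is the coordinate: as the root is simple, \<open>disc\<close> is locally
  invertible, and X/Z is a function of the square of Y/Z.\<close>

lemma cubic_chart_ramified:
  assumes "disc s0 = 0"
  obtains W \<psi> U where "cubic_chart W \<psi> 2 3 U" "vec3 s0 0 1 \<in> U" "\<And>z. \<psi> z $ 3 = 1"
proof -
  have "deriv disc s0 \<noteq> 0"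
    using DERIV_imp_deriv[OF has_field_derivative_disc[of s0]] disc_simple_root[OF assms] by simp
  then obtain N g where N: "open N" "s0 \<in> N" "open (disc ` N)" "g holomorphic_on disc ` N"
      "\<And>z. z \<in> N \<Longrightarrow> g (disc z) = z"
    using holomorphic_local_inverse[of disc UNIV s0] holomorphic_on_disc by auto
  define W where "W = {z. z^2 \<in> disc ` N}"
  define \<psi> where "\<psi> z = vec3 (g (z^2)) z 1" for z
  define U where "U = {v :: complex^3. v $ 3 \<noteq> 0 \<and> v $ 1 / v $ 3 \<in> N}"
  have W: "open W"
    using open_vimage[OF N(3), of "\<lambda>z. z^2"] unfolding W_def vimage_def by (simp add: continuous_intros)
  show thesis
  proof (rule that)
    show "cubic_chart W \<psi> 2 3 U"
      unfolding cubic_chart_def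
    proof (intro conjI ballI allI impI)
      show "open U" unfolding U_def using N(1) by (intro open_quotient_preimage continuous_on_nth_vec)
      have "g \<circ> (\<lambda>z. z^2) holomorphic_on W"
        by (rule holomorphic_on_compose_gen[OF _ N(4)]) (auto simp: W_def intro!: holomorphic_intros)
      then show "(\<lambda>z. \<psi> z $ n) holomorphic_on W" for n
        unfolding \<psi>_def by (intro holomorphic_on_vec3 holomorphic_intros) (simp add: o_def)
      show "\<psi> z \<in> U \<inter> cubic_cone" "\<psi> z $ 2 / \<psi> z $ 3 = z" if z: "z \<in> W" for z
      proof -
        obtain s where s: "s \<in> N" "z^2 = disc s" using z unfolding W_def by blast
        have "\<psi> z \<in> cubic_cone"
          unfolding \<psi>_def cubic_cone_affine using s N(5) by simp
        then show "\<psi> z \<in> U \<inter> cubic_cone" "\<psi> z $ 2 / \<psi> z $ 3 = z" 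
          unfolding U_def \<psi>_def using s N(5) by simp_all
      qed
      show "v $ 3 \<noteq> 0" if "v \<in> U" for v using that unfolding U_def by simp
      show "m *s v \<in> U" if "v \<in> U" "m \<noteq> 0" for v m using that unfolding U_def by simp
      fix v assume v: "v \<in> U \<inter> cubic_cone"
      then have c: "v \<in> cubic_cone" by simp
      then have "v $ 2 / v $ 3 \<in> W \<and> proj_point v = proj_point (\<psi> (v $ 2 / v $ 3))"
      proof (cases rule: cubic_cone_cases)
        case (affine s y)
        then have s: "s \<in> N" using v unfolding U_def by simp
        then have "y \<in> W" "g (y^2) = s" using affine(2) N(5) unfolding W_def by auto
        then show ?thesis using affine unfolding \<psi>_def by metis
      next
        case infinity
        then show ?thesis using v unfolding U_def by simp
      qed
      then show "v $ 2 / v $ 3 \<in> W" "proj_point v = proj_point (\<psi> (v $ 2 / v $ 3))" by simp_all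
    qed (rule W)
    show "vec3 s0 0 1 \<in> U" unfolding U_def using N(2) by simp
    show "\<psi> z $ 3 = 1" for z unfolding \<psi>_def by simp
  qed
qed

text \<open>With \<open>u = X/Y\<close> and \<open>v = Z/Y\<close> the equation of the cubic reads
  \<open>v (1 + 203 u\<^sup>2 - 88 u v + 16 v\<^sup>2) = 256 u\<^sup>3\<close>. Near the origin the quotient
  \<open>r = v/u\<close> extends to \<open>256 u\<^sup>2 / (1 + 203 u\<^sup>2 - 88 u v + 16 v\<^sup>2)\<close>, and
  \<open>u\<^sup>2\<close> is a locally invertible function of \<open>r\<close>.\<close>

lemma cubic_chart_infinity:
  obtains W \<psi> U where "cubic_chart W \<psi> 1 2 U" "vec3 0 1 0 \<in> U"
proof -
  \<comment> \<open>Putting v = u r into the equation and cancelling u gives r = u^2 K(r), so u^2 =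
    h(r), and h has derivative 1/256 at 0.\<close>
  define K where "K r = 256 - 203 * r + 88 * r^2 - 16 * r^3" for r :: complex
  define h where "h r = r / K r" for r
  define S where "S = {r. K r \<noteq> 0}"
  have "continuous_on UNIV K" unfolding K_def by (intro continuous_intros)
  then have S: "open S" unfolding S_def by (intro open_Collect_neq) auto
  have holh: "h holomorphic_on S" unfolding h_def K_def S_def by (intro holomorphic_intros) auto
  have "(h has_field_derivative 1 / 256) (at 0)"
    unfolding h_def K_def by (auto intro!: derivative_eq_intros)
  then have "deriv h 0 \<noteq> 0" using DERIV_imp_deriv by fastforce
  moreover have "0 \<in> S" unfolding S_def K_def by simp
  ultimately obtain N g where N: "open N" "0 \<in> N" "N \<subseteq> S" "open (h ` N)" "g holomorphic_on h ` N"
      "\<And>z. z \<in> N \<Longrightarrow> g (h z) = z"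
    using holomorphic_local_inverse[OF holh S] by metis
  define den where "den v = (v $ 2)^2 + 203 * (v $ 1)^2 - 88 * v $ 1 * v $ 3 + 16 * (v $ 3)^2" for v :: "complex^3"
  define W where "W = {z. z^2 \<in> h ` N}"
  define \<psi> where "\<psi> z = vec3 z 1 (z * g (z^2))" for z
  \<comment> \<open>\<open>den\<close> is the denominator made homogeneous with Y. Membership in
    \<open>N\<close> is required of 256 X^2 / \<open>den\<close> and not of Z/X, which has no
    meaning at the point at infinity.\<close>
  define U where "U = {v. v $ 2 \<noteq> 0} \<inter> {v. den v \<noteq> 0 \<and> 256 * (v $ 1)^2 / den v \<in> N}"
  have W: "open W"
    using open_vimage[OF N(4), of "\<lambda>z. z^2"] unfolding W_def vimage_def by (simp add: continuous_intros)
  show thesis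
  proof (rule that)
    show "cubic_chart W \<psi> 1 2 U"
      unfolding cubic_chart_def
    proof (intro conjI ballI allI impI)
      have "continuous_on UNIV den" unfolding den_def by (intro continuous_intros)
      moreover have "open {v :: complex^3. v $ 2 \<noteq> 0}"
        by (intro open_Collect_neq continuous_intros)
      ultimately show "open U" unfolding U_def
        by (intro open_Int open_quotient_preimage N(1)) (auto intro!: continuous_intros)
      have "g \<circ> (\<lambda>z. z^2) holomorphic_on W"
        by (rule holomorphic_on_compose_gen[OF _ N(5)]) (auto simp: W_def intro!: holomorphic_intros)
      then show "(\<lambda>z. \<psi> z $ n) holomorphic_on W" for n
        unfolding \<psi>_def by (intro holomorphic_on_vec3 holomorphic_intros) (simp add: o_def)
      show "\<psi> z \<in> U \<inter> cubic_cone" "\<psi> z $ 1 / \<psi> z $ 2 = z" if z: "z \<in> W" for z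
      proof -
        obtain r where r: "r \<in> N" "z^2 = h r" using z unfolding W_def by blast
        have K: "K r \<noteq> 0" using r N(3) unfolding S_def by auto
        have zr: "z^2 * K r = r" using r(2) K unfolding h_def by simp
        have \<psi>: "\<psi> z = vec3 z 1 (z * r)" unfolding \<psi>_def r(2) using N(6) r(1) by simp
        have den: "r * den (\<psi> z) = 256 * z^2"
        proof -
          have "r * den (\<psi> z) = r + 256 * z^2 - z^2 * K r"
            unfolding \<psi> den_def vec3_nth K_def by (simp add: algebra_simps power2_eq_square power3_eq_cube)
          then show ?thesis using zr by simp
        qed
        have den0: "den (\<psi> z) \<noteq> 0"
        proof
          assume "den (\<psi> z) = 0"
          then have "z = 0" using den by simp
          then show False using \<open>den (\<psi> z) = 0\<close> unfolding \<psi> den_def by simp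
        qed
        then have "256 * z^2 / den (\<psi> z) = r" using den by (simp add: field_simps)
        then have "\<psi> z \<in> U" using r(1) den0 unfolding U_def \<psi> by simp
        moreover have "\<psi> z \<in> cubic_cone"
        proof -
          have "1^2 * (z * r) = 256 * z^3 - 203 * z^2 * (z * r) + 88 * z * (z * r)^2 - 16 * (z * r)^3"
          proof -
            have "z * r - (256 * z^3 - 203 * z^2 * (z * r) + 88 * z * (z * r)^2 - 16 * (z * r)^3)
                = z * (r * den (\<psi> z) - 256 * z^2)"
              unfolding \<psi> den_def vec3_nth by (simp add: algebra_simps power2_eq_square power3_eq_cube)
            then show ?thesis using den by simp
          qed
          then show ?thesis unfolding \<psi> cubic_cone_def by (simp add: vec3_eq_iff)
        qed
        ultimately show "\<psi> z \<in> U \<inter> cubic_cone" "\<psi> z $ 1 / \<psi> z $ 2 = z" unfolding \<psi> by simp_all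
      qed
      show "v $ 2 \<noteq> 0" if "v \<in> U" for v using that unfolding U_def by simp
      show "m *s v \<in> U" if "v \<in> U" "m \<noteq> 0" for v m
      proof -
        have "den (m *s v) = m^2 * den v" unfolding den_def vector_smult_component by algebra
        then show ?thesis using that unfolding U_def by (simp add: power_mult_distrib)
      qed
      fix v assume v: "v \<in> U \<inter> cubic_cone"
      define r where "r = 256 * (v $ 1)^2 / den v"
      have v2: "v $ 2 \<noteq> 0" and den: "den v \<noteq> 0" and r: "r \<in> N" using v unfolding U_def r_def by auto
      have rden: "r * den v = 256 * (v $ 1)^2" unfolding r_def using den by simp
      have "v $ 3 * den v = 256 * (v $ 1)^3"
        using v unfolding cubic_cone_def den_def by (auto simp: algebra_simps power2_eq_square power3_eq_cube)
      also have "\<dots> = (v $ 1 * r) * den v"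
        unfolding mult.assoc rden by (simp add: power2_eq_square power3_eq_cube)
      finally have v3: "v $ 3 = v $ 1 * r" using den by simp
      have "r * (v $ 2)^2 = (v $ 1)^2 * K r"
      proof -
        have "r * (v $ 2)^2 - (v $ 1)^2 * K r = r * den v - 256 * (v $ 1)^2"
          unfolding den_def v3 K_def by (simp add: algebra_simps power2_eq_square power3_eq_cube)
        then show ?thesis using rden by simp
      qed
      moreover have "K r \<noteq> 0" using r N(3) unfolding S_def by auto
      ultimately have sq: "(v $ 1 / v $ 2)^2 = h r" unfolding h_def using v2 by (simp add: field_simps)
      then show "v $ 1 / v $ 2 \<in> W" unfolding W_def using r by simp
      have "v = v $ 2 *s \<psi> (v $ 1 / v $ 2)"
        unfolding \<psi>_def sq N(6)[OF r] vec3_eq_iff using v2 v3 by simp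
      then show "proj_point v = proj_point (\<psi> (v $ 1 / v $ 2))"
        using v2 proj_point_scale by metis
    qed (rule W)
    show "vec3 0 1 0 \<in> U" unfolding U_def den_def using N(2) by simp
  qed
qed

section \<open>Holomorphic functions in charts\<close>

lemma cubic_chartD:
  assumes "cubic_chart W \<psi> i j U"
  shows "open W" "open U" "\<And>n. (\<lambda>z. \<psi> z $ n) holomorphic_on W"
    "\<And>z. z \<in> W \<Longrightarrow> \<psi> z \<in> U" "\<And>z. z \<in> W \<Longrightarrow> \<psi> z \<in> cubic_cone" "\<And>z. z \<in> W \<Longrightarrow> \<psi> z $ i / \<psi> z $ j = z"
    "\<And>v. v \<in> U \<Longrightarrow> v $ j \<noteq> 0" "\<And>v m. v \<in> U \<Longrightarrow> m \<noteq> 0 \<Longrightarrow> m *s v \<in> U"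
    "\<And>v. v \<in> U \<Longrightarrow> v \<in> cubic_cone \<Longrightarrow> v $ i / v $ j \<in> W"
    "\<And>v. v \<in> U \<Longrightarrow> v \<in> cubic_cone \<Longrightarrow> proj_point v = proj_point (\<psi> (v $ i / v $ j))"
  using assms unfolding cubic_chart_def by blast+

lemma ratio_of_proj_point:
  assumes "proj_point v = proj_point w" "v \<noteq> 0"
  shows "v $ i / v $ j = w $ i / w $ j"
  using proj_point_eq_iff[OF assms(2), of w] assms(1) by auto

lemma cubic_chart_inj:
  assumes chart: "cubic_chart W \<psi> i j U"
  shows "inj_on (\<lambda>z. proj_point (\<psi> z)) W"
proof (rule inj_onI)
  fix z w assume zw: "z \<in> W" "w \<in> W" "proj_point (\<psi> z) = proj_point (\<psi> w)"
  then have "\<psi> z $ i / \<psi> z $ j = \<psi> w $ i / \<psi> w $ j"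
    using ratio_of_proj_point cubic_cone_nonzero cubic_chartD(5)[OF chart] by blast
  then show "z = w" using zw cubic_chartD(6)[OF chart] by simp
qed

lemma cubic_chart_continuous:
  assumes chart: "cubic_chart W \<psi> i j U"
  shows "continuous_on W \<psi>"
proof -
  have "continuous_on W (\<lambda>z. \<psi> z $ n)" for n
    using cubic_chartD(3)[OF chart] by (rule holomorphic_on_imp_continuous_on)
  then show ?thesis
    using continuous_on_vec_lambda[of W "\<lambda>n z. \<psi> z $ n"] by (simp add: vec_lambda_eta)
qed

text \<open>Charts at points with Z nonzero are normalised to Z = 1, so that the entries of
  \<open>\<psi>\<close> are the affine coordinates X/Z and Y/Z themselves.\<close>

lemma ex_cubic_chart:
  assumes "v \<in> cubic_cone"
  obtains W \<psi> i j U where "cubic_chart W \<psi> i j U" "v \<in> U" "v $ 3 \<noteq> 0 \<Longrightarrow> j = 3 \<and> (\<forall>z\<in>W. \<psi> z $ 3 = 1)"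
  using assms
proof (cases rule: cubic_cone_cases)
  case (affine s y)
  have v: "v = v $ 3 *s vec3 s y 1" using affine by (simp add: vec3_eq_iff)
  have "\<exists>W \<psi> i U. cubic_chart W \<psi> i 3 U \<and> vec3 s y 1 \<in> U \<and> (\<forall>z. \<psi> z $ 3 = 1)"
  proof (cases "y = 0")
    case True
    then have "disc s = 0" using affine(2) by simp
    then show ?thesis using cubic_chart_ramified True by metis
  next
    case False
    then show ?thesis using cubic_chart_unramified affine(2) by metis
  qed
  then obtain W \<psi> i U where c: "cubic_chart W \<psi> i 3 U" "vec3 s y 1 \<in> U" "\<forall>z. \<psi> z $ 3 = 1" by blast
  then have "v \<in> U" using cubic_chartD(8)[OF c(1,2) affine(1)] v by simp
  then show thesis using that c by blast
next
  case infinity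
  obtain W \<psi> U where c: "cubic_chart W \<psi> 1 2 U" "vec3 0 1 0 \<in> U" using cubic_chart_infinity .
  have v: "v = v $ 2 *s vec3 0 1 0" using infinity by (simp add: vec3_eq_iff)
  then have "v \<in> U" using cubic_chartD(8)[OF c infinity(3)] by simp
  then show thesis using that c infinity by blast
qed

context labelling
begin

lemma cubic_chart_open_preimage:
  assumes chart: "cubic_chart W \<psi> i j U" and V: "openin (topo elliptic) V"
  shows "open {z \<in> W. proj_point (\<psi> z) \<in> V}"
proof -
  have "continuous_map (top_of_set W) (topo elliptic) (\<lambda>z. proj_point (\<psi> z))"
    using cubic_chart_continuous[OF chart] cubic_chartD(5)[OF chart] by (rule continuous_map_into_elliptic)
  then have "openin (top_of_set W) {z \<in> W. proj_point (\<psi> z) \<in> V}"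
    using openin_continuous_map_preimage[OF _ V] by fastforce
  then show ?thesis using openin_open_trans cubic_chartD(1)[OF chart] by blast
qed

text \<open>The easy direction: the coordinate pulls back to a quotient \<open>q\<close> of
  polynomials on C^5 that is homogeneous of degree 0, and composing with \<open>q\<close> extends
  the pullback of \<open>f\<close> to an open cone.\<close>

lemma hol_elliptic_of_chart:
  assumes chart: "cubic_chart W \<psi> i j U" and V: "openin (topo elliptic) V"
    and sub: "V \<subseteq> proj_point ` (U \<inter> cubic_cone)"
    and hol: "(\<lambda>z. f (proj_point (\<psi> z))) holomorphic_on {z \<in> W. proj_point (\<psi> z) \<in> V}"
  shows "hol elliptic V f"
proof (rule hol_ellipticI)
  note c = cubic_chartD[OF chart]
  define WV where "WV = {z \<in> W. proj_point (\<psi> z) \<in> V}"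
  define q where "q y = invariants y $ i / invariants y $ j" for y
  define N where "N = invariants -` U \<inter> {y. invariants y $ j \<noteq> 0 \<and> q y \<in> WV}"
  define G where "G y = f (proj_point (\<psi> (q y)))" for y
  have WV: "open WV" unfolding WV_def by (rule cubic_chart_open_preimage[OF chart V])
  have N: "open N" unfolding N_def q_def
    using WV c(2) continuous_on_invariants[of UNIV]
    by (intro open_Int open_vimage open_quotient_preimage continuous_intros) auto
  have inv: "cdiff_at (\<lambda>x. invariants x $ n) y" for n y
    using exhaust_3[of n] by (elim disjE) (simp_all add: root_prod_def vandermonde_def)
  have q_scale: "q (m *s y) = q y" if "m \<noteq> 0" for m y
    unfolding q_def using that by (simp add: invariants_scale)
  fix x assume x: "x \<in> bring_cone" "proj_point (invariants x) \<in> V"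
  have invU: "invariants y \<in> U" if y: "y \<in> bring_cone" "proj_point (invariants y) \<in> V" for y
  proof -
    obtain v where v: "v \<in> U" "v \<in> cubic_cone" "proj_point v = proj_point (invariants y)" using y sub by auto
    then obtain m where "m \<noteq> 0" "invariants y = m *s v"
      using proj_point_eq_iff[of v "invariants y"] cubic_cone_nonzero by auto
    then show ?thesis using c(8) v(1) by simp
  qed
  have proj_q: "proj_point (invariants y) = proj_point (\<psi> (q y))" "q y \<in> W"
    if "y \<in> bring_cone" "invariants y \<in> U" for y
    unfolding q_def using c(9,10)[OF that(2) invariants_cubic[OF that(1)]] by simp_all
  show "\<exists>N G. open N \<and> 0 \<notin> N \<and> x \<in> N \<and> (\<forall>y\<in>N. cdiff_at G y)
      \<and> (\<forall>y\<in>N. \<forall>m. m \<noteq> 0 \<longrightarrow> m *s y \<in> N \<and> G (m *s y) = G y)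
      \<and> (\<forall>y\<in>N \<inter> bring_cone. f (proj_point (invariants y)) = G y)"
  proof (intro exI conjI ballI allI impI)
    show "open N" by (rule N)
    have "invariants 0 = 0" by (simp add: vec3_eq_iff root_prod_def vandermonde_def)
    then show "0 \<notin> N" unfolding N_def by simp
    show "x \<in> N" unfolding N_def WV_def
      using invU[OF x] proj_q[OF x(1)] x c(7) by auto
    show "cdiff_at G y" if y: "y \<in> N" for y
      unfolding G_def
    proof (rule cdiff_at_compose[where g = "\<lambda>z. f (proj_point (\<psi> z))"])
      show "cdiff_at q y" unfolding q_def
        using y inv unfolding N_def by (intro cdiff_at_divide) auto
      show "(\<lambda>z. f (proj_point (\<psi> z))) field_differentiable at (q y)"
        using hol WV y unfolding N_def WV_def[symmetric]
        using holomorphic_on_imp_differentiable_at by blast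
    qed
    show "m *s y \<in> N" "G (m *s y) = G y" if "y \<in> N" "m \<noteq> 0" for y m
    proof -
      have "invariants (m *s y) \<in> U" using that c(8) unfolding N_def by (simp add: invariants_scale)
      then show "m *s y \<in> N" using that q_scale unfolding N_def by (simp add: invariants_scale)
      show "G (m *s y) = G y" using that q_scale unfolding G_def by simp
    qed
    show "f (proj_point (invariants y)) = G y" if "y \<in> N \<inter> bring_cone" for y
      using that proj_q(1)[of y] unfolding G_def N_def by simp
  qed
qed

text \<open>Continuity of holomorphic functions, obtained on the cone from their local extensions.
  The removal of singularities depends on it.\<close>

lemma openin_elliptic_vimage:
  assumes V: "openin (topo elliptic) V" and hol: "hol elliptic V f" and T: "open T"
  shows "openin (topo elliptic) {p \<in> V. f p \<in> T}"
  unfolding openin_elliptic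
proof
  show "{p \<in> V. f p \<in> T} \<subseteq> proj_point ` cubic_cone" using V unfolding openin_elliptic by auto
  show "openin (top_of_set bring_cone) {x \<in> bring_cone. proj_point (invariants x) \<in> {p \<in> V. f p \<in> T}}"
  proof (subst openin_subopen, intro ballI)
    fix x assume "x \<in> {x \<in> bring_cone. proj_point (invariants x) \<in> {p \<in> V. f p \<in> T}}"
    then have x: "x \<in> bring_cone" "proj_point (invariants x) \<in> V" "f (proj_point (invariants x)) \<in> T" by auto
    obtain N G where N: "open N" "x \<in> N" "\<And>y. y \<in> N \<Longrightarrow> cdiff_at G y"
      "\<And>y. y \<in> N \<Longrightarrow> y \<in> bring_cone \<Longrightarrow> proj_point (invariants y) \<in> V \<and> f (proj_point (invariants y)) = G y"
      using hol_elliptic_lift[OF hol V x(1,2)] by blast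
    have "continuous_on N G"
      using N(3) by (intro continuous_at_imp_continuous_on ballI) (rule cdiff_at_imp_continuous)
    then have "open (N \<inter> G -` T)" using N(1) T by (rule continuous_open_preimage)
    then have "openin (top_of_set bring_cone) (bring_cone \<inter> (N \<inter> G -` T))" by (rule openin_open_Int)
    moreover have "x \<in> bring_cone \<inter> (N \<inter> G -` T)" using x N by auto
    moreover have "bring_cone \<inter> (N \<inter> G -` T) \<subseteq> {x \<in> bring_cone. proj_point (invariants x) \<in> {p \<in> V. f p \<in> T}}"
      using N(4) by auto
    ultimately show "\<exists>S. openin (top_of_set bring_cone) S \<and> x \<in> S
        \<and> S \<subseteq> {x \<in> bring_cone. proj_point (invariants x) \<in> {p \<in> V. f p \<in> T}}" by blast
  qed
qed

text \<open>The hard direction. Where Y and Z are nonzero, the chart is led through X/Z and a local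
  section into the cone, near which the pullback of \<open>f\<close> has an extension to C^5; along
  this curve the extension is holomorphic in \<open>z\<close>. At the finitely many other points
  continuity suffices.\<close>

lemma holomorphic_in_chart:
  assumes chart: "cubic_chart W \<psi> i j U" and V: "openin (topo elliptic) V" and hol: "hol elliptic V f"
  shows "(\<lambda>z. f (proj_point (\<psi> z))) holomorphic_on {z \<in> W. proj_point (\<psi> z) \<in> V}"
proof -
  note c = cubic_chartD[OF chart]
  define WV where "WV = {z \<in> W. proj_point (\<psi> z) \<in> V}"
  define g where "g z = f (proj_point (\<psi> z))" for z
  define B where "B = {z \<in> WV. \<psi> z $ 2 = 0 \<or> \<psi> z $ 3 = 0}"
  have WV: "open WV" unfolding WV_def by (rule cubic_chart_open_preimage[OF chart V])
  have hol\<psi>: "(\<lambda>z. \<psi> z $ n) holomorphic_on WV" for n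
    using c(3) by (rule holomorphic_on_subset) (auto simp: WV_def)
  have cont: "continuous_on WV g"
  proof -
    have "open (g -` T \<inter> WV)" if T: "open T" for T
    proof -
      have "g -` T \<inter> WV = {z \<in> W. proj_point (\<psi> z) \<in> {p \<in> V. f p \<in> T}}"
        unfolding g_def WV_def by auto
      then show ?thesis
        using cubic_chart_open_preimage[OF chart openin_elliptic_vimage[OF V hol T]] by simp
    qed
    then show ?thesis unfolding continuous_on_open_vimage[OF WV] by blast
  qed
  have fin: "finite B"
  proof -
    \<comment> \<open>The exceptional points are the one at infinity and those over the roots of
      \<open>disc\<close>; the chart meets each of them at most once.\<close>
    have "(\<lambda>z. proj_point (\<psi> z)) ` B \<subseteq> insert (proj_point (vec3 0 1 0)) ((\<lambda>s. proj_point (vec3 s 0 1)) ` {s. disc s = 0})"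
    proof
      fix p assume "p \<in> (\<lambda>z. proj_point (\<psi> z)) ` B"
      then obtain z where z: "z \<in> W" "\<psi> z $ 2 = 0 \<or> \<psi> z $ 3 = 0" "p = proj_point (\<psi> z)"
        unfolding B_def WV_def by auto
      from c(5)[OF z(1)] show "p \<in> insert (proj_point (vec3 0 1 0)) ((\<lambda>s. proj_point (vec3 s 0 1)) ` {s. disc s = 0})"
        by (cases rule: cubic_cone_cases) (use z in auto)
    qed
    moreover have "finite (insert (proj_point (vec3 0 1 0)) ((\<lambda>s. proj_point (vec3 s 0 1)) ` {s. disc s = 0}))"
      using finite_disc_roots by simp
    moreover have "inj_on (\<lambda>z. proj_point (\<psi> z)) B"
      using cubic_chart_inj[OF chart] by (rule inj_on_subset) (auto simp: B_def WV_def)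
    ultimately show ?thesis using finite_imageD finite_subset by metis
  qed
  have "g field_differentiable at z1" if z1: "z1 \<in> WV - B" for z1
  proof -
    define s where "s z = \<psi> z $ 1 / \<psi> z $ 3" for z
    define y where "y z = \<psi> z $ 2 / \<psi> z $ 3" for z
    define W1 where "W1 = WV \<inter> (\<lambda>z. \<psi> z $ 2 * \<psi> z $ 3) -` (- {0})"
    have "z1 \<in> WV" "\<psi> z1 $ 2 \<noteq> 0" "\<psi> z1 $ 3 \<noteq> 0" using z1 unfolding B_def by auto
    then have z1W1: "z1 \<in> W1" unfolding W1_def by simp
    have W1: "open W1" unfolding W1_def
      by (intro continuous_open_preimage holomorphic_on_imp_continuous_on WV holomorphic_intros hol\<psi>) auto
    have W1D: "z \<in> W" "\<psi> z $ 2 \<noteq> 0" "\<psi> z $ 3 \<noteq> 0" "proj_point (\<psi> z) \<in> V" "\<psi> z \<in> cubic_cone" if "z \<in> W1" for z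
      using that c(5) unfolding W1_def WV_def by auto
    have affine: "(y z)^2 = disc (s z) \<and> proj_point (\<psi> z) = proj_point (vec3 (s z) (y z) 1)" if "z \<in> W1" for z
      using W1D(5)[OF that] by (cases rule: cubic_cone_cases) (use W1D[OF that] in \<open>auto simp: s_def y_def\<close>)
    have hol_s: "s holomorphic_on W1" and hol_y: "y holomorphic_on W1"
    proof -
      have "(\<lambda>z. \<psi> z $ n) holomorphic_on W1" for n
        using hol\<psi> by (rule holomorphic_on_subset) (auto simp: W1_def)
      then show "s holomorphic_on W1" "y holomorphic_on W1"
        unfolding s_def y_def using W1D(3) by (auto intro!: holomorphic_intros)
    qed
    have "y z1 \<noteq> 0" unfolding y_def using W1D(2,3)[OF z1W1] by simp
    then obtain N \<sigma> where \<sigma>: "open N" "s z1 \<in> N" "\<And>i. (\<lambda>s. \<sigma> s $ i) holomorphic_on N"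
      "\<And>s. s \<in> N \<Longrightarrow> \<sigma> s \<in> bring_cone" "\<And>s. s \<in> N \<Longrightarrow> \<sigma> s $ k = 1"
      "\<And>s. s \<in> N \<Longrightarrow> root_prod (\<sigma> s) = s" "vandermonde (\<sigma> (s z1)) = y z1"
      using local_section[of "y z1" "s z1"] affine[OF z1W1] by blast
    define W2 where "W2 = W1 \<inter> s -` N"
    have W2: "open W2" unfolding W2_def
      using holomorphic_on_imp_continuous_on[OF hol_s] W1 \<sigma>(1) by (rule continuous_open_preimage)
    have hol_\<gamma>: "(\<lambda>z. \<sigma> (s z) $ n) holomorphic_on W2" for n
    proof -
      have "(\<lambda>s. \<sigma> s $ n) \<circ> s holomorphic_on W2"
        by (rule holomorphic_on_compose_gen[OF holomorphic_on_subset[OF hol_s] \<sigma>(3)]) (auto simp: W2_def)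
      then show ?thesis by (simp add: o_def)
    qed
    have cont_\<gamma>: "continuous_on W2 (\<lambda>z. \<sigma> (s z))"
      using continuous_on_vec_lambda[of W2 "\<lambda>n z. \<sigma> (s z) $ n"] holomorphic_on_imp_continuous_on[OF hol_\<gamma>]
      by (simp add: vec_lambda_eta)
    have inv1: "invariants (\<sigma> (s z1)) = vec3 (s z1) (y z1) 1"
      using \<sigma>(2,5,6,7) by (simp add: vec3_eq_iff)
    then have "proj_point (invariants (\<sigma> (s z1))) \<in> V" using affine[OF z1W1] W1D(4)[OF z1W1] by simp
    then obtain M G where M: "open M" "\<sigma> (s z1) \<in> M" "\<And>y. y \<in> M \<Longrightarrow> cdiff_at G y"
      "\<And>y. y \<in> M \<Longrightarrow> y \<in> bring_cone \<Longrightarrow> proj_point (invariants y) \<in> V \<and> f (proj_point (invariants y)) = G y"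
      using hol_elliptic_lift[OF hol V \<sigma>(4)[OF \<sigma>(2)]] by blast
    define W3 where "W3 = W2 \<inter> (\<lambda>z. \<sigma> (s z)) -` M"
    have W3: "open W3" unfolding W3_def using cont_\<gamma> W2 M(1) by (rule continuous_open_preimage)
    \<comment> \<open>The section reproduces Y/Z only up to sign. Where the sum of the two square
      roots is nonzero, as it is at \<open>z1\<close>, the wrong sign is excluded.\<close>
    define W4 where "W4 = W3 \<inter> (\<lambda>z. vandermonde (\<sigma> (s z)) + y z) -` (- {0})"
    have "(\<lambda>z. vandermonde (\<sigma> (s z)) + y z) holomorphic_on W3"
    proof -
      have "(\<lambda>z. \<sigma> (s z) $ n) holomorphic_on W3" for n
        using hol_\<gamma> by (rule holomorphic_on_subset) (auto simp: W3_def)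
      moreover have "y holomorphic_on W3"
        using hol_y by (rule holomorphic_on_subset) (auto simp: W3_def W2_def)
      ultimately show ?thesis unfolding vandermonde_def by (intro holomorphic_intros)
    qed
    then have W4: "open W4" unfolding W4_def
      by (intro continuous_open_preimage holomorphic_on_imp_continuous_on W3) auto
    have z1W4: "z1 \<in> W4"
      unfolding W4_def W3_def W2_def using z1W1 \<sigma>(2,7) M(2) \<open>y z1 \<noteq> 0\<close> by simp
    have eq: "G (\<sigma> (s z)) = g z" if z: "z \<in> W4" for z
    proof -
      have zz: "z \<in> W1" "s z \<in> N" "\<sigma> (s z) \<in> M" "vandermonde (\<sigma> (s z)) + y z \<noteq> 0"
        using z unfolding W4_def W3_def W2_def by auto
      have "(vandermonde (\<sigma> (s z)))^2 = (y z)^2"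
        using vandermonde_square[OF \<sigma>(4)[OF zz(2)]] \<sigma>(5,6)[OF zz(2)] affine[OF zz(1)] by (simp add: disc_def)
      then have "vandermonde (\<sigma> (s z)) = y z" using zz(4) by (auto simp: power2_eq_iff)
      then have "invariants (\<sigma> (s z)) = vec3 (s z) (y z) 1"
        using \<sigma>(5,6)[OF zz(2)] by (simp add: vec3_eq_iff)
      then have "proj_point (invariants (\<sigma> (s z))) = proj_point (\<psi> z)" using affine[OF zz(1)] by simp
      then show ?thesis using M(4)[OF zz(3) \<sigma>(4)[OF zz(2)]] unfolding g_def by simp
    qed
    have "(\<lambda>z. G (\<sigma> (s z))) field_differentiable at z1"
    proof (rule cdiff_at_curve)
      show "cdiff_at G (\<sigma> (s z1))" using M(2,3) by blast
      show "(\<lambda>z. \<sigma> (s z) $ n) field_differentiable at z1" for n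
        using hol_\<gamma> W2 z1W4 unfolding W4_def W3_def
        by (intro holomorphic_on_imp_differentiable_at[of _ W2]) auto
    qed
    then obtain D where "((\<lambda>z. G (\<sigma> (s z))) has_field_derivative D) (at z1)"
      unfolding field_differentiable_def by blast
    then have "(g has_field_derivative D) (at z1)"
      using W4 z1W4 eq by (rule has_field_derivative_transform_within_open)
    then show ?thesis unfolding field_differentiable_def by blast
  qed
  then have "g holomorphic_on WV - B"
    by (auto simp: holomorphic_on_def intro: field_differentiable_at_within)
  then show ?thesis
    using no_isolated_singularity[OF cont _ WV fin] unfolding g_def WV_def by simp
qed

end

section \<open>The quotient curve is a compact Riemann surface\<close>

definition ratio :: "3 \<Rightarrow> 3 \<Rightarrow> (complex^3) set \<Rightarrow> complex"
  where "ratio i j p = (let v = SOME v. v \<noteq> 0 \<and> proj_point v = p in v $ i / v $ j)"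

lemma ratio_proj_point:
  assumes "v \<noteq> 0" shows "ratio i j (proj_point v) = v $ i / v $ j"
proof -
  define w where "w = (SOME w. w \<noteq> 0 \<and> proj_point w = proj_point v)"
  have "w \<noteq> 0 \<and> proj_point w = proj_point v"
    unfolding w_def by (rule someI[of _ v]) (use assms in simp)
  then show ?thesis
    using ratio_of_proj_point[of w v i j] unfolding ratio_def w_def Let_def by simp
qed

context labelling
begin

text \<open>Over an open set the quotient map restricts to a quotient map, so continuity of maps out
  of it is tested on the cone.\<close>

lemma continuous_map_from_elliptic:
  assumes V: "openin (topo elliptic) V"
    and cont: "continuous_on {x \<in> bring_cone. proj_point (invariants x) \<in> V} (\<lambda>x. g (proj_point (invariants x)))"
  shows "continuous_map (subtopology (topo elliptic) V) euclidean g"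
proof -
  let ?P = "{x \<in> bring_cone. proj_point (invariants x) \<in> V}"
  have "quotient_map (subtopology (top_of_set bring_cone) ?P) (subtopology (topo elliptic) V) (\<lambda>x. proj_point (invariants x))"
    by (rule quotient_map_restriction[OF quotient_map_elliptic]) (use V in auto)
  moreover have "subtopology (top_of_set bring_cone) ?P = top_of_set ?P"
    by (simp add: subtopology_subtopology Int_absorb1 subset_iff)
  ultimately have "quotient_map (top_of_set ?P) (subtopology (topo elliptic) V) (\<lambda>x. proj_point (invariants x))"
    by simp
  then show ?thesis
    by (rule continuous_compose_quotient_map) (use cont in \<open>simp add: o_def\<close>)
qed

lemma openin_elliptic_chart_domain:
  assumes U: "open U" "\<And>v m. v \<in> U \<Longrightarrow> m \<noteq> 0 \<Longrightarrow> m *s v \<in> U"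
  shows "openin (topo elliptic) (proj_point ` (U \<inter> cubic_cone))"
  unfolding openin_elliptic
proof
  have "{x \<in> bring_cone. proj_point (invariants x) \<in> proj_point ` (U \<inter> cubic_cone)} = bring_cone \<inter> invariants -` U"
  proof (intro Set.set_eqI iffI)
    fix x assume x: "x \<in> {x \<in> bring_cone. proj_point (invariants x) \<in> proj_point ` (U \<inter> cubic_cone)}"
    then obtain v where v: "v \<in> U" "v \<in> cubic_cone" "proj_point v = proj_point (invariants x)" by auto
    then obtain m where "m \<noteq> 0" "invariants x = m *s v"
      using proj_point_eq_iff[of v "invariants x"] cubic_cone_nonzero by auto
    then have "invariants x \<in> U" using U(2) v(1) by simp
    then show "x \<in> bring_cone \<inter> invariants -` U" using x by simp
  qed (use invariants_cubic in auto)
  moreover have "open (invariants -` U)" using U(1) continuous_on_invariants[of UNIV] by (rule open_vimage)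
  ultimately show "openin (top_of_set bring_cone)
      {x \<in> bring_cone. proj_point (invariants x) \<in> proj_point ` (U \<inter> cubic_cone)}"
    using openin_open_Int[of "invariants -` U" bring_cone] by simp
qed auto

lemma elliptic_chart_isomorphic:
  assumes chart: "cubic_chart W \<psi> i j U"
  shows "isomorphic (subspace_of elliptic (proj_point ` (U \<inter> cubic_cone))) (subspace_of complex_plane W)"
proof -
  note c = cubic_chartD[OF chart]
  define P where "P = proj_point ` (U \<inter> cubic_cone)"
  have P: "openin (topo elliptic) P"
    unfolding P_def using c(2,8) by (rule openin_elliptic_chart_domain)
  have ratio\<psi>: "ratio i j (proj_point (\<psi> z)) = z" if "z \<in> W" for z
    using ratio_proj_point[OF cubic_cone_nonzero[OF c(5)[OF that]]] c(6)[OF that] by simp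
  have \<psi>P: "proj_point (\<psi> z) \<in> P" if "z \<in> W" for z unfolding P_def using c(4,5)[OF that] by auto
  have P_cases: "ratio i j p \<in> W \<and> proj_point (\<psi> (ratio i j p)) = p" if p: "p \<in> P" for p
  proof -
    obtain v where v: "v \<in> U" "v \<in> cubic_cone" "p = proj_point v" using p unfolding P_def by blast
    then show ?thesis
      using c(9,10)[OF v(1,2)] ratio_proj_point[OF cubic_cone_nonzero[OF v(2)], of i j] by simp
  qed
  have pre: "{z \<in> W. proj_point (\<psi> z) \<in> P} = W" using \<psi>P by auto
  \<comment> \<open>In the chart the coordinate reads as the identity, so it is holomorphic on the
    quotient and therefore continuous.\<close>
  have "hol elliptic P (ratio i j)"
    using chart P by (rule hol_elliptic_of_chart)
      (auto simp: P_def[symmetric] pre ratio\<psi> intro: holomorphic_transform[OF holomorphic_on_ident])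
  then have vimage: "openin (topo elliptic) {p \<in> P. ratio i j p \<in> T}" if "open T" for T :: "complex set"
    using openin_elliptic_vimage[OF P _ that] by blast
  have pts: "points elliptic \<inter> P = P" using openin_subset[OF P] by blast
  have planeW: "topo (subspace_of complex_plane W) = top_of_set W" by (simp add: complex_plane_def)
  have "homeomorphic_maps (subtopology (topo elliptic) P) (top_of_set W) (ratio i j) (\<lambda>z. proj_point (\<psi> z))"
    unfolding homeomorphic_maps_def
  proof (intro conjI ballI)
    show "continuous_map (subtopology (topo elliptic) P) (top_of_set W) (ratio i j)"
      unfolding continuous_map_in_subtopology
    proof
      show "continuous_map (subtopology (topo elliptic) P) euclidean (ratio i j)"
        unfolding continuous_map_def
      proof (intro conjI allI impI)
        fix T :: "complex set" assume "openin euclidean T"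
        then have "openin (topo elliptic) {p \<in> P. ratio i j p \<in> T}" using vimage by simp
        then show "openin (subtopology (topo elliptic) P)
            {x \<in> topspace (subtopology (topo elliptic) P). ratio i j x \<in> T}"
          unfolding openin_subtopology
          by (intro exI[of _ "{p \<in> P. ratio i j p \<in> T}"]) (auto simp: pts)
      qed auto
      show "ratio i j \<in> topspace (subtopology (topo elliptic) P) \<rightarrow> W" using P_cases by (auto simp: pts)
    qed
    have "continuous_map (top_of_set W) (topo elliptic) (\<lambda>z. proj_point (\<psi> z))"
      using cubic_chart_continuous[OF chart] c(5) by (rule continuous_map_into_elliptic)
    then show "continuous_map (top_of_set W) (subtopology (topo elliptic) P) (\<lambda>z. proj_point (\<psi> z))"
      using \<psi>P by (auto simp: continuous_map_in_subtopology)
  qed (use P_cases ratio\<psi> pts in auto)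
  then have homeo: "homeomorphic_map (topo (subspace_of elliptic P)) (topo (subspace_of complex_plane W)) (ratio i j)"
    unfolding planeW unfolding topo_subspace_of homeomorphic_map_maps by blast
  have holo: "hol (subspace_of complex_plane W) V f \<longleftrightarrow>
      hol (subspace_of elliptic P) {x \<in> points (subspace_of elliptic P). ratio i j x \<in> V} (f \<circ> ratio i j)"
    if V: "openin (topo (subspace_of complex_plane W)) V" for V f
  proof -
    have VW: "V \<subseteq> W" "open V"
      using V c(1) unfolding planeW by (auto simp: openin_open_eq)
    define Q where "Q = {p \<in> P. ratio i j p \<in> V}"
    have Q: "openin (topo elliptic) Q" unfolding Q_def using VW(2) by (rule vimage)
    have preQ: "{z \<in> W. proj_point (\<psi> z) \<in> Q} = V"
      unfolding Q_def using \<psi>P ratio\<psi> VW(1) by auto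
    have "hol (subspace_of complex_plane W) V f \<longleftrightarrow> hol complex_plane V f"
      using is_sheafD[OF is_sheaf_complex_plane, of V f] VW(2) by (simp add: complex_plane_def)
    also have "\<dots> \<longleftrightarrow> f holomorphic_on V" by (simp add: complex_plane_def)
    also have "\<dots> \<longleftrightarrow> (\<lambda>z. (f \<circ> ratio i j) (proj_point (\<psi> z))) holomorphic_on V"
      by (rule holomorphic_cong) (use ratio\<psi> VW(1) in auto)
    also have "\<dots> \<longleftrightarrow> hol elliptic Q (f \<circ> ratio i j)"
    proof
      assume "(\<lambda>z. (f \<circ> ratio i j) (proj_point (\<psi> z))) holomorphic_on V"
      then show "hol elliptic Q (f \<circ> ratio i j)"
        by (intro hol_elliptic_of_chart[OF chart Q]) (unfold preQ, auto simp: Q_def P_def)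
    next
      assume "hol elliptic Q (f \<circ> ratio i j)"
      from holomorphic_in_chart[OF chart Q this]
      show "(\<lambda>z. (f \<circ> ratio i j) (proj_point (\<psi> z))) holomorphic_on V" unfolding preQ .
    qed
    also have "\<dots> \<longleftrightarrow> hol (subspace_of elliptic P) Q (f \<circ> ratio i j)"
      using is_sheafD[OF is_sheaf_elliptic Q] by simp
    also have "Q = {x \<in> points (subspace_of elliptic P). ratio i j x \<in> V}"
      unfolding Q_def by (simp add: pts)
    finally show ?thesis .
  qed
  show ?thesis unfolding isomorphic_def P_def[symmetric] using homeo holo by blast
qed

text \<open>The points at which \<open>X/Z\<close> takes a given value form a finite set, and only one point lies
  over infinity. So a clopen set avoiding this point would have an open and compact image
  under \<open>X/Z\<close>.\<close>

lemma clopen_elliptic_without_infinity: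
  assumes A: "openin (topo elliptic) A" "closedin (topo elliptic) A" and O: "proj_point (vec3 0 1 0) \<notin> A"
  shows "A = {}"
proof -
  have v3: "v $ 3 \<noteq> 0" if "v \<in> cubic_cone" "proj_point v \<in> A" for v
    using that(1) by (cases rule: cubic_cone_cases) (use that(2) O in auto)
  have A_sub: "A \<subseteq> proj_point ` cubic_cone" using A(1) unfolding openin_elliptic by blast
  define S where "S = ratio 1 3 ` A"
  have "compact S"
  proof -
    have "compactin (topo elliptic) A" using A(2) compact_space_elliptic by (rule closedin_compact_space[rotated])
    then have "compactin (subtopology (topo elliptic) A) A" by (simp add: compactin_subtopology)
    moreover have "continuous_map (subtopology (topo elliptic) A) euclidean (ratio 1 3)"
    proof (rule continuous_map_from_elliptic[OF A(1)])
      have nz: "invariants x $ 3 \<noteq> 0" if "x \<in> bring_cone" "proj_point (invariants x) \<in> A" for x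
        using v3 invariants_cubic that by blast
      have "continuous_on {x \<in> bring_cone. proj_point (invariants x) \<in> A} (\<lambda>x. invariants x $ 1 / invariants x $ 3)"
        using nz by (intro continuous_intros continuous_on_invariants) auto
      then show "continuous_on {x \<in> bring_cone. proj_point (invariants x) \<in> A} (\<lambda>x. ratio 1 3 (proj_point (invariants x)))"
        by (rule continuous_on_eq) (simp add: ratio_proj_point invariants_neq_0)
    qed
    ultimately have "compactin euclidean (ratio 1 3 ` A)" by (rule image_compactin)
    then show ?thesis unfolding S_def by simp
  qed
  moreover have "open S"
    unfolding open_subopen[of S]
  proof
    fix s assume "s \<in> S"
    then obtain v where v: "v \<in> cubic_cone" "proj_point v \<in> A" "s = ratio 1 3 (proj_point v)"
      unfolding S_def using A_sub by blast
    obtain W \<psi> i j U where chart: "cubic_chart W \<psi> i j U" "v \<in> U"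
      and j: "v $ 3 \<noteq> 0 \<Longrightarrow> j = 3 \<and> (\<forall>z\<in>W. \<psi> z $ 3 = 1)" using ex_cubic_chart[OF v(1)] by blast
    have \<psi>3: "\<psi> z $ 3 = 1" if "z \<in> W" for z using j v3[OF v(1,2)] that by blast
    note c = cubic_chartD[OF chart(1)]
    define WA where "WA = {z \<in> W. proj_point (\<psi> z) \<in> A}"
    have WA: "open WA" unfolding WA_def using cubic_chart_open_preimage[OF chart(1) A(1)] .
    have "v $ i / v $ j \<in> WA" unfolding WA_def using c(9,10)[OF chart(2) v(1)] v(2) by simp
    then obtain r where r: "r > 0" "ball (v $ i / v $ j) r \<subseteq> WA"
      using WA openE by blast
    define B where "B = ball (v $ i / v $ j) r"
    have BW: "B \<subseteq> W" "B \<subseteq> WA" using r(2) unfolding B_def WA_def by auto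
    have inB: "v $ i / v $ j \<in> B" using r(1) unfolding B_def by simp
    have hol: "(\<lambda>z. \<psi> z $ 1) holomorphic_on B" using c(3) BW(1) by (rule holomorphic_on_subset)
    have "\<not> (\<lambda>z. \<psi> z $ 1) constant_on B"
    proof
      assume "(\<lambda>z. \<psi> z $ 1) constant_on B"
      then obtain e where e: "\<And>z. z \<in> B \<Longrightarrow> \<psi> z $ 1 = e" unfolding constant_on_def by blast
      \<comment> \<open>Only the two square roots of the discriminant lie over the value
        \<open>e\<close>, whereas the chart is injective on the infinite set
        \<open>B\<close>.\<close>
      have "(\<lambda>z. proj_point (\<psi> z)) ` B \<subseteq> {proj_point (vec3 e (csqrt (disc e)) 1), proj_point (vec3 e (- csqrt (disc e)) 1)}"
      proof
        fix p assume "p \<in> (\<lambda>z. proj_point (\<psi> z)) ` B"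
        then obtain z where z: "z \<in> B" "p = proj_point (\<psi> z)" by blast
        then have zW: "z \<in> W" using BW by blast
        from c(5)[OF zW] show "p \<in> {proj_point (vec3 e (csqrt (disc e)) 1), proj_point (vec3 e (- csqrt (disc e)) 1)}"
        proof (cases rule: cubic_cone_cases)
          case (affine s y)
          then have "s = e" using e[OF z(1)] \<psi>3[OF zW] by simp
          moreover have "y^2 = (csqrt (disc s))^2" using affine(2) by simp
          then have "y = csqrt (disc s) \<or> y = - csqrt (disc s)" unfolding power2_eq_iff .
          ultimately show ?thesis unfolding z(2) affine(3) by blast
        next
          case infinity then show ?thesis using \<psi>3[OF zW] by simp
        qed
      qed
      then have "finite ((\<lambda>z. proj_point (\<psi> z)) ` B)" by (rule finite_subset) simp
      moreover have "inj_on (\<lambda>z. proj_point (\<psi> z)) B"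
        using cubic_chart_inj[OF chart(1)] BW(1) by (rule inj_on_subset)
      ultimately have "finite B" by (rule finite_imageD)
      then show False using r(1) uncountable_ball countable_finite unfolding B_def by blast
    qed
    then have "open ((\<lambda>z. \<psi> z $ 1) ` B)"
      using open_mapping_thm[OF hol _ _ _ subset_refl] unfolding B_def by simp
    moreover have ratio: "ratio 1 3 (proj_point (\<psi> z)) = \<psi> z $ 1" if "z \<in> W" for z
      using ratio_proj_point[OF cubic_cone_nonzero[OF c(5)[OF that]]] \<psi>3[OF that] by simp
    then have "s = \<psi> (v $ i / v $ j) $ 1"
      using v(3) c(9,10)[OF chart(2) v(1)] by simp
    then have "s \<in> (\<lambda>z. \<psi> z $ 1) ` B" using inB by blast
    moreover have "(\<lambda>z. \<psi> z $ 1) ` B \<subseteq> S"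
    proof
      fix t assume "t \<in> (\<lambda>z. \<psi> z $ 1) ` B"
      then obtain z where z: "z \<in> B" "t = \<psi> z $ 1" by blast
      then have "z \<in> WA" using BW by blast
      then show "t \<in> S" unfolding S_def WA_def using z(2) ratio[of z] by force
    qed
    ultimately show "\<exists>T. open T \<and> s \<in> T \<and> T \<subseteq> S" by blast
  qed
  ultimately have "S = {}"
    using clopen[of S] compact_imp_closed not_compact_UNIV by metis
  then show ?thesis unfolding S_def by simp
qed

lemma connected_space_elliptic: "connected_space (topo elliptic)"
  unfolding connected_space_clopen_in
proof (intro allI impI)
  fix A assume A: "openin (topo elliptic) A \<and> closedin (topo elliptic) A"
  show "A = {} \<or> A = points elliptic"
  proof (cases "proj_point (vec3 0 1 0) \<in> A")
    case True
    have "points elliptic - A = {}"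
      using A True by (intro clopen_elliptic_without_infinity) (auto intro: openin_diff closedin_diff)
    then show ?thesis using A openin_subset by blast
  next
    case False
    then show ?thesis using A clopen_elliptic_without_infinity by blast
  qed
qed

lemma compact_riemann_surface_elliptic: "compact_riemann_surface elliptic"
  unfolding compact_riemann_surface_def
proof (intro conjI ballI)
  show "points elliptic \<noteq> {}" using cubic_cone_infinity unfolding points_elliptic by blast
  fix p assume "p \<in> points elliptic"
  then obtain v where v: "v \<in> cubic_cone" "p = proj_point v" unfolding points_elliptic by blast
  obtain W \<psi> i j U where chart: "cubic_chart W \<psi> i j U" "v \<in> U"
    by (rule ex_cubic_chart[OF v(1)]) (rule that)
  have "openin (topo elliptic) (proj_point ` (U \<inter> cubic_cone))"
    using cubic_chartD(2,8)[OF chart(1)] by (rule openin_elliptic_chart_domain)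
  then show "\<exists>U W. openin (topo elliptic) U \<and> p \<in> U \<and> open W
      \<and> isomorphic (subspace_of elliptic U) (subspace_of complex_plane W)"
    using elliptic_chart_isomorphic[OF chart(1)] v chart cubic_chartD(1)[OF chart(1)] by blast
qed (rule is_sheaf_elliptic compact_space_elliptic connected_space_elliptic Hausdorff_space_elliptic)+

end

section \<open>The affine equation\<close>

abbreviation weierstrass :: "complex \<Rightarrow> complex \<Rightarrow> bool"
  where "weierstrass \<equiv> \<lambda>x y. y^2 + x * y + y = x^3 + 549 * x - 2202"

text \<open>Completing the square turns the given equation into (2 y + x + 1)^2 = 4 x^3 + x^2 + 2198
  x - 8807, and x = 64 X - 17 makes the right-hand side equal to 64^2 times \<open>disc\<close> at
  X.\<close>

definition to_cubic :: "complex^2 \<Rightarrow> complex^3"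
  where "to_cubic v = vec3 ((v $ 1 + 17) / 64) ((2 * v $ 2 + v $ 1 + 1) / 64) 1"

definition of_cubic :: "(complex^3) set \<Rightarrow> complex^2"
  where "of_cubic p = vector [64 * ratio 1 3 p - 17, 32 * ratio 2 3 p - 32 * ratio 1 3 p + 8]"

lemma of_cubic_nth [simp]: "of_cubic p $ 1 = 64 * ratio 1 3 p - 17"
    "of_cubic p $ 2 = 32 * ratio 2 3 p - 32 * ratio 1 3 p + 8"
  by (simp_all add: of_cubic_def)

lemma vec2_eq_iff: "v = w \<longleftrightarrow> v $ 1 = w $ 1 \<and> v $ 2 = w $ 2" for v w :: "complex^2"
  by (simp add: vec_eq_iff forall_2)

lemma weierstrass_iff: "weierstrass (v $ 1) (v $ 2) \<longleftrightarrow> to_cubic v \<in> cubic_cone"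
proof -
  let ?x = "v $ 1" and ?y = "v $ 2"
  \<comment> \<open>The factor is 64^2 / 4: the square of 64 from the substitution, the 4 from
    completing the square.\<close>
  have "1024 * (((2 * ?y + ?x + 1) / 64)^2 - disc ((?x + 17) / 64))
      = ?y^2 + ?x * ?y + ?y - (?x^3 + 549 * ?x - 2202)"
    unfolding disc_def by (simp add: field_simps power2_eq_square power3_eq_cube)
  then show ?thesis unfolding to_cubic_def cubic_cone_affine
    by (metis eq_iff_diff_eq_0 mult_eq_0_iff zero_neq_numeral)
qed

lemma to_cubic_neq_0: "to_cubic v \<noteq> 0"
  by (simp add: to_cubic_def vec3_eq_iff)

lemma of_cubic_to_cubic: "of_cubic (proj_point (to_cubic v)) = v"
  unfolding vec2_eq_iff of_cubic_nth ratio_proj_point[OF to_cubic_neq_0]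
  by (simp add: to_cubic_def field_simps)

lemma to_cubic_of_cubic:
  assumes "v $ 3 \<noteq> 0" shows "proj_point (to_cubic (of_cubic (proj_point v))) = proj_point v"
proof -
  have "v \<noteq> 0" using assms by auto
  then have "v = v $ 3 *s to_cubic (of_cubic (proj_point v))"
    using assms by (simp add: vec3_eq_iff to_cubic_def ratio_proj_point field_simps)
  then show ?thesis using assms proj_point_scale by metis
qed

lemma continuous_on_to_cubic: "continuous_on S to_cubic"
proof -
  have "continuous_on S (\<lambda>v. to_cubic v $ i)" for i
    using exhaust_3[of i] unfolding to_cubic_def
    by (elim disjE) (simp_all add: continuous_intros)
  then show ?thesis
    using continuous_on_vec_lambda[of S "\<lambda>i x. to_cubic x $ i"] by (simp add: vec_lambda_eta)
qed

lemma cdiff_at_to_cubic: "cdiff_at (\<lambda>v. to_cubic v $ i) v"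
  using exhaust_3[of i] unfolding to_cubic_def
  by (elim disjE) (simp_all add: cdiff_at_divide)

context labelling
begin

lemma affine_points:
  "points elliptic - {proj_point (vec3 0 1 0)} = proj_point ` ({v. v $ 3 \<noteq> 0} \<inter> cubic_cone)"
proof (intro Set.set_eqI iffI)
  fix p assume "p \<in> points elliptic - {proj_point (vec3 0 1 0)}"
  then obtain v where v: "v \<in> cubic_cone" "p = proj_point v" "p \<noteq> proj_point (vec3 0 1 0)"
    unfolding points_elliptic by blast
  from v(1) show "p \<in> proj_point ` ({v. v $ 3 \<noteq> 0} \<inter> cubic_cone)"
    by (cases rule: cubic_cone_cases) (use v in auto)
next
  fix p assume "p \<in> proj_point ` ({v. v $ 3 \<noteq> 0} \<inter> cubic_cone)"
  then obtain v where v: "v \<in> cubic_cone" "p = proj_point v" "v $ 3 \<noteq> 0" by blast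
  have "v \<noteq> 0" using v(3) by auto
  then have "p \<noteq> proj_point (vec3 0 1 0)"
    using proj_point_eq_iff[of v "vec3 0 1 0"] v by (auto simp: vec3_eq_iff)
  then show "p \<in> points elliptic - {proj_point (vec3 0 1 0)}" using v by (auto simp: points_elliptic)
qed

text \<open>Functions on the affine curve are local restrictions from C^2. Towards the quotient,
  such an extension is composed with a chart; towards the curve, the chart expression is composed
  with X/Z or Y/Z, which are affine linear on C^2 and so provide an extension.\<close>

lemma elliptic_affine_isomorphic:
  "isomorphic (subspace_of elliptic (points elliptic - {proj_point (vec3 0 1 0)}))
    (subspace_of (affine_plane_curve weierstrass) (points (affine_plane_curve weierstrass) - {}))"
proof -
  define C where "C = {v :: complex^2. weierstrass (v $ 1) (v $ 2)}"
  define P where "P = points elliptic - {proj_point (vec3 0 1 0)}"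
  have C: "topo (subspace_of (affine_plane_curve weierstrass) (points (affine_plane_curve weierstrass) - {})) = top_of_set C"
    by (simp add: affine_plane_curve_def C_def subtopology_subtopology)
  have P: "openin (topo elliptic) P"
    unfolding P_def affine_points
    by (rule openin_elliptic_chart_domain) (auto intro!: open_Collect_neq continuous_intros)
  have C_cubic: "to_cubic v \<in> cubic_cone" if "v \<in> C" for v
    using that weierstrass_iff unfolding C_def by blast
  have to_P: "proj_point (to_cubic v) \<in> P" if "v \<in> C" for v
    unfolding P_def affine_points using C_cubic[OF that] by (auto simp: to_cubic_def)
  have P_cases: "of_cubic p \<in> C \<and> proj_point (to_cubic (of_cubic p)) = p" if p: "p \<in> P" for p
  proof -
    obtain v where v: "v \<in> cubic_cone" "p = proj_point v" "v $ 3 \<noteq> 0"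
      using p unfolding P_def affine_points by blast
    have e: "proj_point (to_cubic (of_cubic p)) = proj_point v" using to_cubic_of_cubic v by simp
    then obtain m where "m \<noteq> 0" "to_cubic (of_cubic p) = m *s v"
      using proj_point_eq_iff[of v] cubic_cone_nonzero[OF v(1)] by metis
    then have "to_cubic (of_cubic p) \<in> cubic_cone" using cubic_cone_scale[OF v(1)] by simp
    then show ?thesis using e v(2) weierstrass_iff unfolding C_def by blast
  qed
  have pts: "points elliptic \<inter> P = P" unfolding P_def by blast
  have cont_of: "continuous_map (subtopology (topo elliptic) P) euclidean of_cubic"
  proof (rule continuous_map_from_elliptic[OF P])
    let ?Q = "{x \<in> bring_cone. proj_point (invariants x) \<in> P}"
    have nz: "invariants x $ 3 \<noteq> 0" if "x \<in> ?Q" for x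
    proof -
      obtain v where v: "v $ 3 \<noteq> 0" "proj_point v = proj_point (invariants x)"
        using \<open>x \<in> ?Q\<close> unfolding P_def affine_points by auto
      then have "v \<noteq> 0" by auto
      then obtain m where m: "m \<noteq> 0" "invariants x = m *s v"
        using proj_point_eq_iff[of v "invariants x"] v(2) by auto
      show ?thesis unfolding m(2) using m(1) v(1) by simp
    qed
    have r: "continuous_on ?Q (\<lambda>x. ratio i 3 (proj_point (invariants x)))" for i
    proof -
      have "continuous_on ?Q (\<lambda>x. invariants x $ i / invariants x $ 3)"
        using nz by (intro continuous_intros continuous_on_invariants) auto
      then show ?thesis
        by (rule continuous_on_eq) (simp add: ratio_proj_point invariants_neq_0)
    qed
    have "continuous_on ?Q (\<lambda>x. of_cubic (proj_point (invariants x)) $ i)" for i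
      using exhaust_2[of i] by (elim disjE) (simp_all add: continuous_intros r)
    then show "continuous_on ?Q (\<lambda>x. of_cubic (proj_point (invariants x)))"
      using continuous_on_vec_lambda[of ?Q "\<lambda>i x. of_cubic (proj_point (invariants x)) $ i"]
      by (simp add: vec_lambda_eta)
  qed
  have "homeomorphic_maps (subtopology (topo elliptic) P) (top_of_set C) of_cubic (\<lambda>v. proj_point (to_cubic v))"
    unfolding homeomorphic_maps_def
  proof (intro conjI ballI)
    show "continuous_map (subtopology (topo elliptic) P) (top_of_set C) of_cubic"
      using cont_of P_cases by (auto simp: continuous_map_in_subtopology)
    have "continuous_map (top_of_set C) (topo elliptic) (\<lambda>v. proj_point (to_cubic v))"
      using continuous_on_to_cubic C_cubic by (rule continuous_map_into_elliptic)
    then show "continuous_map (top_of_set C) (subtopology (topo elliptic) P) (\<lambda>v. proj_point (to_cubic v))"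
      using to_P by (auto simp: continuous_map_in_subtopology)
  qed (use P_cases of_cubic_to_cubic pts in auto)
  then have homeo: "homeomorphic_map (topo (subspace_of elliptic P))
      (topo (subspace_of (affine_plane_curve weierstrass) (points (affine_plane_curve weierstrass) - {}))) of_cubic"
    unfolding C unfolding topo_subspace_of homeomorphic_map_maps by blast
  have holo: "hol (subspace_of (affine_plane_curve weierstrass) (points (affine_plane_curve weierstrass) - {})) V f \<longleftrightarrow>
      hol (subspace_of elliptic P) {x \<in> points (subspace_of elliptic P). of_cubic x \<in> V} (f \<circ> of_cubic)"
    if V: "openin (topo (subspace_of (affine_plane_curve weierstrass) (points (affine_plane_curve weierstrass) - {}))) V" for V f
  proof -
    have VC: "V \<subseteq> C" using V openin_subset unfolding C by fastforce
    define Q where "Q = {p \<in> P. of_cubic p \<in> V}"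
    have Q: "openin (topo elliptic) Q"
    proof -
      obtain T where T: "open T" "V = C \<inter> T" using V unfolding C openin_open by blast
      have "openin (subtopology (topo elliptic) P) {p \<in> topspace (subtopology (topo elliptic) P). of_cubic p \<in> T}"
        using openin_continuous_map_preimage[OF cont_of] T(1) by simp
      moreover have "{p \<in> topspace (subtopology (topo elliptic) P). of_cubic p \<in> T} = Q"
        unfolding Q_def T(2) using P_cases by (auto simp: pts)
      ultimately show ?thesis using P openin_trans_full by fastforce
    qed
    have "hol (subspace_of (affine_plane_curve weierstrass) (points (affine_plane_curve weierstrass) - {})) V f
        \<longleftrightarrow> locally_hol affine_space V f"
      using locally_hol_subspace_of[OF is_sheaf_affine_space, of V C f] VC
      unfolding affine_plane_curve_def C_def by simp
    also have "\<dots> \<longleftrightarrow> hol elliptic Q (f \<circ> of_cubic)"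
    proof
      assume l: "locally_hol affine_space V f"
      have "locally_hol elliptic Q (f \<circ> of_cubic)"
        unfolding locally_hol_def
      proof
        fix p assume p: "p \<in> Q"
        then obtain v where v: "v \<in> cubic_cone" "v $ 3 \<noteq> 0" "p = proj_point v"
          unfolding Q_def P_def affine_points by blast
        obtain W \<psi> i j U where chart: "cubic_chart W \<psi> i j U" "v \<in> U"
          and j: "v $ 3 \<noteq> 0 \<Longrightarrow> j = 3 \<and> (\<forall>z\<in>W. \<psi> z $ 3 = 1)" using ex_cubic_chart[OF v(1)] by blast
        note c = cubic_chartD[OF chart(1)]
        have \<psi>3: "\<psi> z $ 3 = 1" if "z \<in> W" for z using j v(2) that by blast
        define R where "R = Q \<inter> proj_point ` (U \<inter> cubic_cone)"
        have R: "openin (topo elliptic) R"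
          unfolding R_def using Q openin_elliptic_chart_domain[OF c(2,8)] by blast
        define WR where "WR = {z \<in> W. proj_point (\<psi> z) \<in> R}"
        have WR: "open WR" unfolding WR_def using cubic_chart_open_preimage[OF chart(1) R] .
        define \<gamma> where "\<gamma> z = of_cubic (proj_point (\<psi> z))" for z
        have hol_\<gamma>: "(\<lambda>z. \<gamma> z $ n) holomorphic_on WR" for n
        proof -
          have h: "(\<lambda>z. \<psi> z $ m) holomorphic_on WR" for m
            using c(3) by (rule holomorphic_on_subset) (auto simp: WR_def)
          have r: "ratio m 3 (proj_point (\<psi> z)) = \<psi> z $ m" if "z \<in> WR" for z m
            using ratio_proj_point[OF cubic_cone_nonzero[OF c(5)]] \<psi>3 that unfolding WR_def by simp
          have "(\<lambda>z. 64 * \<psi> z $ 1 - 17) holomorphic_on WR" by (intro holomorphic_intros h)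
          then have 1: "(\<lambda>z. \<gamma> z $ 1) holomorphic_on WR"
            by (rule holomorphic_transform) (simp add: \<gamma>_def r)
          have "(\<lambda>z. 32 * \<psi> z $ 2 - 32 * \<psi> z $ 1 + 8) holomorphic_on WR"
            by (intro holomorphic_intros h)
          then have 2: "(\<lambda>z. \<gamma> z $ 2) holomorphic_on WR"
            by (rule holomorphic_transform) (simp add: \<gamma>_def r)
          show ?thesis using exhaust_2[of n] 1 2 by auto
        qed
        have cont_\<gamma>: "continuous_on WR \<gamma>"
          using continuous_on_vec_lambda[of WR "\<lambda>n z. \<gamma> z $ n"] holomorphic_on_imp_continuous_on[OF hol_\<gamma>]
          by (simp add: vec_lambda_eta)
        have "(\<lambda>z. (f \<circ> of_cubic) (proj_point (\<psi> z))) field_differentiable at z" if z: "z \<in> WR" for z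
        proof -
          have "\<gamma> z \<in> V" using z unfolding WR_def R_def Q_def \<gamma>_def by auto
          then obtain T F where T: "open T" "\<gamma> z \<in> T" "\<forall>x\<in>T. cdiff_at F x" "\<forall>q\<in>V \<inter> T. f q = F q"
            using l unfolding locally_hol_def by auto
          have op: "open (WR \<inter> \<gamma> -` T)" using cont_\<gamma> WR T(1) by (rule continuous_open_preimage)
          have zT: "z \<in> WR \<inter> \<gamma> -` T" using z T(2) by simp
          have eq: "F (\<gamma> w) = (f \<circ> of_cubic) (proj_point (\<psi> w))" if "w \<in> WR \<inter> \<gamma> -` T" for w
          proof -
            have "\<gamma> w \<in> V \<inter> T" using that unfolding WR_def R_def Q_def \<gamma>_def by auto
            then show ?thesis using T(4) unfolding \<gamma>_def by simp
          qed
          have "(\<lambda>z. F (\<gamma> z)) field_differentiable at z"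
          proof (rule cdiff_at_curve)
            show "cdiff_at F (\<gamma> z)" using T(2,3) by blast
            show "(\<lambda>z. \<gamma> z $ n) field_differentiable at z" for n
              using hol_\<gamma> WR z by (rule holomorphic_on_imp_differentiable_at)
          qed
          then obtain D where "((\<lambda>z. F (\<gamma> z)) has_field_derivative D) (at z)"
            unfolding field_differentiable_def by blast
          then have "((\<lambda>z. (f \<circ> of_cubic) (proj_point (\<psi> z))) has_field_derivative D) (at z)"
            using op zT eq by (rule has_field_derivative_transform_within_open)
          then show ?thesis unfolding field_differentiable_def by blast
        qed
        then have "(\<lambda>z. (f \<circ> of_cubic) (proj_point (\<psi> z))) holomorphic_on WR"
          by (auto simp: holomorphic_on_def intro: field_differentiable_at_within)
        then have "hol elliptic R (f \<circ> of_cubic)"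
          using hol_elliptic_of_chart[OF chart(1) R] unfolding WR_def R_def by blast
        moreover have "p \<in> R" unfolding R_def using p v chart(2) by blast
        ultimately show "\<exists>V F. openin (topo elliptic) V \<and> p \<in> V \<and> hol elliptic V F
            \<and> (\<forall>q\<in>Q \<inter> V. (f \<circ> of_cubic) q = F q)"
          using R by blast
      qed
      then show "hol elliptic Q (f \<circ> of_cubic)" using is_sheafD[OF is_sheaf_elliptic Q] by blast
    next
      assume h: "hol elliptic Q (f \<circ> of_cubic)"
      show "locally_hol affine_space V f"
        unfolding locally_hol_def
      proof
        fix v0 assume v0: "v0 \<in> V"
        then have c0: "to_cubic v0 \<in> cubic_cone" using VC C_cubic by blast
        obtain W \<psi> i j U where chart: "cubic_chart W \<psi> i j U" "to_cubic v0 \<in> U"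
          and "to_cubic v0 $ 3 \<noteq> 0 \<Longrightarrow> j = 3 \<and> (\<forall>z\<in>W. \<psi> z $ 3 = 1)" using ex_cubic_chart[OF c0] by blast
        then have j: "j = 3" by (simp add: to_cubic_def)
        note c = cubic_chartD[OF chart(1)]
        have to3: "to_cubic v $ i / to_cubic v $ j = to_cubic v $ i" for v
          unfolding j by (simp add: to_cubic_def)
        define WQ where "WQ = {z \<in> W. proj_point (\<psi> z) \<in> Q}"
        have WQ: "open WQ" unfolding WQ_def using cubic_chart_open_preimage[OF chart(1) Q] .
        define g where "g z = f (of_cubic (proj_point (\<psi> z)))" for z
        have g: "g holomorphic_on WQ"
          using holomorphic_in_chart[OF chart(1) Q h] unfolding g_def WQ_def by simp
        define T where "T = to_cubic -` U \<inter> (\<lambda>v. to_cubic v $ i) -` WQ"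
        have "open T" unfolding T_def
          using c(2) WQ by (intro open_Int open_vimage continuous_on_to_cubic continuous_intros)
        moreover have V_to: "proj_point (to_cubic v) = proj_point (\<psi> (to_cubic v $ i)) \<and> to_cubic v $ i \<in> W"
          if "v \<in> V" "to_cubic v \<in> U" for v
          using c(9,10)[OF that(2)] C_cubic[of v] VC that(1) unfolding to3 by blast
        have "v0 \<in> T"
        proof -
          have "proj_point (to_cubic v0) \<in> Q"
            unfolding Q_def using to_P v0 VC of_cubic_to_cubic by auto
          then show ?thesis using V_to[OF v0 chart(2)] chart(2) unfolding T_def WQ_def by simp
        qed
        moreover have "cdiff_at (\<lambda>v. g (to_cubic v $ i)) v" if "v \<in> T" for v
          using that cdiff_at_to_cubic holomorphic_on_imp_differentiable_at[OF g WQ] unfolding T_def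
          by (intro cdiff_at_compose[where g = g]) auto
        moreover have "f v = g (to_cubic v $ i)" if "v \<in> V \<inter> T" for v
          using V_to[of v] that of_cubic_to_cubic[of v] unfolding T_def g_def by simp
        ultimately show "\<exists>T F. openin (topo affine_space) T \<and> v0 \<in> T \<and> hol affine_space T F
            \<and> (\<forall>q\<in>V \<inter> T. f q = F q)"
          by (intro exI[of _ T] exI[of _ "\<lambda>v. g (to_cubic v $ i)"]) auto
      qed
    qed
    also have "\<dots> \<longleftrightarrow> hol (subspace_of elliptic P) Q (f \<circ> of_cubic)"
      using is_sheafD[OF is_sheaf_elliptic Q] by simp
    also have "Q = {x \<in> points (subspace_of elliptic P). of_cubic x \<in> V}"
      unfolding Q_def by (simp add: pts)
    finally show ?thesis .
  qed
  show ?thesis unfolding isomorphic_def P_def[symmetric] using homeo holo by blast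
qed

end

section \<open>Quotients with the same fibres\<close>

text \<open>Both structures depend on \<open>X\<close> and the fibres alone. This exchanges the set
  of orbits for the set of lines in C^3.\<close>

lemma isomorphic_quotients:
  assumes X: "is_sheaf X"
    and fibres: "\<And>x y. x \<in> points X \<Longrightarrow> y \<in> points X \<Longrightarrow> \<pi> x = \<pi> y \<longleftrightarrow> \<rho> x = \<rho> y"
  shows "isomorphic (quotient_of X \<pi>) (quotient_of X \<rho>)"
proof -
  define h where "h q = \<rho> (inv_into (points X) \<pi> q)" for q
  define h' where "h' q = \<pi> (inv_into (points X) \<rho> q)" for q
  have h: "h (\<pi> x) = \<rho> x" if "x \<in> points X" for x
    unfolding h_def using fibres that by (metis f_inv_into_f image_eqI inv_into_into)
  have h': "h' (\<rho> x) = \<pi> x" if "x \<in> points X" for x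
    unfolding h'_def using fibres that by (metis f_inv_into_f image_eqI inv_into_into)
  have "homeomorphic_maps (topo (quotient_of X \<pi>)) (topo (quotient_of X \<rho>)) h h'"
    unfolding homeomorphic_maps_def topo_quotient_of
  proof (intro conjI ballI)
    have "continuous_map (topo X) (quotient_topology (topo X) \<rho>) (h \<circ> \<pi>)"
      using quotient_imp_continuous_map[OF quotient_map_quotient_topology[of "topo X" \<rho>]]
      by (rule continuous_map_eq) (simp add: h)
    then show "continuous_map (quotient_topology (topo X) \<pi>) (quotient_topology (topo X) \<rho>) h"
      by (rule continuous_compose_quotient_map[OF quotient_map_quotient_topology])
    have "continuous_map (topo X) (quotient_topology (topo X) \<pi>) (h' \<circ> \<rho>)"
      using quotient_imp_continuous_map[OF quotient_map_quotient_topology[of "topo X" \<pi>]]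
      by (rule continuous_map_eq) (simp add: h')
    then show "continuous_map (quotient_topology (topo X) \<rho>) (quotient_topology (topo X) \<pi>) h'"
      by (rule continuous_compose_quotient_map[OF quotient_map_quotient_topology])
  qed (auto simp: h h')
  moreover have "hol (quotient_of X \<rho>) V f \<longleftrightarrow> hol (quotient_of X \<pi>) {x \<in> points (quotient_of X \<pi>). h x \<in> V} (f \<circ> h)"
    if V: "openin (topo (quotient_of X \<rho>)) V" for V f
  proof -
    define U where "U = {x \<in> points X. \<rho> x \<in> V}"
    have U: "openin (topo X) U" using V unfolding U_def by (simp add: openin_quotient_topology)
    have eq: "{x \<in> points X. \<pi> x \<in> {q \<in> points (quotient_of X \<pi>). h q \<in> V}} = U"
      unfolding U_def by (auto simp: h fibres)
    \<comment> \<open>The two pullbacks agree on \<open>U\<close> only; that \<open>hol\<close>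
      ignores the values elsewhere comes from the sheaf condition.\<close>
    have "locally_hol X U (f \<circ> \<rho>) \<longleftrightarrow> locally_hol X U (f \<circ> h \<circ> \<pi>)"
      unfolding locally_hol_def by (simp add: U_def h)
    then show ?thesis
      using is_sheafD[OF X U] eq unfolding hol_quotient_of U_def[symmetric] by simp
  qed
  ultimately show ?thesis unfolding isomorphic_def homeomorphic_map_maps by blast
qed

lemma (in labelling) bring_quotient_isomorphic:
  "isomorphic (bring_quotient {p. p permutes {a, b, c, d} \<and> evenperm p}) elliptic"
  unfolding bring_quotient_def elliptic_def
proof (rule isomorphic_quotients)
  show "is_sheaf bring_curve"
    unfolding bring_curve_eq by (intro is_sheaf_subspace_of is_sheaf_projective_space)
  fix L M assume "L \<in> points bring_curve" "M \<in> points bring_curve"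
  then obtain x y where "x \<in> bring_cone" "y \<in> bring_cone" "L = proj_point x" "M = proj_point y" by auto
  then show "(\<lambda>p. permute_coords p L) ` {p. p permutes {a, b, c, d} \<and> evenperm p}
      = (\<lambda>p. permute_coords p M) ` {p. p permutes {a, b, c, d} \<and> evenperm p}
    \<longleftrightarrow> invariants ` L = invariants ` M"
    using orbit_eq_iff invariants_image_proj_point by simp
qed

section \<open>Subgroups of order 12 in the alternating group of degree 5\<close>

lemma group_alternating_group:
  fixes A :: "'a::finite set"
  shows "group (alternating_group A)"
proof (rule groupI)
  have perm: "permutation p" if "p permutes A" for p
    using that permutes_imp_permutation[of A p] by simp
  let ?G = "alternating_group A"
  show "x \<otimes>\<^bsub>?G\<^esub> y \<in> carrier ?G" if "x \<in> carrier ?G" "y \<in> carrier ?G" for x y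
    using that perm by (auto simp: alternating_group_def permutes_compose evenperm_comp)
  show "\<one>\<^bsub>?G\<^esub> \<in> carrier ?G" by (simp add: alternating_group_def permutes_id)
  show "x \<otimes>\<^bsub>?G\<^esub> y \<otimes>\<^bsub>?G\<^esub> z = x \<otimes>\<^bsub>?G\<^esub> (y \<otimes>\<^bsub>?G\<^esub> z)" for x y z
    by (simp add: alternating_group_def comp_assoc)
  show "\<one>\<^bsub>?G\<^esub> \<otimes>\<^bsub>?G\<^esub> x = x" for x by (simp add: alternating_group_def)
  show "\<exists>y\<in>carrier ?G. y \<otimes>\<^bsub>?G\<^esub> x = \<one>\<^bsub>?G\<^esub>" if "x \<in> carrier ?G" for x
    using that perm permutes_inv[of x A] permutes_inv_o(2)[of x A]
    by (intro bexI[of _ "inv' x"]) (auto simp: alternating_group_def evenperm_inv)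
qed

text \<open>Orbit lengths divide 12, so 5 is excluded. Without an orbit of length 1 there are two
  disjoint ones of length at least 2, hence one of length 2. An even permutation preserving that
  orbit is determined by its action on the other three points, which would leave at most 6
  elements.\<close>

lemma order_12_subgroup_fixes_point:
  fixes H :: "(5 \<Rightarrow> 5) set"
  assumes H: "subgroup H (alternating_group UNIV)" and card: "card H = 12"
  obtains k where "\<And>p. p \<in> H \<Longrightarrow> p k = k"
proof -
  define G where "G = (alternating_group (UNIV :: 5 set))\<lparr>carrier := H\<rparr>"
  have G: "group G" unfolding G_def
    using subgroup.subgroup_is_group[OF H group_alternating_group] .
  have Hp: "p permutes UNIV \<and> evenperm p" if "p \<in> H" for p
    using subgroup.subset[OF H] that by (auto simp: alternating_group_def)
  have bij: "p \<in> Bij UNIV" if "p \<in> H" for p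
    using Hp[OF that] permutes_bij by (auto simp: Bij_def)
  interpret group_action G UNIV "\<lambda>p. p"
  proof (unfold group_action_def, intro group_hom.intro G group_BijGroup group_hom_axioms.intro homI)
    show "p \<in> carrier (BijGroup UNIV)" if "p \<in> carrier G" for p
      using that bij by (simp add: G_def BijGroup_def)
    show "p \<otimes>\<^bsub>G\<^esub> q = p \<otimes>\<^bsub>BijGroup UNIV\<^esub> q" if "p \<in> carrier G" "q \<in> carrier G" for p q
      using that bij by (simp add: G_def BijGroup_def alternating_group_def compose_def o_def fun_eq_iff)
  qed
  define orb where "orb x = orbit G (\<lambda>p. p) x" for x
  have orb: "orb x = {p x | p. p \<in> H}" for x unfolding orb_def orbit_def G_def by simp
  have x_orb: "x \<in> orb x" for x unfolding orb_def by (simp add: orbit_refl)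
  have orb_eq: "orb y = orb x" if "y \<in> orb x" for x y
    using that orbit_sym[of x y] orbit_trans[of x y] orbit_trans[of y x] unfolding orb_def by blast
  have orb_disj: "orb x \<inter> orb y = {}" if "y \<notin> orb x" for x y
    using orb_eq that x_orb by blast
  have "order G = 12" using card by (simp add: G_def order_def)
  then have "card (orb x) dvd 12" for x
    using orbit_stabilizer_theorem[of x] unfolding orb_def by (metis UNIV_I dvd_triv_left)
  moreover have "card (orb x) \<le> 5" for x using card_mono[of UNIV "orb x"] by simp
  moreover have "card (orb x) \<noteq> 0" for x using x_orb by auto
  ultimately have "card (orb x) dvd 12 \<and> card (orb x) \<in> {1, 2, 3, 4, 5}" for x
    by (simp add: le_Suc_eq numeral_eq_Suc)
  then have cases: "card (orb x) \<in> {1, 2, 3, 4}" for x by force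
  have card_co: "card (- orb x) = 5 - card (orb x)" for x by (simp add: Compl_eq_Diff_UNIV card_Diff_subset)
  have sub: "card (orb y) \<le> 5 - card (orb x)" if "y \<notin> orb x" for x y
    using orb_disj[OF that] card_mono[of "- orb x" "orb y"] card_co[of x] by auto
  have "\<exists>x. card (orb x) = 1"
  proof (rule ccontr)
    assume n: "\<nexists>x. card (orb x) = 1"
    have ge: "2 \<le> card (orb x)" for x using n cases[of x] by auto
    have "\<exists>x. card (orb x) = 2"
    proof -
      define x :: 5 where "x = 0"
      have "card (- orb x) \<noteq> 0" using card_co[of x] cases[of x] by auto
      then have "- orb x \<noteq> {}" by auto
      then obtain y where "y \<notin> orb x" by blast
      then have "card (orb y) \<le> 5 - card (orb x)" by (rule sub)
      then have "card (orb x) = 2 \<or> card (orb y) = 2" using ge[of x] ge[of y] by linarith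
      then show ?thesis by blast
    qed
    then obtain x where x: "card (orb x) = 2" by blast
    then obtain u v where uv: "orb x = {u, v}" "u \<noteq> v" by (meson card_2_iff)
    define T where "T = - orb x"
    have T: "card T = 3" using card_co[of x] x unfolding T_def by simp
    have inv: "p y \<in> orb x \<longleftrightarrow> y \<in> orb x" if "p \<in> H" for p y
    proof -
      have "p y \<in> orb y" unfolding orb using that by blast
      then show ?thesis using orb_eq x_orb by metis
    qed
    define r where "r p = (\<lambda>i. if i \<in> T then p i else i)" for p
    have "r p permutes T" if p: "p \<in> H" for p
    proof -
      have "inj p" using Hp[OF p] permutes_inj by blast
      then have "inj_on (r p) T" unfolding r_def inj_on_def by simp
      moreover have "r p ` T \<subseteq> T" unfolding r_def T_def using inv[OF p] by auto
      ultimately have "bij_betw (r p) T T"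
        by (simp add: bij_betw_def endo_inj_surj)
      then show ?thesis by (intro bij_imp_permutes) (auto simp: r_def)
    qed
    moreover have "inj_on r H"
    proof (rule inj_onI, rule ccontr)
      fix p q assume pq: "p \<in> H" "q \<in> H" "r p = r q" "p \<noteq> q"
      have T: "p i = q i" if "i \<in> T" for i using fun_cong[OF pq(3), of i] that unfolding r_def by simp
      have S: "p u \<in> {u, v}" "p v \<in> {u, v}" "q u \<in> {u, v}" "q v \<in> {u, v}"
        using inv[OF pq(1)] inv[OF pq(2)] uv by auto
      have "inj p" "inj q" using Hp[OF pq(1)] Hp[OF pq(2)] permutes_inj by blast+
      then have ne: "p u \<noteq> p v" "q u \<noteq> q v" using uv(2) by (auto dest: injD)
      have swap: "p u = q v" "p v = q u"
      proof -
        have "\<not> (p u = q u \<and> p v = q v)"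
        proof
          assume "p u = q u \<and> p v = q v"
          then have "p i = q i" for i using T[of i] uv(1) unfolding T_def by (cases "i \<in> orb x") auto
          then show False using pq(4) by blast
        qed
        then show "p u = q v" "p v = q u" using S ne by auto
      qed
      \<comment> \<open>Distinct elements with the same action on \<open>T\<close> differ by
        exchanging the two points of the orbit, which changes the parity.\<close>
      have "p = q \<circ> Transposition.transpose u v"
      proof
        fix i show "p i = (q \<circ> Transposition.transpose u v) i"
          using swap T[of i] uv(1) unfolding T_def by (cases "i = u"; cases "i = v") (auto simp: Transposition.transpose_def)
      qed
      then have "evenperm p \<longleftrightarrow> \<not> evenperm q"
        using Hp[OF pq(2)] uv(2) permutes_imp_permutation[of UNIV q]
        by (simp add: evenperm_comp permutation_swap_id evenperm_swap)
      then show False using Hp pq by blast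
    qed
    ultimately have "card H \<le> card {p. p permutes T}"
      by (intro card_inj_on_le[of r]) (auto simp: finite_permutations)
    also have "\<dots> = fact 3" using card_permutations[OF T] by simp
    finally show False using card by (simp add: fact_numeral)
  qed
  then obtain k where k: "card (orb k) = 1" by blast
  then obtain l where "orb k = {l}" by (meson card_1_singletonE)
  then have "p k = k" if "p \<in> H" for p using x_orb[of k] that unfolding orb by auto
  then show thesis using that by blast
qed

text \<open>The subgroup lies in the even permutations of the four points other than the fixed one,
  and counting gives equality.\<close>

lemma alt_4_subgroup_is_point_stabilizer:
  fixes H :: "(5 \<Rightarrow> 5) set"
  assumes H: "subgroup H (alternating_group UNIV)"
    and iso: "(alternating_group UNIV)\<lparr>carrier := H\<rparr> \<cong> alt_group 4"
  obtains a b c d k where "UNIV = {a, b, c, d, k}" "distinct [a, b, c, d, k]"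
    "H = {p. p permutes {a, b, c, d} \<and> evenperm p}"
proof -
  obtain h where "bij_betw h H (carrier (alt_group 4))"
    using iso unfolding is_iso_def iso_def by auto
  then have "card H = card (carrier (alt_group 4))" by (rule bij_betw_same_card)
  then have card: "card H = 12"
    using alt_group_card_carrier[of 4] by (simp add: fact_numeral)
  obtain k where k: "\<And>p. p \<in> H \<Longrightarrow> p k = k" using order_12_subgroup_fixes_point[OF H card] by blast
  have "card (UNIV - {k}) = 4" by simp
  then obtain xs where xs: "distinct xs" "set xs = UNIV - {k}" "length xs = 4"
    by (metis distinct_card finite finite_distinct_list)
  then obtain a b c d where abcd: "xs = [a, b, c, d]"
    by (auto simp: length_Suc_conv numeral_eq_Suc)
  define G where "G = {p. p permutes {a, b, c, d} \<and> evenperm p}"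
  have "H \<subseteq> G"
  proof
    fix p assume p: "p \<in> H"
    then have "p permutes UNIV" "evenperm p"
      using subgroup.subset[OF H] by (auto simp: alternating_group_def)
    moreover have "{a, b, c, d} = UNIV - {k}" using xs abcd by simp
    then have "i = k" if "i \<notin> {a, b, c, d}" for i using that by auto
    ultimately show "p \<in> G" using k[OF p] unfolding G_def permutes_def by auto
  qed
  moreover have "card G \<le> 12"
  proof -
    \<comment> \<open>Composing with a transposition carries \<open>G\<close> into the odd
      permutations, so \<open>G\<close> makes up at most half of the 24 permutations.\<close>
    let ?t = "Transposition.transpose a b"
    have t: "?t permutes {a, b, c, d}" "\<not> evenperm ?t"
      using xs(1) abcd by (auto simp: evenperm_swap intro: permutes_swap_id)
    have perm: "permutation p" if "p \<in> G" for p
      using that permutes_imp_permutation[of "{a, b, c, d}" p] unfolding G_def by simp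
    have fin: "finite {p. p permutes {a, b, c, d}}" by (rule finite_permutations) simp
    have odd: "\<not> evenperm (?t \<circ> p)" if "p \<in> G" for p
      using that t(2) perm[OF that] unfolding G_def by (simp add: evenperm_comp permutation_swap_id)
    have "(\<lambda>p. ?t \<circ> p) ` G \<inter> G = {}" using odd unfolding G_def by blast
    moreover have "inj_on (\<lambda>p. ?t \<circ> p) G"
      by (rule inj_onI) (metis comp_assoc id_comp swap_id_idempotent transpose_comp_involutory)
    then have "card ((\<lambda>p. ?t \<circ> p) ` G) = card G" by (rule card_image)
    moreover have "finite G" using fin unfolding G_def by (rule rev_finite_subset) auto
    ultimately have "2 * card G = card ((\<lambda>p. ?t \<circ> p) ` G \<union> G)"
      by (simp add: card_Un_disjoint)
    also have "\<dots> \<le> card {p. p permutes {a, b, c, d}}"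
      using fin t(1) unfolding G_def by (intro card_mono) (auto intro: permutes_compose)
    also have "\<dots> = fact 4" using xs(1) abcd by (intro card_permutations) auto
    finally show ?thesis by (simp add: fact_numeral)
  qed
  moreover have "finite G" by (rule finite_subset[OF subset_UNIV]) simp
  ultimately have "H = G" using card by (intro card_seteq) auto
  moreover have "UNIV = {a, b, c, d, k}" using xs abcd by auto
  moreover have "distinct [a, b, c, d, k]" using xs abcd by auto
  ultimately show thesis using that unfolding G_def by blast
qed

section \<open>The quotient by the alternating group on four letters\<close>

theorem proposition7p4:
  fixes H :: "(5 \<Rightarrow> 5) set"
  assumes "subgroup H (alternating_group UNIV)"
    and "(alternating_group UNIV)\<lparr>carrier := H\<rparr> \<cong> alt_group 4"
  shows "\<exists>E :: (complex^3) set fun_space.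
    smooth_projective_model E
      (affine_plane_curve (\<lambda>x y. y^2 + x * y + y = x^3 + 549 * x - 2202)) \<and>
    isomorphic (bring_quotient H) E"
proof -
  obtain a b c d k where labels: "UNIV = {a, b, c, d, k}" "distinct [a, b, c, d, k]"
    and H: "H = {p. p permutes {a, b, c, d} \<and> evenperm p}"
    using alt_4_subgroup_is_point_stabilizer[OF assms] .
  interpret labelling a b c d k using labels by unfold_locales
  have "smooth_projective_model elliptic (affine_plane_curve weierstrass)"
    unfolding smooth_projective_model_def
    using compact_riemann_surface_elliptic elliptic_affine_isomorphic
    by (intro conjI exI[of _ "{proj_point (vec3 0 1 0)}"] exI[of _ "{}"]) simp_all
  then show ?thesis using bring_quotient_isomorphic unfolding H by blast
qed

end
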